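(* Let $c>0$, $\sigma>0$, $\rho=\sigma^2/c$, let $n\ge0$ be an integer, $\gamma=-nc$ and $r=\lfloor n/2\rfloor$. Let $A_3$ be the three-dimensional Ornstein-Uhlenbeck operator (generator in $L^2_\mu$) with differential expression $$A_3=(-cx+y)\frac{\partial}{\partial x}+(-cy+z)\frac{\partial}{\partial y}-cz\frac{\partial}{\partial z}+\sigma^2\Big(\frac{\partial^2}{\partial x^2}+\frac{\partial^2}{\partial y^2}+\frac{\partial^2}{\partial z^2}\Big).$$ Let $q_k=2n+1-4k$ for $k=0,1,\dots,r$. Then there exist $\{f_k: k=0,\dots,r\}$ such that $$\{f_k,(\gamma-A_3)f_k,\dots,(\gamma-A_3)^{q_k-1}f_k:\ k=0,\dots,r\}$$ is a basis of the spectral subspace associated to $\gamma$, and such that, setting $h_k=(\gamma-A_3)^{q_k-1}f_k$, the family $\{h_k: k=0,1,\dots,r\}$ is a basis of the eigenspace of the eigenvalue $\gamma$ and satisfies $$\mathcal Q_nh_k=\sum_{i=0}^{k}(-2)^{k-i}\binom{k}{i}H_{k-i}(x)H_{2i}(y)H_{n-k-i}(z),\qquad k=0,1,\dots,r.$$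
   Context: Hermite polynomials (with parameter $\rho$): $H_0=1$ and $H_m(x)=(-\rho)^m e^{x^2/(2\rho)}\frac{d^m}{dx^m}e^{-x^2/(2\rho)}$ for $m\ge1$. Let $\mathcal P$ be the space of real polynomials in $(x,y,z)$ and $\mathcal H_m'=\mathrm{span}\{H_i(x)H_j(y)H_k(z): i+j+k=m\}$. Then $\mathcal P$ is the direct sum of the $\mathcal H_m'$, $m\ge0$, and $\mathcal Q_m$ denotes the canonical projection of $\mathcal P$ onto $\mathcal H_m'$ along this decomposition. Operator: let $B=\begin{bmatrix}-c&1&0\\0&-c&1\\0&0&-c\end{bmatrix}$ and $Q_t=\sigma^2\int_0^te^{sB}e^{sB^*}\,ds$, where $B^*$ is the transpose of $B$. The Ornstein-Uhlenbeck semigroup is $(T(t)f)(x)=\frac{1}{(4\pi)^{3/2}(\det Q_t)^{1/2}}\int_{\mathbb R^3}e^{-\langle Q_t^{-1}y,y\rangle/4}f(e^{tB}x-y)\,dy$ for $t>0$, $T(0)=\mathrm{Id}$. It has a unique invariant probability measure $\mu$ and extends to a strongly continuous contraction semigroup on the real Hilbert space $L^2_\mu=L^2(\mathbb R^3,d\mu)$; its generator is $A_3$. Polynomials lie in the domain of $A_3$, and on them $A_3$ acts as the displayed differential expression. It is known that the spectrum of $A_3$ is $\{-nc:n=0,1,2,\dots\}$ and that all generalised eigenfunctions are polynomials. The spectral subspace associated to $\gamma=-nc$ is $\mathrm{Ker}\,(\gamma-A_3)^{\nu}$, where $\nu=1+2n$ is the index of the eigenvalue $\gamma$. The eigenspace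 is $\mathrm{Ker}(\gamma-A_3)$. *)

theory Defs
  imports "HOL-Analysis.Analysis"
begin

section \<open>Hermite polynomials and the projections onto their spans\<close>

definition Hermite :: "real \<Rightarrow> nat \<Rightarrow> real \<Rightarrow> real" where
  "Hermite \<rho> m x =
     (- \<rho>) ^ m * exp (x\<^sup>2 / (2 * \<rho>)) * (deriv ^^ m) (\<lambda>u. exp (- (u\<^sup>2) / (2 * \<rho>))) x"

text \<open>Real polynomials in $(x,y,z)$ are identified with the polynomial functions on
  \<^typ>\<open>real ^ 3\<close> (\<^const>\<open>real_polynomial_function\<close>). The sum below runs over a finite index set,
  so this is the linear span of the products of total index \<open>m\<close>.\<close>

definition Hermite_space :: "real \<Rightarrow> nat \<Rightarrow> (real ^ 3 \<Rightarrow> real) set" where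
  "Hermite_space \<rho> m =
     {p. \<exists>a :: nat \<Rightarrow> nat \<Rightarrow> nat \<Rightarrow> real.
           p = (\<lambda>v. \<Sum>(i, j, k) \<in> {(i, j, k). i + j + k = m}.
                  a i j k * (Hermite \<rho> i (v $ 1) * Hermite \<rho> j (v $ 2) * Hermite \<rho> k (v $ 3)))}"

text \<open>The projection onto the \<open>m\<close>-th summand of the direct sum decomposition of the polynomials
  into the spaces \<^const>\<open>Hermite_space\<close>; it is meaningful for polynomial functions \<open>p\<close> only.\<close>

definition Hermite_proj :: "real \<Rightarrow> nat \<Rightarrow> (real ^ 3 \<Rightarrow> real) \<Rightarrow> (real ^ 3 \<Rightarrow> real)" where
  "Hermite_proj \<rho> m p =
     (THE q. \<exists>g. (\<forall>j. g j \<in> Hermite_space \<rho> j) \<and> finite {j. g j \<noteq> (\<lambda>_. 0)} \<and>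
                 p = (\<lambda>v. \<Sum>j | g j \<noteq> (\<lambda>_. 0). g j v) \<and> q = g m)"


section \<open>The Ornstein-Uhlenbeck semigroup on bounded Borel functions\<close>

definition mat_exp :: "real ^ 'n ^ 'n \<Rightarrow> real ^ 'n ^ 'n" where
  "mat_exp A = (\<Sum>k. (1 / fact k) *\<^sub>R (((**) A) ^^ k) (mat 1))"

definition OU_B :: "real \<Rightarrow> real ^ 3 ^ 3" where
  "OU_B c = vector [vector [- c, 1, 0], vector [0, - c, 1], vector [0, 0, - c]]"

text \<open>The drift vector field \<open>v \<mapsto> B v\<close>: together with the diffusion matrix \<open>\<sigma>\<^sup>2 I\<close> it gives the
  differential expression
  $(-cx+y)\partial_x + (-cy+z)\partial_y - cz\,\partial_z
    + \sigma^2(\partial_x^2+\partial_y^2+\partial_z^2)$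
  of the generator defined below.\<close>

lemma OU_B_mult_vec:
  "OU_B c *v v = vector [- c * v $ 1 + v $ 2, - c * v $ 2 + v $ 3, - c * v $ 3]"
  by (simp add: OU_B_def vec_eq_iff forall_3 matrix_vector_mult_def sum_3)

definition OU_Q :: "real \<Rightarrow> real \<Rightarrow> real \<Rightarrow> real ^ 3 ^ 3" where
  "OU_Q c \<sigma> t =
     \<sigma>\<^sup>2 *\<^sub>R integral {0..t} (\<lambda>s. mat_exp (s *\<^sub>R OU_B c) ** mat_exp (s *\<^sub>R transpose (OU_B c)))"

definition OU_semigroup ::
  "real \<Rightarrow> real \<Rightarrow> real \<Rightarrow> (real ^ 3 \<Rightarrow> real) \<Rightarrow> (real ^ 3 \<Rightarrow> real)" where
  "OU_semigroup c \<sigma> t f x =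
     (if t = 0 then f x
      else 1 / ((4 * pi) powr (3 / 2) * sqrt (det (OU_Q c \<sigma> t))) *
           (\<integral>y. exp (- ((matrix_inv (OU_Q c \<sigma> t) *v y) \<bullet> y) / 4) *
                 f (mat_exp (t *\<^sub>R OU_B c) *v x - y) \<partial>lborel))"

definition bounded_Borel :: "(real ^ 3 \<Rightarrow> real) set" where
  "bounded_Borel = {f. f \<in> borel_measurable borel \<and> bounded (range f)}"

definition OU_invariant :: "real \<Rightarrow> real \<Rightarrow> (real ^ 3) measure \<Rightarrow> bool" where
  "OU_invariant c \<sigma> \<mu> \<longleftrightarrow>
     sets \<mu> = sets borel \<and> emeasure \<mu> UNIV = 1 \<and>
     (\<forall>t\<ge>0. \<forall>f\<in>bounded_Borel. (\<integral>x. OU_semigroup c \<sigma> t f x \<partial>\<mu>) = (\<integral>x. f x \<partial>\<mu>))"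


section \<open>The semigroup and its generator on $L^2_\mu$\<close>

text \<open>Elements of $L^2_\mu$ are represented by square-integrable functions; all notions below are
  invariant under modification on \<open>\<mu>\<close>-null sets, and operators select some representative of
  their value.\<close>

definition L2 :: "(real ^ 3) measure \<Rightarrow> (real ^ 3 \<Rightarrow> real) set" where
  "L2 \<mu> = {f. f \<in> borel_measurable \<mu> \<and> integrable \<mu> (\<lambda>x. (f x)\<^sup>2)}"

text \<open>The squared norm. With values in \<^typ>\<open>ennreal\<close> it is \<open>\<infinity>\<close>, rather than \<open>0\<close>, for measurable
  functions that are not square-integrable.\<close>

definition L2_norm_sq :: "(real ^ 3) measure \<Rightarrow> (real ^ 3 \<Rightarrow> real) \<Rightarrow> ennreal" where
  "L2_norm_sq \<mu> f = (\<integral>\<^sup>+x. ennreal ((f x)\<^sup>2) \<partial>\<mu>)"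

text \<open>The extension by continuity from bounded Borel functions to $L^2_\mu$. It exists and is
  independent of the approximating sequence, because \<^const>\<open>OU_semigroup\<close> is a contraction for the
  $L^2_\mu$ norm and bounded functions are dense.\<close>

definition OU_L2 ::
  "real \<Rightarrow> real \<Rightarrow> (real ^ 3) measure \<Rightarrow> real \<Rightarrow> (real ^ 3 \<Rightarrow> real) \<Rightarrow> (real ^ 3 \<Rightarrow> real)" where
  "OU_L2 c \<sigma> \<mu> t f =
     (SOME g. g \<in> L2 \<mu> \<and>
        (\<exists>\<phi>. (\<forall>i::nat. \<phi> i \<in> bounded_Borel) \<and>
             (\<lambda>i. L2_norm_sq \<mu> (\<lambda>x. \<phi> i x - f x)) \<longlonglongrightarrow> 0 \<and>
             (\<lambda>i. L2_norm_sq \<mu> (\<lambda>x. OU_semigroup c \<sigma> t (\<phi> i) x - g x)) \<longlonglongrightarrow> 0))"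

definition OU_gen_rel ::
  "real \<Rightarrow> real \<Rightarrow> (real ^ 3) measure \<Rightarrow> (real ^ 3 \<Rightarrow> real) \<Rightarrow> (real ^ 3 \<Rightarrow> real) \<Rightarrow> bool" where
  "OU_gen_rel c \<sigma> \<mu> f g \<longleftrightarrow>
     f \<in> L2 \<mu> \<and> g \<in> L2 \<mu> \<and>
     ((\<lambda>t. L2_norm_sq \<mu> (\<lambda>x. (OU_L2 c \<sigma> \<mu> t f x - f x) / t - g x)) \<longlongrightarrow> 0) (at_right 0)"

definition OU_dom :: "real \<Rightarrow> real \<Rightarrow> (real ^ 3) measure \<Rightarrow> (real ^ 3 \<Rightarrow> real) set" where
  "OU_dom c \<sigma> \<mu> = {f. \<exists>g. OU_gen_rel c \<sigma> \<mu> f g}"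

definition OU_gen ::
  "real \<Rightarrow> real \<Rightarrow> (real ^ 3) measure \<Rightarrow> (real ^ 3 \<Rightarrow> real) \<Rightarrow> (real ^ 3 \<Rightarrow> real)" where
  "OU_gen c \<sigma> \<mu> f = (SOME g. OU_gen_rel c \<sigma> \<mu> f g)"

definition OU_shift ::
  "real \<Rightarrow> real \<Rightarrow> (real ^ 3) measure \<Rightarrow> real \<Rightarrow> (real ^ 3 \<Rightarrow> real) \<Rightarrow> (real ^ 3 \<Rightarrow> real)" where
  "OU_shift c \<sigma> \<mu> \<gamma> f = (\<lambda>x. \<gamma> * f x - OU_gen c \<sigma> \<mu> f x)"

text \<open>$\mathrm{Ker}\,(\gamma - A_3)^\nu$, including the requirement that the argument lies in the
  domain of the power. The membership in \<^const>\<open>L2\<close> matters for \<open>\<nu> = 0\<close> only.\<close>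

definition OU_ker ::
  "real \<Rightarrow> real \<Rightarrow> (real ^ 3) measure \<Rightarrow> real \<Rightarrow> nat \<Rightarrow> (real ^ 3 \<Rightarrow> real) set" where
  "OU_ker c \<sigma> \<mu> \<gamma> \<nu> =
     {f \<in> L2 \<mu>. (\<forall>j<\<nu>. (OU_shift c \<sigma> \<mu> \<gamma> ^^ j) f \<in> OU_dom c \<sigma> \<mu>) \<and>
                (AE x in \<mu>. (OU_shift c \<sigma> \<mu> \<gamma> ^^ \<nu>) f x = 0)}"

definition OU_eigenspace :: 
  "real \<Rightarrow> real \<Rightarrow> (real ^ 3) measure \<Rightarrow> real \<Rightarrow> (real ^ 3 \<Rightarrow> real) set" where
  "OU_eigenspace c \<sigma> \<mu> \<gamma> = OU_ker c \<sigma> \<mu> \<gamma> 1"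

text \<open>The exponent \<open>1 + 2 * n\<close> is the index of the eigenvalue \<open>- n * c\<close>.\<close>

definition OU_spectral_subspace ::
  "real \<Rightarrow> real \<Rightarrow> (real ^ 3) measure \<Rightarrow> nat \<Rightarrow> (real ^ 3 \<Rightarrow> real) set" where
  "OU_spectral_subspace c \<sigma> \<mu> n = OU_ker c \<sigma> \<mu> (- (real n * c)) (1 + 2 * n)"

text \<open>A finite family \<open>v\<close> of vectors is a basis of a subspace \<open>S\<close> of $L^2_\mu$.\<close>

definition L2_basis ::
  "(real ^ 3) measure \<Rightarrow> 'i set \<Rightarrow> ('i \<Rightarrow> real ^ 3 \<Rightarrow> real) \<Rightarrow> (real ^ 3 \<Rightarrow> real) set \<Rightarrow> bool" where
  "L2_basis \<mu> I v S \<longleftrightarrow>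
     finite I \<and> (\<forall>i\<in>I. v i \<in> S) \<and>
     (\<forall>a. (AE x in \<mu>. (\<Sum>i\<in>I. a i * v i x) = 0) \<longrightarrow> (\<forall>i\<in>I. a i = 0)) \<and>
     (\<forall>g\<in>S. \<exists>a. AE x in \<mu>. g x = (\<Sum>i\<in>I. a i * v i x))"

end

theory Submission
  imports Defs "HOL-Computational_Algebra.Polynomial" "HOL-Probability.Probability" "HOL-Real_Asymp.Real_Asymp"
begin

text \<open>
  Everything is transported by the smoothing map \<open>G f \<zeta> = \<integral> f (x + \<zeta>) d\<mu>(x)\<close>. Invariance of \<open>\<mu>\<close> alone
  gives \<open>G (T(t) f) = G f \<circ> e\<^sup>t\<^sup>B\<close>, so \<open>G\<close> conjugates the semigroup to composition with a linear flow
  and the generator to the derivation along \<open>B\<zeta>\<close>, which on forms of degree \<open>n\<close> is \<open>- n c\<close> plus the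
  nilpotent derivation \<open>N = y \<partial>\<^sub>x + z \<partial>\<^sub>y\<close>. On forms of degree \<open>n\<close> the Jordan chains of \<open>N\<close> are
  generated by \<open>x\<^sup>m w\<^sup>k\<close> with \<open>w = y\<^sup>2 - 2 x z\<close>, \<open>m = n - 2 k\<close>; they have length \<open>2 m + 1\<close> and end in a
  multiple of \<open>z\<^sup>m w\<^sup>k\<close>. As \<open>G p - p\<close> has smaller degree than the polynomial \<open>p\<close>, these chains lift to
  polynomials with the same leading form, whose projection to the top Hermite space arises by
  replacing monomials with products of Hermite polynomials.

  Testing invariance on exponentials shows that \<open>\<mu>\<close> is Gaussian; hence its translates have
  square-integrable densities, \<open>G\<close> is defined on \<open>L\<^sup>2\<close>, and it is injective by uniqueness of Laplace
  transforms. If \<open>f\<close> is a generalised eigenfunction for \<open>- n c\<close>, then \<open>G f\<close> along the flow is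
  \<open>exp (- n c s)\<close> times a polynomial in \<open>s\<close>. Comparing with the Taylor expansion of \<open>G f\<close> at the fixed
  point \<open>0\<close> as \<open>s\<close> tends to infinity forces \<open>G f\<close> to be a form of degree \<open>n\<close>.
\<close>

section \<open>Homogeneous polynomials and Jordan chains\<close>

text \<open>The generator is only an L2 limit of difference quotients whose values are fixed up to
  null sets, so it cannot be computed pointwise. After smoothing, every function is defined and
  continuous everywhere, and the L2 limit turns into an ordinary derivative along the flow. The flow
  is a group, so the parameter s runs through the whole line although the semigroup runs forward
  only; this is what allows an ordinary differential equation in s.

  The lengths of the chains come from representation theory: N is the nilpotent element of sl2
  acting on its three-dimensional representation, w is the invariant quadratic form, and the forms
  of degree n split into w^k times the irreducible representation of dimension 2 (n - 2 k) + 1.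
  These dimensions add up to (n + 1) (n + 2) / 2. The coefficients in the claim are those of the
  binomial expansion of z^m (y^2 - 2 x z)^k.

  Invariance is given for bounded functions only, and exponentials are unbounded. Their integrals
  must be shown finite, by truncation, before invariance may be tested on them.\<close>

inductive_set lspan :: "('a \<Rightarrow> real) set \<Rightarrow> ('a \<Rightarrow> real) set" for S where
  zero: "(\<lambda>x. 0) \<in> lspan S"
| add_base: "f \<in> lspan S \<Longrightarrow> g \<in> S \<Longrightarrow> (\<lambda>x. f x + a * g x) \<in> lspan S"

lemma lspan_add:
  assumes "f \<in> lspan S" "g \<in> lspan S"
  shows "(\<lambda>x. f x + g x) \<in> lspan S"
  using assms(2,1)
proof (induction rule: lspan.induct)
  case (add_base g h a)
  then show ?case
    using lspan.add_base[of "\<lambda>x. f x + g x" S h a] by (simp add: add.assoc)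
qed simp

lemma lspan_scale:
  assumes "f \<in> lspan S"
  shows "(\<lambda>x. a * f x) \<in> lspan S"
  using assms
proof (induction rule: lspan.induct)
  case (add_base f g b)
  then show ?case
    using lspan.add_base[of "\<lambda>x. a * f x" S g "a * b"] by (simp add: algebra_simps)
qed (simp add: lspan.zero)

lemma lspan_base: "f \<in> S \<Longrightarrow> f \<in> lspan S"
  using lspan.add_base[OF lspan.zero, of f S 1] by simp

lemma lspan_diff: "f \<in> lspan S \<Longrightarrow> g \<in> lspan S \<Longrightarrow> (\<lambda>x. f x - g x) \<in> lspan S"
  using lspan_add[OF _ lspan_scale[of g S "-1"]] by simp

lemma lspan_sum:
  "(\<And>i. i \<in> I \<Longrightarrow> f i \<in> lspan S) \<Longrightarrow> (\<lambda>x. \<Sum>i\<in>I. f i x) \<in> lspan S"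
  by (induction I rule: infinite_finite_induct) (auto intro: lspan.zero lspan_add)

lemma lspan_subset:
  assumes "f \<in> lspan S" "\<And>g. g \<in> S \<Longrightarrow> g \<in> lspan T"
  shows "f \<in> lspan T"
  using assms(1)
proof induction
  case (add_base f g a)
  show ?case by (rule lspan_add[OF add_base.IH lspan_scale[OF assms(2)[OF add_base.hyps(2)]]])
qed (rule lspan.zero)

lemma lspan_mono: "f \<in> lspan S \<Longrightarrow> S \<subseteq> T \<Longrightarrow> f \<in> lspan T"
  by (erule lspan_subset) (auto intro: lspan_base)

lemma lspan_mult_left:
  assumes "f \<in> lspan S" "\<And>g. g \<in> S \<Longrightarrow> (\<lambda>x. h x * g x) \<in> lspan T"
  shows "(\<lambda>x. h x * f x) \<in> lspan T"
  using assms(1)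
proof induction
  case zero
  then show ?case by (simp add: lspan.zero)
next
  case (add_base f g a)
  then show ?case
    using lspan_add[OF add_base.IH lspan_scale[OF assms(2), of g a]]
    by (simp add: algebra_simps)
qed

lemma lspan_mult:
  assumes "f \<in> lspan S" "g \<in> lspan T"
    and "\<And>f g. f \<in> S \<Longrightarrow> g \<in> T \<Longrightarrow> (\<lambda>x. f x * g x) \<in> lspan U"
  shows "(\<lambda>x. f x * g x) \<in> lspan U"
proof -
  have "(\<lambda>x. h x * g x) \<in> lspan U" if "h \<in> S" for h
    by (rule lspan_mult_left[OF assms(2)]) (use assms(3) that in auto)
  then have "(\<lambda>x. g x * f x) \<in> lspan U"
    by (intro lspan_mult_left[OF assms(1)]) (auto simp: mult.commute)
  then show ?thesis by (simp add: mult.commute)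
qed

lemma lspan_image_coeffs:
  assumes "f \<in> lspan (v ` I)" "finite I"
  obtains a where "f = (\<lambda>x. \<Sum>i\<in>I. a i * v i x)"
proof -
  from assms(1) have "\<exists>a. f = (\<lambda>x. \<Sum>i\<in>I. a i * v i x)"
  proof induction
    case zero
    then show ?case by (intro exI[of _ "\<lambda>_. 0"]) simp
  next
    case (add_base f g b)
    then obtain a i where a: "f = (\<lambda>x. \<Sum>i\<in>I. a i * v i x)" and i: "i \<in> I" "g = v i" by auto
    have "f x + b * g x = (\<Sum>k\<in>I. (a k + (if k = i then b else 0)) * v k x)" for x
    proof -
      have "(\<Sum>k\<in>I. (if k = i then b else 0) * v k x) = (\<Sum>k\<in>I. if k = i then b * v k x else 0)"
        by (rule sum.cong) auto
      then show ?thesis using i assms(2) by (simp add: a distrib_right sum.distrib)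
    qed
    then show ?case by (intro exI[of _ "\<lambda>k. a k + (if k = i then b else 0)"]) auto
  qed
  then show thesis using that by blast
qed

section \<open>Forms of degree n and polynomials of degree below n\<close>

definition monom3 :: "nat \<Rightarrow> nat \<Rightarrow> nat \<Rightarrow> real ^ 3 \<Rightarrow> real" where
  "monom3 i j k v = v $ 1 ^ i * v $ 2 ^ j * v $ 3 ^ k"

definition hpoly :: "nat \<Rightarrow> (real ^ 3 \<Rightarrow> real) set" where
  "hpoly n = lspan {monom3 i j k | i j k. i + j + k = n}"

text \<open>The bound is strict: \<open>lpoly n\<close> is exactly what is discarded when only the
  leading form of degree \<open>n\<close> matters, and \<open>lpoly 0\<close> consists of the zero
  function, which starts inductions.\<close>

definition lpoly :: "nat \<Rightarrow> (real ^ 3 \<Rightarrow> real) set" where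
  "lpoly n = lspan {monom3 i j k | i j k. i + j + k < n}"

lemma monom3_hpoly: "i + j + k = n \<Longrightarrow> monom3 i j k \<in> hpoly n"
  unfolding hpoly_def by (rule lspan_base) blast

lemma monom3_lpoly: "i + j + k < n \<Longrightarrow> monom3 i j k \<in> lpoly n"
  unfolding lpoly_def by (rule lspan_base) blast

lemma hpoly_lpoly: "p \<in> hpoly m \<Longrightarrow> m < n \<Longrightarrow> p \<in> lpoly n"
  unfolding hpoly_def lpoly_def by (erule lspan_mono) auto

lemma lpoly_le: "p \<in> lpoly m \<Longrightarrow> m \<le> n \<Longrightarrow> p \<in> lpoly n"
  unfolding lpoly_def by (erule lspan_mono) (blast intro: less_le_trans)

lemma monom3_mult: "(\<lambda>v. monom3 i j k v * monom3 i' j' k' v) = monom3 (i + i') (j + j') (k + k')"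
  by (auto simp: monom3_def power_add)

lemma hpoly_mult:
  assumes "p \<in> hpoly m" "q \<in> hpoly n"
  shows "(\<lambda>v. p v * q v) \<in> hpoly (m + n)"
proof -
  have *: "(\<lambda>v. f v * g v) \<in> hpoly (m + n)"
    if "f \<in> {monom3 i j k | i j k. i + j + k = m}" "g \<in> {monom3 i j k | i j k. i + j + k = n}" for f g
  proof -
    from that obtain i j k i' j' k' where "f = monom3 i j k" "i + j + k = m"
      "g = monom3 i' j' k'" "i' + j' + k' = n" by blast
    then show ?thesis by (simp only: monom3_mult) (rule monom3_hpoly, linarith)
  qed
  show ?thesis using assms * unfolding hpoly_def by (rule lspan_mult)
qed

lemma hpoly_const: "(\<lambda>v. a) \<in> hpoly 0"
  using lspan_scale[OF monom3_hpoly[of 0 0 0 0, unfolded hpoly_def], of a]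
  by (simp add: monom3_def hpoly_def)

lemma hpoly_nth: "(\<lambda>v. v $ i) \<in> hpoly 1"
proof -
  have "monom3 1 0 0 \<in> hpoly 1" "monom3 0 1 0 \<in> hpoly 1" "monom3 0 0 1 \<in> hpoly 1"
    by (auto intro: monom3_hpoly)
  then show ?thesis using exhaust_3[of i] by (auto simp: monom3_def[abs_def])
qed

lemma hpoly_zero: "(\<lambda>v. 0) \<in> hpoly n" unfolding hpoly_def by (rule lspan.zero)
lemma hpoly_add: "p \<in> hpoly n \<Longrightarrow> q \<in> hpoly n \<Longrightarrow> (\<lambda>v. p v + q v) \<in> hpoly n"
  unfolding hpoly_def by (rule lspan_add)
lemma hpoly_diff: "p \<in> hpoly n \<Longrightarrow> q \<in> hpoly n \<Longrightarrow> (\<lambda>v. p v - q v) \<in> hpoly n"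
  unfolding hpoly_def by (rule lspan_diff)
lemma hpoly_scale: "p \<in> hpoly n \<Longrightarrow> (\<lambda>v. a * p v) \<in> hpoly n"
  unfolding hpoly_def by (rule lspan_scale)
lemma hpoly_sum: "(\<And>i. i \<in> I \<Longrightarrow> p i \<in> hpoly n) \<Longrightarrow> (\<lambda>v. \<Sum>i\<in>I. p i v) \<in> hpoly n"
  unfolding hpoly_def by (rule lspan_sum)

lemma lpoly_zero: "(\<lambda>v. 0) \<in> lpoly n" unfolding lpoly_def by (rule lspan.zero)
lemma lpoly_add: "p \<in> lpoly n \<Longrightarrow> q \<in> lpoly n \<Longrightarrow> (\<lambda>v. p v + q v) \<in> lpoly n"
  unfolding lpoly_def by (rule lspan_add)
lemma lpoly_diff: "p \<in> lpoly n \<Longrightarrow> q \<in> lpoly n \<Longrightarrow> (\<lambda>v. p v - q v) \<in> lpoly n"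
  unfolding lpoly_def by (rule lspan_diff)
lemma lpoly_scale: "p \<in> lpoly n \<Longrightarrow> (\<lambda>v. a * p v) \<in> lpoly n"
  unfolding lpoly_def by (rule lspan_scale)
lemma lpoly_sum: "(\<And>i. i \<in> I \<Longrightarrow> p i \<in> lpoly n) \<Longrightarrow> (\<lambda>v. \<Sum>i\<in>I. p i v) \<in> lpoly n"
  unfolding lpoly_def by (rule lspan_sum)

lemma hpoly_nth_mult: "p \<in> hpoly n \<Longrightarrow> (\<lambda>v. v $ i * p v) \<in> hpoly (Suc n)"
  using hpoly_mult[OF hpoly_nth] by simp

lemma hpoly_power: "p \<in> hpoly m \<Longrightarrow> (\<lambda>v. p v ^ k) \<in> hpoly (k * m)"
proof (induction k)
  case 0
  then show ?case by (simp add: hpoly_const)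
next
  case (Suc k)
  then show ?case using hpoly_mult[of p m "\<lambda>v. p v ^ k" "k * m"] by simp
qed

lemma monom3_cases:
  assumes "i + j + k = Suc n"
  obtains a i' j' k' where "i' + j' + k' = n" "monom3 i j k = (\<lambda>v. v $ a * monom3 i' j' k' v)"
proof -
  consider (1) i' where "i = Suc i'" | (2) j' where "j = Suc j'" | (3) k' where "k = Suc k'"
    using assms by (metis add_is_0 not0_implies_Suc)
  then show thesis
  proof cases
    case 1 then show thesis using assms by (intro that[of i' j k 1]) (auto simp: monom3_def)
  next
    case 2 then show thesis using assms by (intro that[of i j' k 2]) (auto simp: monom3_def)
  next
    case 3 then show thesis using assms by (intro that[of i j k' 3]) (auto simp: monom3_def)
  qed
qed

section \<open>The nilpotent shear and its Jordan chains\<close>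

definition shear :: "real \<Rightarrow> real ^ 3 \<Rightarrow> real ^ 3" where
  "shear t v = vector [v $ 1 + t * v $ 2 + t\<^sup>2 / 2 * v $ 3, v $ 2 + t * v $ 3, v $ 3]"

lemma shear_nth [simp]:
  "shear t v $ 1 = v $ 1 + t * v $ 2 + t\<^sup>2 / 2 * v $ 3"
  "shear t v $ 2 = v $ 2 + t * v $ 3"
  "shear t v $ 3 = v $ 3"
  by (simp_all add: shear_def)

text \<open>\<open>disc v\<close> is the discriminant of \<open>s \<mapsto> x + s y + s\<^sup>2 z / 2\<close>, and \<^const>\<open>shear\<close> is translation of \<open>s\<close>. So the
  Taylor coefficients at \<open>s = 0\<close> of the powers of this quadratic, multiplied by powers of \<open>disc\<close>, form
  Jordan chains for the infinitesimal shear.\<close>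

definition disc :: "real ^ 3 \<Rightarrow> real" where
  "disc v = (v $ 2)\<^sup>2 - 2 * v $ 1 * v $ 3"

lemma disc_shear: "disc (shear t v) = disc v"
  by (simp add: disc_def power2_eq_square algebra_simps)

definition xpol :: "real ^ 3 \<Rightarrow> real poly" where
  "xpol v = [:v $ 1, v $ 2, v $ 3 / 2:]"

text \<open>The factor \<open>fact j\<close> turns Taylor coefficients into derivatives. As
  \<open>shear t\<close> is exp (t N), it then acts by the plain exponential series: the step from
  \<open>j\<close> to \<open>j + i\<close> has weight \<open>t ^ i / fact i\<close>.\<close>

definition X_chain :: "nat \<Rightarrow> nat \<Rightarrow> real ^ 3 \<Rightarrow> real" where
  "X_chain m j v = fact j * coeff (xpol v ^ m) j"

definition chain :: "nat \<Rightarrow> nat \<Rightarrow> nat \<Rightarrow> real ^ 3 \<Rightarrow> real" where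
  "chain n k j v = disc v ^ k * X_chain (n - 2 * k) j v"

lemma xpol_shear: "xpol (shear t v) = pcompose (xpol v) [:t, 1:]"
  by (simp add: xpol_def pcompose_pCons power2_eq_square algebra_simps)

lemma degree_xpol_power: "degree (xpol v ^ m) \<le> 2 * m"
proof -
  have "degree (xpol v) \<le> 2" by (simp add: xpol_def)
  then show ?thesis using degree_power_le[of "xpol v" m] by (meson le_trans mult_le_mono1)
qed

text \<open>Taylor's formula for the \<open>j\<close>-th derivative of \<open>p\<close> at
  \<open>t\<close>. Any bound \<open>d\<close> on the degree will do, so that chains of different
  lengths can share one range of summation.\<close>

lemma coeff_pcompose_shift:
  fixes p :: "real poly"
  assumes "degree p \<le> d"
  shows "fact j * coeff (pcompose p [:t, 1:]) j = (\<Sum>i\<le>d. t ^ i / fact i * (fact (j + i) * coeff p (j + i)))"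
proof -
  have "pcompose p [:t, 1:] = (\<Sum>i\<le>d. smult (coeff p i) ([:t, 1:] ^ i))"
  proof -
    have "pcompose p q = (\<Sum>i\<le>d. smult (coeff p i) (q ^ i))" for q
    proof -
      have "p = (\<Sum>i\<le>d. monom (coeff p i) i)"
        using assms by (simp add: poly_as_sum_of_monoms')
      then have "pcompose p q = (\<Sum>i\<le>d. pcompose (monom (coeff p i) i) q)"
        by (metis (no_types, lifting) pcompose_sum sum.cong)
      moreover have "pcompose (monom a i) q = smult a (q ^ i)" for a i
        by (induction i) (simp_all add: monom_0 monom_Suc pcompose_pCons)
      ultimately show ?thesis by simp
    qed
    then show ?thesis .
  qed
  moreover have "coeff ([:t, 1:] ^ i) j = of_nat (i choose j) * t ^ (i - j)" for i
    by (cases "j \<le> i") (simp_all add: coeff_linear_poly_power coeff_eq_0 degree_linear_power)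
  ultimately have "fact j * coeff (pcompose p [:t, 1:]) j = (\<Sum>i\<le>d. fact j * (coeff p i * (of_nat (i choose j) * t ^ (i - j))))"
    by (simp add: coeff_sum sum_distrib_left)
  also have "\<dots> = (\<Sum>i\<in>{..d} \<inter> {j..}. fact j * (coeff p i * (of_nat (i choose j) * t ^ (i - j))))"
    by (intro sum.mono_neutral_right) (auto simp: binomial_eq_0)
  also have "\<dots> = (\<Sum>i\<in>{i. i \<le> d \<and> j + i \<le> d}. t ^ i / fact i * (fact (j + i) * coeff p (j + i)))"
  proof (intro sum.reindex_bij_witness[where i = "\<lambda>i. j + i" and j = "\<lambda>i. i - j"])
    fix i assume "i \<in> {..d} \<inter> {j..}"
    then have "real (i choose j) * fact j * fact (i - j) = fact i"
      using binomial_fact[of j i, where 'a = real] by simp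
    then show "t ^ (i - j) / fact (i - j) * (fact (j + (i - j)) * coeff p (j + (i - j))) =
         fact j * (coeff p i * (real (i choose j) * t ^ (i - j)))"
      using \<open>i \<in> _\<close> by (simp add: field_simps)
  qed auto
  also have "\<dots> = (\<Sum>i\<le>d. t ^ i / fact i * (fact (j + i) * coeff p (j + i)))"
    using assms by (intro sum.mono_neutral_left) (auto intro!: coeff_eq_0)
  finally show ?thesis .
qed

lemma X_chain_eq_0: "j > 2 * m \<Longrightarrow> X_chain m j v = 0"
  using degree_xpol_power[of v m] by (simp add: X_chain_def coeff_eq_0)

text \<open>The upper limit \<open>2 * n\<close> instead of \<open>2 * m\<close> adds zero terms
  only and is the same for all chains of degree \<open>n\<close>.\<close>

lemma X_chain_shear:
  assumes "m \<le> n"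
  shows "X_chain m j (shear t v) = (\<Sum>i\<le>2 * n. t ^ i / fact i * X_chain m (j + i) v)"
proof -
  have "xpol (shear t v) ^ m = pcompose (xpol v ^ m) [:t, 1:]"
    unfolding xpol_shear by (induction m) (simp_all add: pcompose_mult pcompose_1)
  then show ?thesis
    using assms degree_xpol_power[of v m] unfolding X_chain_def
    by (simp add: coeff_pcompose_shift[of _ "2 * n"])
qed

lemma chain_shear: "chain n k j (shear t v) = (\<Sum>i\<le>2 * n. t ^ i / fact i * chain n k (j + i) v)"
  by (simp add: chain_def disc_shear X_chain_shear[of "n - 2 * k" n] sum_distrib_left
      mult.assoc mult.left_commute[of "disc v ^ k"])

lemma chain_eq_0: "j > 2 * (n - 2 * k) \<Longrightarrow> chain n k j v = 0"
  by (simp add: chain_def X_chain_eq_0)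

lemma coeff_xpol_Suc:
  "coeff (xpol v ^ Suc m) j = v $ 1 * coeff (xpol v ^ m) j
     + (if j \<ge> 1 then v $ 2 * coeff (xpol v ^ m) (j - 1) else 0)
     + (if j \<ge> 2 then 1 / 2 * (v $ 3 * coeff (xpol v ^ m) (j - 2)) else 0)"
  by (auto simp: xpol_def coeff_pCons split: nat.splits)

text \<open>This is the leading coefficient of a power of a quadratic whose own leading coefficient
  is z / 2.\<close>

lemma X_chain_top: "X_chain m (2 * m) v = fact (2 * m) * (v $ 3 / 2) ^ m"
proof -
  have "coeff (xpol v ^ m) (2 * m) = (v $ 3 / 2) ^ m"
  proof (induction m)
    case (Suc m)
    have "coeff (xpol v ^ m) (2 * Suc m) = 0" "coeff (xpol v ^ m) (2 * Suc m - 1) = 0"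
      using degree_xpol_power[of v m] by (auto intro!: coeff_eq_0)
    moreover have "2 * Suc m - 2 = 2 * m" by simp
    ultimately show ?case using Suc by (simp only: coeff_xpol_Suc) simp
  qed simp
  then show ?thesis by (simp add: X_chain_def)
qed

lemma X_chain_hpoly: "X_chain m j \<in> hpoly m"
proof -
  have "(\<lambda>v. coeff (xpol v ^ m) j) \<in> hpoly m" for j
  proof (induction m arbitrary: j)
    case 0
    then show ?case by (simp add: hpoly_const)
  next
    case (Suc m)
    have *: "(\<lambda>v. v $ 1 * coeff (xpol v ^ m) j) \<in> hpoly (Suc m)"
         "(\<lambda>v. v $ 2 * coeff (xpol v ^ m) (j - 1)) \<in> hpoly (Suc m)"
         "(\<lambda>v. 1/2 * (v $ 3 * coeff (xpol v ^ m) (j - 2))) \<in> hpoly (Suc m)"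
      by (intro hpoly_nth_mult hpoly_scale Suc.IH)+
    have "(\<lambda>v. v $ 1 * coeff (xpol v ^ m) j
       + (if j \<ge> 1 then v $ 2 * coeff (xpol v ^ m) (j - 1) else 0)
       + (if j \<ge> 2 then 1 / 2 * (v $ 3 * coeff (xpol v ^ m) (j - 2)) else 0)) \<in> hpoly (Suc m)"
      using * by (cases "j \<ge> 1"; cases "j \<ge> 2"; simp only: if_True if_False; intro hpoly_add hpoly_zero)
    then show ?case unfolding coeff_xpol_Suc .
  qed
  from hpoly_scale[OF this, of "fact j" j] show ?thesis by (simp add: X_chain_def[abs_def])
qed

lemma disc_hpoly: "disc \<in> hpoly 2"
proof -
  have "(\<lambda>v. v $ 2 * v $ 2 - 2 * (v $ 1 * v $ 3)) \<in> hpoly (1 + 1)"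
    by (intro hpoly_diff hpoly_mult hpoly_scale hpoly_nth)
  then show ?thesis by (simp add: disc_def[abs_def] power2_eq_square numeral_2_eq_2 mult.assoc)
qed

lemma chain_hpoly: "k \<le> n div 2 \<Longrightarrow> chain n k j \<in> hpoly n"
  using hpoly_mult[OF hpoly_power[OF disc_hpoly, of k] X_chain_hpoly[of "n - 2 * k" j]]
  by (simp add: chain_def[abs_def] mult.commute)

lemma chain_top:
  "chain n k (2 * (n - 2 * k)) v =
     fact (2 * (n - 2 * k)) / 2 ^ (n - 2 * k) * (v $ 3 ^ (n - 2 * k) * disc v ^ k)"
  by (simp add: chain_def X_chain_top power_divide)

section \<open>The chains span the forms of degree n and are independent\<close>

lemma lspan_Un_split:
  assumes "f \<in> lspan (S \<union> T)"
  obtains g h where "g \<in> lspan S" "h \<in> lspan T" "f = (\<lambda>x. g x + h x)"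
proof -
  from assms have "\<exists>g h. g \<in> lspan S \<and> h \<in> lspan T \<and> f = (\<lambda>x. g x + h x)"
  proof induction
    case zero
    then show ?case by (intro exI[of _ "\<lambda>_. 0"]) (auto intro: lspan.zero)
  next
    case (add_base f u a)
    then obtain g h where gh: "g \<in> lspan S" "h \<in> lspan T" "f = (\<lambda>x. g x + h x)" by blast
    show ?case
    proof (cases "u \<in> S")
      case True
      with gh show ?thesis
        by (intro exI[of _ "\<lambda>x. g x + a * u x"] exI[of _ h]) (auto intro: lspan.add_base)
    next
      case False
      with gh add_base.hyps show ?thesis
        by (intro exI[of _ g] exI[of _ "\<lambda>x. h x + a * u x"]) (auto intro: lspan.add_base simp: add.assoc)
    qed
  qed
  then show thesis using that by blast
qed

text \<open>Modulo \<^const>\<open>disc\<close>, every monomial reduces to one of degree at most \<open>1\<close> in \<open>y\<close>, which is determined by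
  its weight \<open>j\<close>, where \<open>x\<close>, \<open>y\<close>, \<open>z\<close> have the weights \<open>0\<close>, \<open>1\<close>, \<open>2\<close>.\<close>

definition cone_monom :: "nat \<Rightarrow> nat \<Rightarrow> real ^ 3 \<Rightarrow> real" where
  "cone_monom n j = monom3 (n - (j + 1) div 2) (j mod 2) (j div 2)"

text \<open>Writing y^2 as \<open>disc\<close> plus 2 x z lowers the exponent of y by two; the
  multiple of \<open>disc\<close> that splits off has a cofactor of degree
  \<open>n - 2\<close>.\<close>

lemma monom3_mod_disc:
  assumes "i + j + k = n"
  shows "monom3 i j k \<in> lspan (cone_monom n ` {..2 * n} \<union>
           {\<lambda>v. disc v * monom3 i j k v | i j k. i + j + k + 2 = n})" (is "_ \<in> lspan (?E \<union> ?D)")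
  using assms
proof (induction j arbitrary: i k rule: less_induct)
  case (less j)
  consider "j = 0" | "j = 1" | j' where "j = j' + 2"
    by (metis One_nat_def add_2_eq_Suc' not0_implies_Suc)
  then show ?case
  proof cases
    case 1
    with less.prems have "monom3 i j k = cone_monom n (2 * k)" "2 * k \<le> 2 * n"
      by (auto simp: cone_monom_def)
    then show ?thesis by (intro lspan_base) auto
  next
    case 2
    with less.prems have "monom3 i j k = cone_monom n (2 * k + 1)" "2 * k + 1 \<le> 2 * n"
      by (auto simp: cone_monom_def)
    then show ?thesis by (intro lspan_base) (auto simp del: One_nat_def)
  next
    case 3
    have "monom3 i j k = (\<lambda>v. disc v * monom3 i j' k v + 2 * monom3 (i + 1) j' (k + 1) v)"
      by (auto simp: 3 monom3_def disc_def power_add algebra_simps power2_eq_square)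
    moreover have "(\<lambda>v. disc v * monom3 i j' k v) \<in> lspan (?E \<union> ?D)"
      using less.prems 3 by (intro lspan_base UnI2) auto
    moreover have "monom3 (i + 1) j' (k + 1) \<in> lspan (?E \<union> ?D)"
      using less.prems 3 by (intro less.IH) auto
    ultimately show ?thesis by (simp add: lspan_add lspan_scale)
  qed
qed

lemma polyfun_eqD:
  fixes c d :: "nat \<Rightarrow> real"
  assumes "\<And>x. (\<Sum>i\<le>n. c i * x ^ i) = (\<Sum>i\<le>n. d i * x ^ i)"
  shows "\<forall>i\<le>n. c i = d i"
  using assms polyfun_eq_coeffs by blast

text \<open>Chain \<open>k\<close> has length 2 (n - 2 k) + 1, which is the number q_k of the
  claim.\<close>

definition chain_idx :: "nat \<Rightarrow> (nat \<times> nat) set" where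
  "chain_idx n = (SIGMA k:{0..n div 2}. {0..<2 * n + 1 - 4 * k})"

lemma chain_idx_iff: "(k, j) \<in> chain_idx n \<longleftrightarrow> k \<le> n div 2 \<and> j \<le> 2 * (n - 2 * k)"
  by (auto simp: chain_idx_def)

lemma finite_chain_idx [simp]: "finite (chain_idx n)"
  by (simp add: chain_idx_def)

text \<open>The induction goes down by two degrees: multiples of \<open>disc\<close> come from the
  chains of degree \<open>n - 2\<close>, with \<open>k\<close> raised by one. There remains one cone
  monomial for each weight, and restriction to the cone \<open>disc = 0\<close> shows that the
  longest chain produces it modulo multiples of \<open>disc\<close>.\<close>

lemma hpoly_chain_span:
  assumes "p \<in> hpoly n"
  shows "p \<in> lspan ((\<lambda>(k, j). chain n k j) ` chain_idx n)"
  using assms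
proof (induction n arbitrary: p rule: less_induct)
  case (less n)
  let ?C = "(\<lambda>(k, j). chain n k j) ` chain_idx n"
  let ?E = "cone_monom n ` {..2 * n}"
  let ?D = "{\<lambda>v. disc v * monom3 i j k v | i j k. i + j + k + 2 = n}"
  have hp: "p \<in> lspan (?E \<union> ?D)" if "p \<in> hpoly n" for p
    using that unfolding hpoly_def by (rule lspan_subset) (use monom3_mod_disc in blast)
  have D: "f \<in> lspan ?C" if "f \<in> ?D" for f
  proof -
    from that obtain i j k where f: "f = (\<lambda>v. disc v * monom3 i j k v)" and n: "i + j + k + 2 = n" by blast
    have "monom3 i j k \<in> lspan ((\<lambda>(k, j). chain (n - 2) k j) ` chain_idx (n - 2))"
      using n by (intro less.IH monom3_hpoly) auto
    then show ?thesis unfolding f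
    proof (rule lspan_mult_left)
      fix g assume "g \<in> (\<lambda>(k, j). chain (n - 2) k j) ` chain_idx (n - 2)"
      then obtain k j where g: "g = chain (n - 2) k j" and kj: "(k, j) \<in> chain_idx (n - 2)" by auto
      have "(\<lambda>v. disc v * g v) = chain n (k + 1) j"
        by (auto simp: g chain_def)
      moreover have "(k + 1, j) \<in> chain_idx n"
        using kj n by (auto simp: chain_idx_iff)
      ultimately show "(\<lambda>v. disc v * g v) \<in> lspan ?C"
        by (intro lspan_base) (auto intro!: rev_image_eqI)
    qed
  qed
  have DC: "u \<in> lspan ?C" if "u \<in> lspan ?D" for u
    using that D by (rule lspan_subset)
  have E: "cone_monom n l \<in> lspan ?C" if l: "l \<le> 2 * n" for l
  proof -
    from hp[OF X_chain_hpoly[of n l]] obtain g u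
      where g: "g \<in> lspan ?E" and u: "u \<in> lspan ?D" and X: "X_chain n l = (\<lambda>v. g v + u v)"
      by (rule lspan_Un_split)
    obtain d where d: "g = (\<lambda>v. \<Sum>i\<le>2 * n. d i * cone_monom n i v)"
      using g by (rule lspan_image_coeffs) auto
    \<comment> \<open>This curve lies on the cone \<open>disc = 0\<close>, so it annihilates
      \<open>u\<close>, and it separates weights: the cone monomial of weight i becomes a nonzero
      multiple of \<tau>^i.\<close>
    define c :: "real \<Rightarrow> real ^ 3" where "c \<tau> = vector [1, \<tau>, \<tau>\<^sup>2 / 2]" for \<tau>
    have u0: "u (c \<tau>) = 0" for \<tau>
      using u by induction (auto simp: c_def disc_def)
    have "cone_monom n i (c \<tau>) = (1 / 2) ^ (i div 2) * \<tau> ^ i" for i \<tau>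
    proof -
      have "\<tau> ^ (i mod 2) * (\<tau>\<^sup>2) ^ (i div 2) = \<tau> ^ i"
        by (simp flip: power_mult power_add)
      then show ?thesis
        by (simp add: cone_monom_def monom3_def c_def power_divide field_simps)
    qed
    moreover have "X_chain n l (c \<tau>) = fact l * (of_nat (2 * n choose l) * (1 / 2) ^ l) * \<tau> ^ l" for \<tau>
    proof -
      \<comment> \<open>On the cone the quadratic has discriminant zero and is a square; its powers
        therefore have binomial coefficients, none of which vanishes up to
        \<open>2 * n\<close>.\<close>
      have "xpol (c \<tau>) = [:1, \<tau> / 2:] ^ 2"
        by (simp add: xpol_def c_def power2_eq_square)
      then have "xpol (c \<tau>) ^ n = [:1, \<tau> / 2:] ^ (2 * n)"
        by (simp add: power_mult)
      then show ?thesis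
        by (simp add: X_chain_def coeff_linear_poly_power l power_divide)
    qed
    ultimately have "(\<Sum>i\<le>2 * n. d i * (1 / 2) ^ (i div 2) * \<tau> ^ i) =
        fact l * (of_nat (2 * n choose l) * (1 / 2) ^ l) * \<tau> ^ l" for \<tau> :: real
      using fun_cong[OF X, of "c \<tau>"] by (simp add: d u0 mult.assoc)
    also have "\<And>\<tau>. fact l * (of_nat (2 * n choose l) * (1 / 2) ^ l) * \<tau> ^ l =
       (\<Sum>i\<le>2 * n. (if i = l then fact l * (of_nat (2 * n choose l) * (1 / 2) ^ l) else 0) * \<tau> ^ i)"
      using l by (simp add: if_distrib[of "\<lambda>x. x * _"] cong: if_cong)
    finally have "\<forall>i\<le>2 * n. d i * (1 / 2) ^ (i div 2) =
        (if i = l then fact l * (of_nat (2 * n choose l) * (1 / 2) ^ l) else 0)"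
      by (intro polyfun_eqD)
    note * = this
    have d0: "d i = 0" if "i \<le> 2 * n" "i \<noteq> l" for i
      using * that by auto
    have dl: "d l \<noteq> 0"
      using * l by (auto simp: binomial_eq_0_iff)
    have "g = (\<lambda>v. d l * cone_monom n l v)"
      unfolding d using l d0 by (subst sum.remove[of _ l]) auto
    then have "cone_monom n l = (\<lambda>v. (1 / d l) * (chain n 0 l v - u v))"
      using dl X by (auto simp: chain_def fun_eq_iff)
    also have "\<dots> \<in> lspan ?C"
      by (intro lspan_scale lspan_diff DC u lspan_base) (use l in \<open>force simp: chain_idx_iff\<close>)
    finally show ?thesis .
  qed
  from hp[OF less.prems] show ?case
    by (rule lspan_subset) (use D E in blast)
qed

text \<open>Shearing a relation and comparing powers of \<open>t\<close> gives the same relation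
  with every \<open>j\<close> replaced by \<open>j + i\<close>. Let \<open>d\<close> be the distance
  of a chain member from the end of its chain, treated in decreasing order. In the relation shifted
  by \<open>d\<close>, the members closer to the end drop out, the farther ones have zero
  coefficients by induction, and those at distance \<open>d\<close> land on the ends of the chains,
  which are independent.\<close>

lemma chain_indep:
  assumes zero: "\<And>v. (\<Sum>(k, j)\<in>chain_idx n. a k j * chain n k j v) = 0"
    and kj: "(k, j) \<in> chain_idx n"
  shows "a k j = 0"
proof -
  have shifted: "(\<Sum>(k, j)\<in>chain_idx n. a k j * chain n k (j + i) v) = 0" if "i \<le> 2 * n" for i v
  proof -
    have "(\<Sum>i\<le>2 * n. (\<Sum>(k, j)\<in>chain_idx n. a k j * chain n k (j + i) v) / fact i * t ^ i) =
          (\<Sum>i\<le>2 * n. 0 * t ^ i)" for t :: real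
    proof -
      have "(\<Sum>i\<le>2 * n. (\<Sum>(k, j)\<in>chain_idx n. a k j * chain n k (j + i) v) / fact i * t ^ i) =
          (\<Sum>(k, j)\<in>chain_idx n. a k j * chain n k j (shear t v))"
        unfolding chain_shear
        by (simp add: sum_divide_distrib sum_distrib_left sum_distrib_right split_def mult_ac
            sum.swap[of _ "chain_idx n"])
      then show ?thesis using zero by simp
    qed
    then have "\<forall>i\<le>2 * n. (\<Sum>(k, j)\<in>chain_idx n. a k j * chain n k (j + i) v) / fact i = 0"
      by (intro polyfun_eqD)
    then show ?thesis using that by auto
  qed
  have "\<forall>k j. (k, j) \<in> chain_idx n \<longrightarrow> 2 * (n - 2 * k) - j = d \<longrightarrow> a k j = 0" for d
  proof (induction "2 * n - d" arbitrary: d rule: less_induct)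
    case less
    have IH: "a k j = 0" if "(k, j) \<in> chain_idx n" "2 * (n - 2 * k) - j > d" for k j
      using less.hyps[of "2 * (n - 2 * k) - j"] that by auto
    show ?case
    proof (cases "d \<le> 2 * n")
      case False
      then show ?thesis by auto
    next
      case True
      \<comment> \<open>The coefficient in chain \<open>k\<close> at distance \<open>d\<close> from
        its end, or 0 if the chain is too short to have one.\<close>
      define A where "A k = (if d \<le> 2 * (n - 2 * k) then a k (2 * (n - 2 * k) - d) else 0)" for k
      define c :: "nat \<Rightarrow> real" where "c k = fact (2 * (n - 2 * k)) / 2 ^ (n - 2 * k)" for k
      have inner: "(\<Sum>j\<in>{0..<2 * n + 1 - 4 * k}. a k j * chain n k (j + d) v) =
          A k * chain n k (2 * (n - 2 * k)) v" if k: "k \<le> n div 2" for k v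
      proof -
        have "(\<Sum>j\<in>{0..<2 * n + 1 - 4 * k}. a k j * chain n k (j + d) v) =
              (\<Sum>j\<in>{0..<2 * n + 1 - 4 * k}. if j = 2 * (n - 2 * k) - d then A k * chain n k (2 * (n - 2 * k)) v else 0)"
        proof (rule sum.cong)
          fix j assume j: "j \<in> {0..<2 * n + 1 - 4 * k}"
          then have idx: "(k, j) \<in> chain_idx n" using k by (auto simp: chain_idx_def)
          consider "j + d > 2 * (n - 2 * k)" | "j + d = 2 * (n - 2 * k)" | "j + d < 2 * (n - 2 * k)" by linarith
          then show "a k j * chain n k (j + d) v =
              (if j = 2 * (n - 2 * k) - d then A k * chain n k (2 * (n - 2 * k)) v else 0)"
          proof cases
            case 1
            then show ?thesis by (auto simp: chain_eq_0 A_def)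
          next
            case 2
            then have "j = 2 * (n - 2 * k) - d" "d \<le> 2 * (n - 2 * k)" by auto
            then show ?thesis using 2 by (simp add: A_def)
          next
            case 3
            then have "a k j = 0" using idx by (intro IH) auto
            with 3 show ?thesis by auto
          qed
        qed simp
        also have "\<dots> = A k * chain n k (2 * (n - 2 * k)) v"
          using k by (subst sum.delta) auto
        finally show ?thesis .
      qed
      have "(\<Sum>k\<le>n div 2. A k * c k * Y ^ k) = (\<Sum>k\<le>n div 2. 0 * Y ^ k)" for Y :: real
      proof -
        \<comment> \<open>Here z = 1 and \<open>disc\<close> equals Y, so the ends of the chains
          become distinct powers of Y.\<close>
        let ?v = "vector [- Y / 2, 0, 1] :: real ^ 3"
        have "disc ?v = Y" by (simp add: disc_def)
        then have "chain n k (2 * (n - 2 * k)) ?v = c k * Y ^ k" for k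
          by (simp add: chain_top c_def)
        then have *: "(\<Sum>j\<in>{0..<2 * n + 1 - 4 * k}. a k j * chain n k (j + d) ?v) = A k * c k * Y ^ k"
          if "k \<in> {0..n div 2}" for k
          using that by (subst inner) (auto simp: mult.assoc)
        have "(\<Sum>(k, j)\<in>chain_idx n. a k j * chain n k (j + d) ?v) = (\<Sum>k\<in>{0..n div 2}. A k * c k * Y ^ k)"
          unfolding chain_idx_def by (subst sum.Sigma[symmetric], simp, simp, rule sum.cong[OF refl *])
        then show ?thesis using shifted[OF True] by (simp add: atLeast0AtMost)
      qed
      then have "\<forall>k\<le>n div 2. A k * c k = 0"
        by (intro polyfun_eqD)
      then have A0: "A k = 0" if "k \<le> n div 2" for k
        using that by (auto simp: c_def)
      show ?thesis
      proof (intro allI impI)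
        fix k j assume "(k, j) \<in> chain_idx n" "2 * (n - 2 * k) - j = d"
        then show "a k j = 0"
          using A0[of k] by (auto simp: chain_idx_iff A_def)
      qed
    qed
  qed
  then show ?thesis using kj by blast
qed

section \<open>Hermite polynomials\<close>

lemma lpoly_mult:
  assumes "p \<in> lpoly m" "q \<in> lpoly (Suc n)"
  shows "(\<lambda>v. p v * q v) \<in> lpoly (m + n)"
proof -
  have *: "(\<lambda>v. f v * g v) \<in> lspan {monom3 i j k | i j k. i + j + k < m + n}"
    if "f \<in> {monom3 i j k | i j k. i + j + k < m}" "g \<in> {monom3 i j k | i j k. i + j + k < Suc n}" for f g
  proof -
    from that obtain i j k i' j' k' where "f = monom3 i j k" "i + j + k < m"
      "g = monom3 i' j' k'" "i' + j' + k' < Suc n" by blast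
    then show ?thesis
      by (simp only: monom3_mult) (rule monom3_lpoly[unfolded lpoly_def], linarith)
  qed
  show ?thesis using assms * unfolding lpoly_def by (rule lspan_mult)
qed

lemma hpoly_lpoly_Suc: "p \<in> hpoly n \<Longrightarrow> p \<in> lpoly (Suc n)"
  by (erule hpoly_lpoly) simp

lemma hpoly_homogeneous: "p \<in> hpoly n \<Longrightarrow> p (\<tau> *\<^sub>R v) = \<tau> ^ n * p v"
  unfolding hpoly_def
  by (induction rule: lspan.induct) (auto simp: monom3_def power_mult_distrib power_add algebra_simps)

lemma lpoly_growth:
  assumes "p \<in> lpoly n"
  shows "((\<lambda>\<tau>. p (\<tau> *\<^sub>R v) / \<tau> ^ n) \<longlongrightarrow> 0) at_top"
  using assms unfolding lpoly_def
proof (induction rule: lspan.induct)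
  case (add_base f g a)
  from add_base.hyps obtain i j k where g: "g = monom3 i j k" and n: "i + j + k < n" by blast
  have "g (\<tau> *\<^sub>R v) / \<tau> ^ n = g v * inverse (\<tau> ^ (n - (i + j + k)))" if "\<tau> > 0" for \<tau>
  proof -
    have "g (\<tau> *\<^sub>R v) = \<tau> ^ (i + j + k) * g v"
      using hpoly_homogeneous[OF monom3_hpoly[OF refl]] by (simp add: g)
    moreover have "\<tau> ^ n = \<tau> ^ (i + j + k) * \<tau> ^ (n - (i + j + k))"
      using n by (simp flip: power_add)
    ultimately show ?thesis using that by (simp add: field_simps)
  qed
  then have "eventually (\<lambda>\<tau>. g v * inverse (\<tau> ^ (n - (i + j + k))) = g (\<tau> *\<^sub>R v) / \<tau> ^ n) at_top"
    by (intro eventually_mono[OF eventually_gt_at_top[of 0]]) simp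
  moreover have "((\<lambda>\<tau>. g v * inverse (\<tau> ^ (n - (i + j + k)))) \<longlongrightarrow> 0) at_top"
    using n by (intro tendsto_mult_right_zero tendsto_inverse_0_at_top filterlim_pow_at_top filterlim_ident) auto
  ultimately have "((\<lambda>\<tau>. g (\<tau> *\<^sub>R v) / \<tau> ^ n) \<longlongrightarrow> 0) at_top"
    by (rule Lim_transform_eventually[rotated])
  from tendsto_add[OF add_base.IH tendsto_mult_left[OF this, of a]] show ?case
    by (simp add: add_divide_distrib)
qed simp

text \<open>Along a ray, the quotient by \<tau>^n is constant for a form of degree \<open>n\<close>
  and tends to 0 for a polynomial of smaller degree.\<close>

lemma hpoly_Int_lpoly:
  assumes "p \<in> hpoly n" "p \<in> lpoly n"
  shows "p v = 0"
proof -
  have "((\<lambda>\<tau>. p (\<tau> *\<^sub>R v) / \<tau> ^ n) \<longlongrightarrow> p v) at_top"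
    by (rule tendsto_eventually, rule eventually_mono[OF eventually_gt_at_top[of 0]])
       (simp add: hpoly_homogeneous[OF assms(1)])
  with lpoly_growth[OF assms(2), of v] show ?thesis
    by (meson tendsto_unique trivial_limit_at_top_linorder)
qed

text \<open>This is what differentiation does to the polynomial factor of a polynomial times the
  Gaussian, once (-1 / \<rho>)^m is split off; with that normalisation the polynomials are
  monic.\<close>

fun hermite_poly :: "real \<Rightarrow> nat \<Rightarrow> real poly" where
  "hermite_poly \<rho> 0 = 1"
| "hermite_poly \<rho> (Suc m) = pCons 0 (hermite_poly \<rho> m) - smult \<rho> (pderiv (hermite_poly \<rho> m))"

lemma degree_hermite_poly: "degree (hermite_poly \<rho> m) \<le> m"
proof (induction m)
  case (Suc m)
  then show ?case
    by (auto intro!: degree_diff_le degree_pCons_le[THEN order_trans] degree_smult_le[THEN order_trans]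
        simp: degree_pderiv)
qed simp

lemma coeff_hermite_poly: "coeff (hermite_poly \<rho> m) m = 1"
proof (induction m)
  case (Suc m)
  have "coeff (hermite_poly \<rho> m) (Suc (Suc m)) = 0"
    using degree_hermite_poly[of \<rho> m] by (intro coeff_eq_0) simp
  then show ?case using Suc by (simp add: coeff_pderiv)
qed simp

lemma Hermite_eq_poly:
  assumes "\<rho> > 0"
  shows "Hermite \<rho> m x = poly (hermite_poly \<rho> m) x"
proof -
  let ?\<phi> = "\<lambda>u::real. exp (- (u\<^sup>2) / (2 * \<rho>))"
  have "(deriv ^^ m) ?\<phi> = (\<lambda>x. (- 1 / \<rho>) ^ m * poly (hermite_poly \<rho> m) x * ?\<phi> x)"
  proof (induction m)
    case (Suc m)
    have "deriv (\<lambda>x. (- 1 / \<rho>) ^ m * poly (hermite_poly \<rho> m) x * ?\<phi> x) x =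
          (- 1 / \<rho>) ^ Suc m * poly (hermite_poly \<rho> (Suc m)) x * ?\<phi> x" for x
      using assms by (intro DERIV_imp_deriv) (auto intro!: derivative_eq_intros simp: field_simps)
    then show ?case using Suc by simp
  qed simp
  moreover have 1: "(- \<rho>) ^ m * (- 1 / \<rho>) ^ m = (1::real)"
    using assms by (simp flip: power_mult_distrib)
  moreover have 2: "exp (x\<^sup>2 / (2 * \<rho>)) * ?\<phi> x = 1"
    by (simp flip: exp_add)
  ultimately have "Hermite \<rho> m x = ((- \<rho>) ^ m * (- 1 / \<rho>) ^ m) * poly (hermite_poly \<rho> m) x *
      (exp (x\<^sup>2 / (2 * \<rho>)) * ?\<phi> x)"
    by (simp only: Hermite_def mult_ac)
  then show ?thesis by (simp only: 1 2 mult_1 mult_1_right)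
qed

definition hprod :: "real \<Rightarrow> nat \<Rightarrow> nat \<Rightarrow> nat \<Rightarrow> real ^ 3 \<Rightarrow> real" where
  "hprod \<rho> i j k v = Hermite \<rho> i (v $ 1) * Hermite \<rho> j (v $ 2) * Hermite \<rho> k (v $ 3)"

lemma hermite_lpoly:
  assumes "\<rho> > 0"
  shows "(\<lambda>v. Hermite \<rho> m (v $ i) - v $ i ^ m) \<in> lpoly m"
proof -
  have "poly (hermite_poly \<rho> m) x = (\<Sum>l\<le>m. coeff (hermite_poly \<rho> m) l * x ^ l)" for x
    unfolding poly_altdef using degree_hermite_poly[of \<rho> m]
    by (intro sum.mono_neutral_left) (auto simp: coeff_eq_0)
  then have "Hermite \<rho> m x - x ^ m = (\<Sum>l<m. coeff (hermite_poly \<rho> m) l * x ^ l)" for x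
    by (simp add: Hermite_eq_poly[OF assms] coeff_hermite_poly lessThan_Suc_atMost[symmetric])
  moreover have "(\<lambda>v. v $ i ^ l) \<in> lpoly m" if "l < m" for l
    using hpoly_power[OF hpoly_nth[of i], of l] that by (intro hpoly_lpoly) auto
  ultimately show ?thesis by (auto intro!: lpoly_sum lpoly_scale)
qed

text \<open>The three factors are monic, and the difference of the two products telescopes by
  exchanging one factor at a time.\<close>

lemma hprod_lpoly:
  assumes "\<rho> > 0"
  shows "(\<lambda>v. hprod \<rho> i j k v - monom3 i j k v) \<in> lpoly (i + j + k)"
proof -
  have H: "(\<lambda>v. Hermite \<rho> m (v $ i)) \<in> lpoly (Suc m)" and M: "(\<lambda>v. v $ i ^ m) \<in> lpoly (Suc m)" for m i
  proof -
    show M: "(\<lambda>v. v $ i ^ m) \<in> lpoly (Suc m)"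
      using hpoly_power[OF hpoly_nth[of i], of m] by (intro hpoly_lpoly) auto
    show "(\<lambda>v. Hermite \<rho> m (v $ i)) \<in> lpoly (Suc m)"
      using lpoly_add[OF lpoly_le[OF hermite_lpoly[OF assms, of m i], of "Suc m"] M] by simp
  qed
  let ?h = "\<lambda>m i v. Hermite \<rho> m (v $ i)" and ?d = "\<lambda>m i v. Hermite \<rho> m (v $ i) - v $ i ^ m"
  have 1: "(\<lambda>v. (?d i 1 v * ?h j 2 v) * ?h k 3 v) \<in> lpoly (i + j + k)"
    by (intro lpoly_mult hermite_lpoly assms H)
  have 2: "(\<lambda>v. (?d j 2 v * v $ 1 ^ i) * ?h k 3 v) \<in> lpoly (j + i + k)"
    by (intro lpoly_mult hermite_lpoly assms H M)
  have 3: "(\<lambda>v. (?d k 3 v * v $ 1 ^ i) * v $ 2 ^ j) \<in> lpoly (k + i + j)"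
    by (intro lpoly_mult hermite_lpoly assms H M)
  have "(\<lambda>v. hprod \<rho> i j k v - monom3 i j k v) =
     (\<lambda>v. (?d i 1 v * ?h j 2 v) * ?h k 3 v + (?d j 2 v * v $ 1 ^ i) * ?h k 3 v + (?d k 3 v * v $ 1 ^ i) * v $ 2 ^ j)"
    by (auto simp: hprod_def monom3_def algebra_simps)
  then show ?thesis using 1 2 3 by (auto intro!: lpoly_add simp: add_ac)
qed

lemma finite_triples: "finite {(i, j, k). i + j + k = (m::nat)}"
  by (rule finite_subset[of _ "{..m} \<times> {..m} \<times> {..m}"]) auto

section \<open>The direct sum of the Hermite spaces and its projections\<close>

lemma Hermite_space_eq_lspan: "Hermite_space \<rho> m = lspan {hprod \<rho> i j k | i j k. i + j + k = m}"
proof -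
  let ?T = "{(i, j, k). i + j + k = m}"
  let ?v = "\<lambda>(i, j, k). hprod \<rho> i j k"
  have im: "{hprod \<rho> i j k | i j k. i + j + k = m} = ?v ` ?T"
  proof (intro equalityI subsetI)
    fix x assume "x \<in> {hprod \<rho> i j k | i j k. i + j + k = m}"
    then obtain i j k where "x = ?v (i, j, k)" "(i, j, k) \<in> ?T" by auto
    then show "x \<in> ?v ` ?T" by (rule image_eqI)
  qed auto
  show ?thesis
  proof (intro equalityI subsetI)
    fix p assume "p \<in> Hermite_space \<rho> m"
    then obtain a where p: "p = (\<lambda>v. \<Sum>(i, j, k)\<in>?T. a i j k * hprod \<rho> i j k v)"
      unfolding Hermite_space_def hprod_def by blast
    show "p \<in> lspan {hprod \<rho> i j k | i j k. i + j + k = m}"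
      unfolding p by (rule lspan_sum, clarify, intro lspan_scale lspan_base, blast)
  next
    fix p assume "p \<in> lspan {hprod \<rho> i j k | i j k. i + j + k = m}"
    then obtain a where "p = (\<lambda>v. \<Sum>t\<in>?T. a t * ?v t v)"
      unfolding im using finite_triples by (rule lspan_image_coeffs)
    then have "p = (\<lambda>v. \<Sum>(i, j, k)\<in>?T. a (i, j, k) * hprod \<rho> i j k v)"
      by (simp add: split_def)
    then show "p \<in> Hermite_space \<rho> m"
      unfolding Hermite_space_def hprod_def by (auto intro!: exI[of _ "\<lambda>i j k. a (i, j, k)"])
  qed
qed

text \<open>At z = 1 the monomials of degree \<open>m\<close> become distinct monomials in x and y,
  so that two comparisons of coefficients in one variable suffice.\<close>

lemma monom3_indep:
  assumes zero: "\<And>v. (\<Sum>(i, j, k)\<in>{(i, j, k). i + j + k = m}. a i j k * monom3 i j k v) = 0"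
    and ijk: "i + j + k = m"
  shows "a i j k = 0"
proof -
  have "(\<Sum>i\<le>m. (\<Sum>j\<le>m. (if i + j \<le> m then a i j (m - i - j) else 0) * y ^ j) * x ^ i) = (\<Sum>i\<le>m. 0 * x ^ i)"
    for x y :: real
  proof -
    have "(\<Sum>i\<le>m. (\<Sum>j\<le>m. (if i + j \<le> m then a i j (m - i - j) else 0) * y ^ j) * x ^ i) =
          (\<Sum>(i, j)\<in>{..m} \<times> {..m}. if i + j \<le> m then a i j (m - i - j) * (x ^ i * y ^ j) else 0)"
      by (subst sum.cartesian_product[symmetric]) (auto simp: sum_distrib_right intro!: sum.cong)
    also have "\<dots> = (\<Sum>(i, j)\<in>{(i, j). i + j \<le> m}. a i j (m - i - j) * (x ^ i * y ^ j))"
      by (rule sum.mono_neutral_cong_right) (auto split: if_splits)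
    also have "\<dots> = (\<Sum>(i, j, k)\<in>{(i, j, k). i + j + k = m}. a i j k * monom3 i j k (vector [x, y, 1]))"
      by (rule sum.reindex_bij_witness[where i = "\<lambda>(i, j, k). (i, j)" and j = "\<lambda>(i, j). (i, j, m - i - j)"])
         (auto simp: monom3_def)
    finally show ?thesis using zero by simp
  qed
  then have "\<forall>i\<le>m. (\<Sum>j\<le>m. (if i + j \<le> m then a i j (m - i - j) else 0) * y ^ j) = 0" for y
    by (intro polyfun_eqD)
  then have "(\<Sum>j\<le>m. (if i + j \<le> m then a i j (m - i - j) else 0) * y ^ j) = (\<Sum>j\<le>m. 0 * y ^ j)" for y
    using ijk by auto
  then have "\<forall>j\<le>m. (if i + j \<le> m then a i j (m - i - j) else 0) = 0"
    by (rule polyfun_eqD)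
  from this[rule_format, of j] show ?thesis using ijk by auto
qed

text \<open>Replacing Hermite products by monomials with the same coefficients gives the leading
  form \<open>P\<close>. It differs from \<open>p\<close> by lower degree, so it is a form of degree
  \<open>m\<close> and of lower degree at once; hence it is zero, and with it all
  coefficients.\<close>

lemma Hermite_space_Int_lpoly:
  assumes "\<rho> > 0" "p \<in> Hermite_space \<rho> m" "p \<in> lpoly m"
  shows "p = (\<lambda>v. 0)"
proof -
  let ?T = "{(i, j, k). i + j + k = m}"
  from assms(2) obtain a where p: "p = (\<lambda>v. \<Sum>(i, j, k)\<in>?T. a i j k * hprod \<rho> i j k v)"
    unfolding Hermite_space_def hprod_def by blast
  define P where "P = (\<lambda>v. \<Sum>(i, j, k)\<in>?T. a i j k * monom3 i j k v)"
  have "(\<lambda>v. \<Sum>(i, j, k)\<in>?T. a i j k * (hprod \<rho> i j k v - monom3 i j k v)) \<in> lpoly m"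
    using hprod_lpoly[OF assms(1)] by (auto intro!: lpoly_sum lpoly_scale)
  also have "(\<lambda>v. \<Sum>(i, j, k)\<in>?T. a i j k * (hprod \<rho> i j k v - monom3 i j k v)) = (\<lambda>v. p v - P v)"
    by (simp add: p P_def split_def right_diff_distrib sum_subtractf)
  finally have "P \<in> lpoly m"
    using lpoly_diff[OF assms(3)] by fastforce
  moreover have "P \<in> hpoly m"
    unfolding P_def by (intro hpoly_sum) (auto intro!: hpoly_scale monom3_hpoly)
  ultimately have "P v = 0" for v by (intro hpoly_Int_lpoly)
  then have "a i j k = 0" if "i + j + k = m" for i j k
    using that unfolding P_def by (intro monom3_indep[where m = m and a = a])
  then show ?thesis by (auto simp: p intro!: sum.neutral)
qed

lemma Hermite_space_lpoly:
  assumes "\<rho> > 0" "p \<in> Hermite_space \<rho> m" "m < n"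
  shows "p \<in> lpoly n"
  using assms(2) unfolding Hermite_space_eq_lspan lpoly_def
proof (rule lspan_subset)
  fix g assume "g \<in> {hprod \<rho> i j k | i j k. i + j + k = m}"
  then obtain i j k where g: "g = hprod \<rho> i j k" and m: "i + j + k = m" by blast
  have "(\<lambda>v. (hprod \<rho> i j k v - monom3 i j k v) + monom3 i j k v) \<in> lpoly n"
    using m assms(1,3) by (intro lpoly_add lpoly_le[OF hprod_lpoly] monom3_lpoly) auto
  then show "g \<in> lspan {monom3 i j k | i j k. i + j + k < n}"
    by (simp add: g lpoly_def)
qed

text \<open>Among the nonzero summands, the one with the largest index would be minus a sum of
  polynomials of smaller degree.\<close>

lemma Hermite_sum_eq_0:
  assumes "\<rho> > 0" "finite J" "\<And>j. j \<in> J \<Longrightarrow> g j \<in> Hermite_space \<rho> j"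
    and zero: "\<And>v. (\<Sum>j\<in>J. g j v) = 0" and "j \<in> J"
  shows "g j = (\<lambda>v. 0)"
proof (rule ccontr)
  assume "g j \<noteq> (\<lambda>v. 0)"
  let ?S = "{j \<in> J. g j \<noteq> (\<lambda>v. 0)}"
  define m where "m = Max ?S"
  have fin: "finite ?S" and ne: "?S \<noteq> {}"
    using assms \<open>g j \<noteq> _\<close> by auto
  have m: "m \<in> J" "g m \<noteq> (\<lambda>v. 0)" using Max_in[OF fin ne] by (auto simp: m_def)
  have gz: "g j = (\<lambda>v. 0)" if "j \<in> J" "j > m" for j
    using Max_ge[OF fin, of j] that by (auto simp: m_def)
  have "(\<Sum>j\<in>J - {m}. g j v) = (\<Sum>j\<in>{j\<in>J. j < m}. g j v)" for v
  proof (rule sum.mono_neutral_right)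
    show "\<forall>j\<in>J - {m} - {j \<in> J. j < m}. g j v = 0"
    proof
      fix j assume "j \<in> J - {m} - {j \<in> J. j < m}"
      then have "j \<in> J" "m < j" by auto
      then show "g j v = 0" by (simp add: gz)
    qed
  qed (use assms(2) in auto)
  then have "g m v = - 1 * (\<Sum>j\<in>{j\<in>J. j < m}. g j v)" for v
    using zero[of v] assms(2) m by (simp add: sum.remove[of J m])
  then have "g m = (\<lambda>v. - 1 * (\<Sum>j\<in>{j\<in>J. j < m}. g j v))" by (rule ext)
  also have "\<dots> \<in> lpoly m"
    using assms(1,3) by (intro lpoly_scale lpoly_sum) (auto intro: Hermite_space_lpoly)
  finally have "g m \<in> lpoly m" .
  then show False
    using Hermite_space_Int_lpoly[OF assms(1)] assms(3) m by blast
qed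

lemma lpoly_Hermite_lspan:
  assumes "\<rho> > 0" "p \<in> lpoly n"
  shows "p \<in> lspan {hprod \<rho> i j k | i j k. i + j + k < n}"
  using assms(2)
proof (induction n arbitrary: p rule: less_induct)
  case (less n)
  show ?case
    using less.prems unfolding lpoly_def
  proof (rule lspan_subset)
    fix g assume "g \<in> {monom3 i j k | i j k. i + j + k < n}"
    then obtain i j k where g: "g = monom3 i j k" and n: "i + j + k < n" by blast
    have "(\<lambda>v. hprod \<rho> i j k v - monom3 i j k v) \<in> lspan {hprod \<rho> i' j' k' | i' j' k'. i' + j' + k' < i + j + k}"
      by (rule less.IH[OF n hprod_lpoly[OF assms(1)]])
    then have "(\<lambda>v. hprod \<rho> i j k v - monom3 i j k v) \<in> lspan {hprod \<rho> i j k | i j k. i + j + k < n}"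
      by (rule lspan_mono) (use n in \<open>blast intro: less_trans\<close>)
    moreover have "hprod \<rho> i j k \<in> lspan {hprod \<rho> i j k | i j k. i + j + k < n}"
      using n by (intro lspan_base) blast
    ultimately have "(\<lambda>v. hprod \<rho> i j k v - (hprod \<rho> i j k v - monom3 i j k v)) \<in> lspan {hprod \<rho> i j k | i j k. i + j + k < n}"
      by (rule lspan_diff[rotated])
    then show "g \<in> lspan {hprod \<rho> i j k | i j k. i + j + k < n}"
      by (simp add: g)
  qed
qed

lemma lpoly_Hermite_decomp:
  assumes "\<rho> > 0" "p \<in> lpoly n"
  obtains g where "\<And>j. g j \<in> Hermite_space \<rho> j" "p = (\<lambda>v. \<Sum>j<n. g j v)"
proof -
  from lpoly_Hermite_lspan[OF assms]
  have "\<exists>g. (\<forall>j. g j \<in> Hermite_space \<rho> j) \<and> p = (\<lambda>v. \<Sum>j<n. g j v)"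
  proof induction
    case zero
    show ?case
      by (intro exI[of _ "\<lambda>_ _. 0"]) (auto simp: Hermite_space_eq_lspan intro: lspan.zero)
  next
    case (add_base f h a)
    then obtain g where g: "\<And>j. g j \<in> Hermite_space \<rho> j" "f = (\<lambda>v. \<Sum>j<n. g j v)" by blast
    from add_base.hyps obtain i j k where h: "h = hprod \<rho> i j k" and n: "i + j + k < n" by blast
    define g' where "g' l = (\<lambda>v. g l v + (if l = i + j + k then a else 0) * h v)" for l
    have "g' l \<in> Hermite_space \<rho> l" for l
      using g(1)[of l] unfolding g'_def Hermite_space_eq_lspan
      by (cases "l = i + j + k") (auto simp: h intro!: lspan.add_base)
    moreover have "(\<lambda>v. f v + a * h v) = (\<lambda>v. \<Sum>j<n. g' j v)"
      using n by (auto simp: g(2) g'_def sum.distrib if_distrib[of "\<lambda>x. x * _"] cong: if_cong)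
    ultimately show ?case by (intro exI[of _ g']) auto
  qed
  then show thesis using that by blast
qed

text \<open>Reduces the definite description to a congruence modulo lower degree: the remainder
  decomposes into Hermite spaces of index below \<open>n\<close>, and directness of the sum gives
  uniqueness.\<close>

lemma Hermite_proj_eqI:
  assumes "\<rho> > 0" "w \<in> Hermite_space \<rho> n" "(\<lambda>v. p v - w v) \<in> lpoly n"
  shows "Hermite_proj \<rho> n p = w"
proof -
  obtain g where g: "\<And>j. g j \<in> Hermite_space \<rho> j" "(\<lambda>v. p v - w v) = (\<lambda>v. \<Sum>j<n. g j v)"
    using assms(1,3) by (rule lpoly_Hermite_decomp) blast
  define g' where "g' j = (if j < n then g j else if j = n then w else (\<lambda>_. 0))" for j
  show ?thesis
    unfolding Hermite_proj_def
  proof (rule the_equality)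
    have "{j. g' j \<noteq> (\<lambda>_. 0)} \<subseteq> {..n}" by (auto simp: g'_def split: if_splits)
    then have fin: "finite {j. g' j \<noteq> (\<lambda>_. 0)}" by (rule finite_subset) simp
    have "p v = (\<Sum>j | g' j \<noteq> (\<lambda>_. 0). g' j v)" for v
    proof -
      have "p v = (\<Sum>j<n. g j v) + w v" using fun_cong[OF g(2), of v] by simp
      also have "\<dots> = (\<Sum>j\<in>{..n}. g' j v)"
        by (simp add: g'_def lessThan_Suc_atMost[symmetric])
      also have "\<dots> = (\<Sum>j | g' j \<noteq> (\<lambda>_. 0). g' j v)"
        by (rule sum.mono_neutral_right) (auto simp: g'_def split: if_splits)
      finally show ?thesis .
    qed
    moreover have "g' j \<in> Hermite_space \<rho> j" for j
      using g(1)[of j] assms(2) by (auto simp: g'_def Hermite_space_eq_lspan lspan.zero)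
    moreover have "g' n = w" by (simp add: g'_def)
    ultimately show ex: "\<exists>g. (\<forall>j. g j \<in> Hermite_space \<rho> j) \<and> finite {j. g j \<noteq> (\<lambda>_. 0)} \<and>
        p = (\<lambda>v. \<Sum>j | g j \<noteq> (\<lambda>_. 0). g j v) \<and> w = g n"
      using fin by (intro exI[of _ g']) auto
    fix q assume "\<exists>g. (\<forall>j. g j \<in> Hermite_space \<rho> j) \<and> finite {j. g j \<noteq> (\<lambda>_. 0)} \<and>
        p = (\<lambda>v. \<Sum>j | g j \<noteq> (\<lambda>_. 0). g j v) \<and> q = g n"
    then obtain h where h: "\<And>j. h j \<in> Hermite_space \<rho> j" "finite {j. h j \<noteq> (\<lambda>_. 0)}"
        "p = (\<lambda>v. \<Sum>j | h j \<noteq> (\<lambda>_. 0). h j v)" "q = h n" by blast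
    \<comment> \<open>A common finite index set for both decompositions. The index \<open>n\<close>
      is added because both of its components may be zero.\<close>
    let ?J = "insert n ({j. h j \<noteq> (\<lambda>_. 0)} \<union> {j. g' j \<noteq> (\<lambda>_. 0)})"
    have "(\<lambda>v. h n v - g' n v) = (\<lambda>v. 0)"
    proof (rule Hermite_sum_eq_0[where g = "\<lambda>j v. h j v - g' j v" and J = ?J, OF assms(1)])
      show "(\<lambda>v. h j v - g' j v) \<in> Hermite_space \<rho> j" for j
        using h(1)[of j] \<open>g' j \<in> _\<close> unfolding Hermite_space_eq_lspan by (rule lspan_diff)
      fix v
      have "(\<Sum>j\<in>?J. h j v) = p v"
        using h(2) fin by (subst h(3), intro sum.mono_neutral_right) auto
      moreover have "(\<Sum>j\<in>?J. g' j v) = (\<Sum>j | g' j \<noteq> (\<lambda>_. 0). g' j v)"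
        using h(2) fin by (intro sum.mono_neutral_right) auto
      ultimately show "(\<Sum>j\<in>?J. h j v - g' j v) = 0"
        using \<open>p v = (\<Sum>j | g' j \<noteq> (\<lambda>_. 0). g' j v)\<close> by (simp only: sum_subtractf diff_self)
    qed (use h(2) fin in auto)
    then have "h n = g' n" by (auto simp: fun_eq_iff)
    then show "q = w" using h(4) by (simp add: g'_def)
  qed
qed

text \<open>The numbers \<open>(- 2) ^ (k - i) * real (k choose i)\<close> arise by expanding
  \<open>disc v ^ k\<close> with the binomial theorem, the summand \<open>i\<close> carrying y^(2 i)
  and (-2 x z)^(k - i).\<close>

lemma Hermite_proj_kernel:
  assumes "\<rho> > 0" "k \<le> n div 2" "(\<lambda>v. p v - v $ 3 ^ (n - 2 * k) * disc v ^ k) \<in> lpoly n"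
  shows "Hermite_proj \<rho> n p = (\<lambda>v. \<Sum>i=0..k. (- 2) ^ (k - i) * real (k choose i) *
     (Hermite \<rho> (k - i) (v $ 1) * Hermite \<rho> (2 * i) (v $ 2) * Hermite \<rho> (n - k - i) (v $ 3)))"
    (is "_ = ?W")
proof (rule Hermite_proj_eqI[OF assms(1)])
  let ?c = "\<lambda>i. (- 2) ^ (k - i) * real (k choose i)"
  define W where "W = (\<lambda>v. \<Sum>i\<in>{0..k}. ?c i * hprod \<rho> (k - i) (2 * i) (n - k - i) v)"
  have W: "?W = W"
    by (simp add: W_def hprod_def)
  have deg: "(k - i) + 2 * i + (n - k - i) = n" if "i \<in> {0..k}" for i
    using that assms(2) by auto
  show "?W \<in> Hermite_space \<rho> n"
    unfolding W W_def Hermite_space_eq_lspan by (intro lspan_sum lspan_scale lspan_base) (use deg in blast)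
  have "v $ 3 ^ (n - 2 * k) * disc v ^ k = (\<Sum>i\<in>{0..k}. ?c i * monom3 (k - i) (2 * i) (n - k - i) v)" for v
  proof -
    have "disc v ^ k = (v $ 2 ^ 2 + - 2 * v $ 1 * v $ 3) ^ k" by (simp add: disc_def)
    also have "\<dots> = (\<Sum>i\<in>{0..k}. of_nat (k choose i) * (v $ 2 ^ 2) ^ i * (- 2 * v $ 1 * v $ 3) ^ (k - i))"
      unfolding atLeast0AtMost by (rule binomial_ring)
    finally have "v $ 3 ^ (n - 2 * k) * disc v ^ k =
        (\<Sum>i\<in>{0..k}. v $ 3 ^ (n - 2 * k) * (of_nat (k choose i) * (v $ 2 ^ 2) ^ i * (- 2 * v $ 1 * v $ 3) ^ (k - i)))"
      by (simp add: sum_distrib_left)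
    also have "\<dots> = (\<Sum>i\<in>{0..k}. ?c i * monom3 (k - i) (2 * i) (n - k - i) v)"
    proof (rule sum.cong)
      fix i assume "i \<in> {0..k}"
      then have "n - k - i = (n - 2 * k) + (k - i)" using assms(2) by auto
      then show "v $ 3 ^ (n - 2 * k) * (of_nat (k choose i) * (v $ 2 ^ 2) ^ i * (- 2 * v $ 1 * v $ 3) ^ (k - i)) =
        ?c i * monom3 (k - i) (2 * i) (n - k - i) v"
        by (simp only: monom3_def power_add power_mult_distrib power_mult) (simp add: mult_ac)
    qed simp
    finally show ?thesis .
  qed
  then have "(\<lambda>v. p v - ?W v) = (\<lambda>v. (p v - v $ 3 ^ (n - 2 * k) * disc v ^ k) -
      (\<Sum>i\<in>{0..k}. ?c i * (hprod \<rho> (k - i) (2 * i) (n - k - i) v - monom3 (k - i) (2 * i) (n - k - i) v)))"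
    unfolding W by (simp add: hprod_def right_diff_distrib sum_subtractf del: diff_diff_left)
  also have "\<dots> \<in> lpoly n"
  proof (rule lpoly_diff[OF assms(3) lpoly_sum], rule lpoly_scale)
    fix i assume "i \<in> {0..k}"
    then show "(\<lambda>v. hprod \<rho> (k - i) (2 * i) (n - k - i) v - monom3 (k - i) (2 * i) (n - k - i) v) \<in> lpoly n"
      using hprod_lpoly[OF assms(1), of "k - i" "2 * i" "n - k - i"] by (simp only: deg)
  qed
  finally show "(\<lambda>v. p v - ?W v) \<in> lpoly n" .
qed

lemma lpoly_real_polynomial_function: "p \<in> lpoly n \<Longrightarrow> real_polynomial_function p"
proof -
  have "real_polynomial_function (\<lambda>v::real^3. v $ i)" for i
    by (intro real_polynomial_function.intros bounded_linear_vec_nth)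
  then have [simp]: "real_polynomial_function (monom3 i j k)" for i j k
    unfolding monom3_def by (intro real_polynomial_function.intros(4) real_polynomial_function_power)
  show "p \<in> lpoly n \<Longrightarrow> real_polynomial_function p"
    unfolding lpoly_def
    by (induction p rule: lspan.induct) (auto intro!: real_polynomial_function.intros(2-4))
qed

section \<open>The drift flow and the covariance matrices\<close>

text \<open>The coefficients of 1, N and N^2 in the exponential of \<open>a\<close> plus a nilpotent
  matrix N with N^3 = 0.\<close>

lemma exp_shifted_sums:
  fixes a :: real
  shows "(\<lambda>k. a ^ k / fact k) sums exp a"
    and "(\<lambda>k. real k * a ^ (k - 1) / fact k) sums exp a"
    and "(\<lambda>k. real (k choose 2) * a ^ (k - 2) / fact k) sums (exp a / 2)"
proof -
  show 0: "(\<lambda>k. a ^ k / fact k) sums exp a"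
    using exp_converges[of a] by (simp add: divide_inverse mult.commute)
  have "(\<lambda>k. real (Suc k) * a ^ (Suc k - 1) / fact (Suc k)) = (\<lambda>k. a ^ k / fact k)"
    by (auto simp: fact_Suc field_simps simp del: of_nat_Suc)
  with 0 have "(\<lambda>k. real (Suc k) * a ^ (Suc k - 1) / fact (Suc k)) sums exp a" by (simp only:)
  from sums_Suc[OF this] show "(\<lambda>k. real k * a ^ (k - 1) / fact k) sums exp a" by simp
  have "real (k + 2 choose 2) * a ^ (k + 2 - 2) / fact (k + 2) = (a ^ k / fact k) / 2" for k
  proof -
    have *: "real (k + 2 choose 2) = fact (k + 2) / (2 * fact k)"
      using binomial_fact[of 2 "k + 2", where 'a = real] by simp
    define F :: real where "F = fact (k + 2)"
    have "F \<noteq> 0" by (simp add: F_def)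
    then show ?thesis unfolding * F_def[symmetric] by simp
  qed
  with sums_divide[OF 0, of 2] have "(\<lambda>k. real (k + 2 choose 2) * a ^ (k + 2 - 2) / fact (k + 2)) sums (exp a / 2)"
    by (simp only:)
  then show "(\<lambda>k. real (k choose 2) * a ^ (k - 2) / fact k) sums (exp a / 2)"
    by (subst (asm) sums_iff_shift) (simp add: numeral_2_eq_2 lessThan_Suc)
qed

lemma matrix_add_rdistrib: "(A + B) ** C = A ** C + B ** (C :: real ^ 'n ^ 'm)"
  by (simp add: vec_eq_iff matrix_matrix_mult_def sum.distrib distrib_right)

text \<open>A scalar matrix commutes with \<open>N\<close>, so powers follow the binomial theorem,
  which stops after the second power of \<open>N\<close>. Where \<open>k - 1\<close> or
  \<open>k - 2\<close> is cut off at 0, the coefficient in front is zero.\<close>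

lemma mat_exp_nilpotent:
  fixes N :: "real ^ 'n ^ 'n"
  assumes "N ** (N ** N) = 0"
  shows "mat_exp (a *\<^sub>R mat 1 + t *\<^sub>R N) = exp a *\<^sub>R (mat 1 + t *\<^sub>R N + (t\<^sup>2 / 2) *\<^sub>R (N ** N))"
proof -
  let ?A = "a *\<^sub>R mat 1 + t *\<^sub>R N"
  have pow: "(((**) ?A) ^^ k) (mat 1) =
      a ^ k *\<^sub>R mat 1 + (real k * t * a ^ (k - 1)) *\<^sub>R N + (real (k choose 2) * t\<^sup>2 * a ^ (k - 2)) *\<^sub>R (N ** N)" for k
  proof (induction k)
    case (Suc k)
    have 1: "real k * a ^ (k - 1) * a = real k * a ^ k" by (cases k) auto
    have 2: "real (k choose 2) * a ^ (k - 2) * a = real (k choose 2) * a ^ (k - 1)"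
    proof (cases "k \<ge> 2")
      case True
      then have "k - 1 = Suc (k - 2)" by simp
      then show ?thesis by simp
    qed (simp add: binomial_eq_0)
    have c: "real (Suc k choose 2) = real k + real (k choose 2)"
      by (simp add: numeral_2_eq_2)
    have "(((**) ?A) ^^ Suc k) (mat 1) = (a * a ^ k) *\<^sub>R mat 1
        + (a * (real k * t * a ^ (k - 1)) + t * a ^ k) *\<^sub>R N
        + (a * (real (k choose 2) * t\<^sup>2 * a ^ (k - 2)) + t * (real k * t * a ^ (k - 1))) *\<^sub>R (N ** N)"
      using assms
      by (simp add: Suc matrix_add_ldistrib matrix_add_rdistrib matrix_scalar_ac flip: scalar_matrix_assoc)
        (simp add: scaleR_add_left scaleR_add_right mult_ac)
    also have "a * (real k * t * a ^ (k - 1)) + t * a ^ k = real (Suc k) * t * a ^ (Suc k - 1)"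
    proof -
      have "a * (real k * t * a ^ (k - 1)) = (real k * a ^ (k - 1) * a) * t" by simp
      then show ?thesis unfolding 1 by (simp add: algebra_simps)
    qed
    also have "a * (real (k choose 2) * t\<^sup>2 * a ^ (k - 2)) + t * (real k * t * a ^ (k - 1)) =
       real (Suc k choose 2) * t\<^sup>2 * a ^ (Suc k - 2)"
    proof -
      have "a * (real (k choose 2) * t\<^sup>2 * a ^ (k - 2)) = (real (k choose 2) * a ^ (k - 2) * a) * t\<^sup>2" by simp
      moreover have "Suc k - 2 = k - 1" by simp
      ultimately show ?thesis unfolding 2 c by (simp add: algebra_simps power2_eq_square)
    qed
    finally show ?case by simp
  qed (simp add: binomial_eq_0)
  have "(\<lambda>k. (1 / fact k) *\<^sub>R (((**) ?A) ^^ k) (mat 1)) =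
     (\<lambda>k. (a ^ k / fact k) *\<^sub>R mat 1 + (real k * a ^ (k - 1) / fact k * t) *\<^sub>R N
        + (real (k choose 2) * a ^ (k - 2) / fact k * t\<^sup>2) *\<^sub>R (N ** N))"
    by (simp add: pow scaleR_add_right mult_ac)
  also have "\<dots> sums (exp a *\<^sub>R mat 1 + (exp a * t) *\<^sub>R N + (exp a / 2 * t\<^sup>2) *\<^sub>R (N ** N))"
    by (intro sums_add bounded_linear.sums[OF bounded_linear_scaleR_left] sums_mult2 exp_shifted_sums)
  finally show ?thesis
    unfolding mat_exp_def by (subst sums_unique[symmetric]) (auto simp: scaleR_add_right)
qed

section \<open>The flow of the drift and its adjoint\<close>

definition flow :: "real \<Rightarrow> real \<Rightarrow> real ^ 3 \<Rightarrow> real ^ 3" where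
  "flow c t v = exp (- (c * t)) *\<^sub>R shear t v"

text \<open>The adjoint of the flow, exp (t B^T). It acts on the frequency \<open>\<xi>\<close> of
  an exponential function when the flow acts on its argument.\<close>

definition coflow :: "real \<Rightarrow> real \<Rightarrow> real ^ 3 \<Rightarrow> real ^ 3" where
  "coflow c t v = exp (- (c * t)) *\<^sub>R vector [v $ 1, t * v $ 1 + v $ 2, t\<^sup>2 / 2 * v $ 1 + t * v $ 2 + v $ 3]"

definition shift_mat :: "real ^ 3 ^ 3" where
  "shift_mat = vector [vector [0, 1, 0], vector [0, 0, 1], vector [0, 0, 0]]"

lemma shift_mat_nth [simp]:
  "shift_mat $ 1 $ 1 = 0" "shift_mat $ 1 $ 2 = 1" "shift_mat $ 1 $ 3 = 0"
  "shift_mat $ 2 $ 1 = 0" "shift_mat $ 2 $ 2 = 0" "shift_mat $ 2 $ 3 = 1"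
  "shift_mat $ 3 $ 1 = 0" "shift_mat $ 3 $ 2 = 0" "shift_mat $ 3 $ 3 = 0"
  by (simp_all add: shift_mat_def)

lemma shift_mat_nilpotent: "shift_mat ** (shift_mat ** shift_mat) = 0"
  by (simp add: vec_eq_iff forall_3 matrix_matrix_mult_def sum_3)

lemma OU_B_eq: "t *\<^sub>R OU_B c = (- (c * t)) *\<^sub>R mat 1 + t *\<^sub>R shift_mat"
  by (simp add: OU_B_def vec_eq_iff forall_3 mat_def)

definition flow_mat :: "real \<Rightarrow> real \<Rightarrow> real ^ 3 ^ 3" where
  "flow_mat c t = exp (- (c * t)) *\<^sub>R (mat 1 + t *\<^sub>R shift_mat + (t\<^sup>2 / 2) *\<^sub>R (shift_mat ** shift_mat))"

lemma mat_exp_OU_B: "mat_exp (t *\<^sub>R OU_B c) = flow_mat c t"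
  unfolding OU_B_eq mat_exp_nilpotent[OF shift_mat_nilpotent] flow_mat_def ..

lemma transpose_add: "transpose (A + B) = transpose A + transpose (B :: real ^ 'n ^ 'm)"
  by (simp add: transpose_def vec_eq_iff)

lemma mat_exp_transpose_OU_B: "mat_exp (t *\<^sub>R transpose (OU_B c)) = transpose (flow_mat c t)"
proof -
  let ?N = "transpose shift_mat"
  have "?N ** (?N ** ?N) = 0"
    by (simp add: vec_eq_iff forall_3 matrix_matrix_mult_def sum_3 transpose_def)
  moreover have "t *\<^sub>R transpose (OU_B c) = (- (c * t)) *\<^sub>R mat 1 + t *\<^sub>R ?N"
    by (simp add: OU_B_def vec_eq_iff forall_3 mat_def transpose_def)
  ultimately show ?thesis
    by (simp only: mat_exp_nilpotent flow_mat_def transpose_scalar transpose_add transpose_mat matrix_transpose_mul)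
qed

lemma flow_mat_mult: "flow_mat c t *v v = flow c t v"
  by (simp add: flow_mat_def flow_def vec_eq_iff forall_3 matrix_vector_mult_def sum_3 mat_def
      matrix_matrix_mult_def algebra_simps)

lemma transpose_flow_mat_mult: "transpose (flow_mat c t) *v v = coflow c t v"
  by (simp add: flow_mat_def coflow_def vec_eq_iff forall_3 matrix_vector_mult_def sum_3 mat_def
      matrix_matrix_mult_def transpose_def algebra_simps)

lemma mat_exp_OU_B_mult: "mat_exp (t *\<^sub>R OU_B c) *v v = flow c t v"
  by (simp add: mat_exp_OU_B flow_mat_mult)

lemma inner_flow: "\<xi> \<bullet> flow c t v = coflow c t \<xi> \<bullet> v"
  by (simp add: flow_def coflow_def inner_vec_def sum_3 algebra_simps)

lemma shear_add: "shear s (shear t v) = shear (s + t) v"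
  by (simp add: vec_eq_iff forall_3 power2_eq_square algebra_simps add_divide_distrib)

lemma shear_scaleR: "shear t (a *\<^sub>R v) = a *\<^sub>R shear t v"
  by (simp add: vec_eq_iff forall_3 algebra_simps)

lemma flow_add: "flow c s (flow c t v) = flow c (s + t) v"
  by (simp add: flow_def shear_scaleR shear_add algebra_simps flip: exp_add)

lemma flow_0 [simp]: "flow c 0 v = v"
  by (simp add: flow_def vec_eq_iff forall_3)

lemma coflow_0 [simp]: "coflow c 0 v = v"
  by (simp add: coflow_def vec_eq_iff forall_3)

lemma linear_flow: "linear (flow c t)"
  unfolding flow_mat_mult[symmetric, abs_def] by (rule matrix_vector_mul_linear)

text \<open>The solution \<open>Q\<close> of the Lyapunov equation \<open>B Q + Q B\<^sup>T = - \<sigma>\<^sup>2 I\<close>, that is, the limit of \<^const>\<open>OU_Q\<close>. The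
  covariance matrix of the invariant measure is \<open>2 Q\<close>.\<close>

definition OU_cov :: "real \<Rightarrow> real \<Rightarrow> real ^ 3 ^ 3" where
  "OU_cov c \<sigma> = (let a = 1 / (2 * c) in \<sigma>\<^sup>2 *\<^sub>R
     vector [vector [a + 2 * a ^ 3 + 6 * a ^ 5, a\<^sup>2 + 3 * a ^ 4, a ^ 3],
             vector [a\<^sup>2 + 3 * a ^ 4, a + 2 * a ^ 3, a\<^sup>2],
             vector [a ^ 3, a\<^sup>2, a]])"

lemma OU_cov_sym: "(OU_cov c \<sigma> *v \<xi>) \<bullet> \<eta> = (OU_cov c \<sigma> *v \<eta>) \<bullet> \<xi>"
  by (simp add: OU_cov_def Let_def inner_vec_def matrix_vector_mult_def sum_3 algebra_simps)

text \<open>The two vectors are B^T x and B^T y, the velocities of \<open>coflow\<close>. In this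
  bilinear form the equation is ready for differentiation along \<open>coflow\<close>.\<close>

lemma OU_cov_lyapunov:
  assumes "c > 0"
  shows "(OU_cov c \<sigma> *v vector [- c * x $ 1, - c * x $ 2 + x $ 1, - c * x $ 3 + x $ 2]) \<bullet> y
     + (OU_cov c \<sigma> *v x) \<bullet> vector [- c * y $ 1, - c * y $ 2 + y $ 1, - c * y $ 3 + y $ 2] = - \<sigma>\<^sup>2 * (x \<bullet> y)"
proof -
  define a where "a = 1 / (2 * c)"
  have a: "2 * c * a = 1" using assms by (simp add: a_def)
  \<comment> \<open>The entries of \<open>OU_cov\<close> are polynomials in a = 1 / (2 c), and a
    factor \<open>c\<close> just lowers a power of \<open>a\<close> by one and halves it. The claim
    thereby becomes a comparison of polynomials in \<open>a\<close>.\<close>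
  have p: "c * a ^ Suc k = a ^ k / 2" for k
    using a by (simp add: field_simps)
  have p': "c * a = 1 / 2" "c * a\<^sup>2 = a / 2" "c * a ^ 3 = a\<^sup>2 / 2" "c * a ^ 4 = a ^ 3 / 2" "c * a ^ 5 = a ^ 4 / 2"
    using p[of 0] p[of 1] p[of 2] p[of 3] p[of 4] by (simp_all add: eval_nat_numeral)
  have "((a + 2 * a ^ 3 + 6 * a ^ 5) * (- c * x $ 1) + (a\<^sup>2 + 3 * a ^ 4) * (- c * x $ 2 + x $ 1) + a ^ 3 * (- c * x $ 3 + x $ 2)) * y $ 1
      + ((a\<^sup>2 + 3 * a ^ 4) * (- c * x $ 1) + (a + 2 * a ^ 3) * (- c * x $ 2 + x $ 1) + a\<^sup>2 * (- c * x $ 3 + x $ 2)) * y $ 2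
      + (a ^ 3 * (- c * x $ 1) + a\<^sup>2 * (- c * x $ 2 + x $ 1) + a * (- c * x $ 3 + x $ 2)) * y $ 3
      + (((a + 2 * a ^ 3 + 6 * a ^ 5) * x $ 1 + (a\<^sup>2 + 3 * a ^ 4) * x $ 2 + a ^ 3 * x $ 3) * (- c * y $ 1)
      + ((a\<^sup>2 + 3 * a ^ 4) * x $ 1 + (a + 2 * a ^ 3) * x $ 2 + a\<^sup>2 * x $ 3) * (- c * y $ 2 + y $ 1)
      + (a ^ 3 * x $ 1 + a\<^sup>2 * x $ 2 + a * x $ 3) * (- c * y $ 3 + y $ 2))
     = - (x $ 1 * y $ 1 + x $ 2 * y $ 2 + x $ 3 * y $ 3)" (is "?L = ?R")
  proof -
    have "?L = - 2 * (c * a + 2 * (c * a ^ 3) + 6 * (c * a ^ 5)) * x $ 1 * y $ 1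
       + 2 * (a\<^sup>2 + 3 * a ^ 4) * x $ 1 * y $ 1
       + (a + 2 * a ^ 3 + a ^ 3 - 2 * (c * a\<^sup>2 + 3 * (c * a ^ 4))) * (x $ 1 * y $ 2 + x $ 2 * y $ 1)
       + (a\<^sup>2 - 2 * (c * a ^ 3)) * (x $ 1 * y $ 3 + x $ 3 * y $ 1)
       + (2 * a\<^sup>2 - 2 * (c * a + 2 * (c * a ^ 3))) * x $ 2 * y $ 2
       + (a - 2 * (c * a\<^sup>2)) * (x $ 2 * y $ 3 + x $ 3 * y $ 2)
       - 2 * (c * a) * x $ 3 * y $ 3"
      by (simp add: algebra_simps)
    also have "\<dots> = ?R" unfolding p' by (simp add: algebra_simps)
    finally show ?thesis .
  qed
  moreover have *: "(OU_cov c \<sigma> *v vector [- c * x $ 1, - c * x $ 2 + x $ 1, - c * x $ 3 + x $ 2]) \<bullet> y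
     + (OU_cov c \<sigma> *v x) \<bullet> vector [- c * y $ 1, - c * y $ 2 + y $ 1, - c * y $ 3 + y $ 2] = \<sigma>\<^sup>2 * ?L"
    unfolding OU_cov_def Let_def a_def[symmetric]
    by (simp add: inner_vec_def matrix_vector_mult_def sum_3 algebra_simps)
  ultimately show ?thesis
    by (simp only: *) (simp add: inner_vec_def sum_3 algebra_simps)
qed

lemma det_OU_cov:
  assumes "c > 0" "\<sigma> > 0"
  shows "det (OU_cov c \<sigma>) > 0"
proof -
  define a where "a = 1 / (2 * c)"
  have "a > 0" using assms by (simp add: a_def)
  have "det (OU_cov c \<sigma>) = \<sigma> ^ 6 * (a * (a\<^sup>2 + 2 * a ^ 4 + 3 * a ^ 6 + a ^ 8))"
    by (simp add: OU_cov_def Let_def det_3 flip: a_def) (simp add: algebra_simps eval_nat_numeral)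
  also have "\<dots> > 0" using \<open>a > 0\<close> assms by (intro mult_pos_pos add_pos_pos zero_less_power) auto
  finally show ?thesis .
qed

lemma coflow_deriv:
  "((\<lambda>s. coflow c s \<xi> $ 1) has_real_derivative - c * coflow c s \<xi> $ 1) (at s within S)"
  "((\<lambda>s. coflow c s \<xi> $ 2) has_real_derivative - c * coflow c s \<xi> $ 2 + coflow c s \<xi> $ 1) (at s within S)"
  "((\<lambda>s. coflow c s \<xi> $ 3) has_real_derivative - c * coflow c s \<xi> $ 3 + coflow c s \<xi> $ 2) (at s within S)"
  unfolding coflow_def
  by (auto intro!: derivative_eq_intros simp: field_simps)

section \<open>The matrices Q_t as bilinear forms\<close>

lemma bounded_linear_matrix_entry: "bounded_linear (\<lambda>M :: real ^ 3 ^ 3. (M *v \<xi>) \<bullet> \<eta>)"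
proof -
  have "linear (\<lambda>M :: real ^ 3 ^ 3. (M *v \<xi>) \<bullet> \<eta>)"
    by (rule linearI) (simp_all add: matrix_vector_mult_add_rdistrib inner_add_left flip: scaleR_matrix_vector_assoc)
  then show ?thesis by (rule linear_conv_bounded_linear[THEN iffD1])
qed

lemma continuous_flow_mat_square: "continuous_on S (\<lambda>s. flow_mat c s ** transpose (flow_mat c s))"
proof -
  have "bilinear ((**) :: real ^ 3 ^ 3 \<Rightarrow> real ^ 3 ^ 3 \<Rightarrow> real ^ 3 ^ 3)"
    unfolding bilinear_def
    by (auto intro!: linearI simp: matrix_add_ldistrib matrix_add_rdistrib matrix_scalar_ac scalar_matrix_assoc)
  then have bb: "bounded_bilinear ((**) :: real ^ 3 ^ 3 \<Rightarrow> real ^ 3 ^ 3 \<Rightarrow> real ^ 3 ^ 3)"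
    by (simp add: bilinear_conv_bounded_bilinear)
  have lt: "linear (transpose :: real ^ 3 ^ 3 \<Rightarrow> real ^ 3 ^ 3)"
    by (rule linearI) (simp_all add: transpose_add transpose_scalar)
  have 1: "continuous_on S (flow_mat c)" for S
    unfolding flow_mat_def by (intro continuous_intros) auto
  have "continuous_on S (\<lambda>s. transpose (flow_mat c s))"
    by (intro linear_continuous_on_compose[OF 1 lt])
  then show ?thesis by (intro bounded_bilinear.continuous_on[OF bb] 1)
qed

lemma OU_Q_inner:
  "((\<lambda>s. \<sigma>\<^sup>2 * (coflow c s \<xi> \<bullet> coflow c s \<eta>)) has_integral (OU_Q c \<sigma> t *v \<xi>) \<bullet> \<eta>) {0..t}"
proof -
  let ?f = "\<lambda>s. flow_mat c s ** transpose (flow_mat c s)"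
  have eq: "(?f s *v \<xi>) \<bullet> \<eta> = coflow c s \<xi> \<bullet> coflow c s \<eta>" for s
  proof -
    have "(?f s *v \<xi>) \<bullet> \<eta> = \<eta> \<bullet> flow c s (coflow c s \<xi>)"
      by (simp only: matrix_vector_mul_assoc[symmetric] flow_mat_mult transpose_flow_mat_mult inner_commute)
    then show ?thesis by (simp add: inner_flow inner_commute)
  qed
  have "(?f has_integral integral {0..t} ?f) {0..t}"
    by (intro integrable_integral integrable_continuous_real continuous_flow_mat_square)
  from has_integral_linear[OF this bounded_linear_matrix_entry[of \<xi> \<eta>]]
  have "((\<lambda>s. coflow c s \<xi> \<bullet> coflow c s \<eta>) has_integral (integral {0..t} ?f *v \<xi>) \<bullet> \<eta>) {0..t}"
    by (simp add: o_def eq)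
  from has_integral_mult_right[OF this, of "\<sigma>\<^sup>2"] show ?thesis
    by (simp add: OU_Q_def mat_exp_OU_B mat_exp_transpose_OU_B flip: scaleR_matrix_vector_assoc)
qed

text \<open>By the Lyapunov equation, minus the form of \<open>OU_cov\<close> evaluated along
  \<open>coflow\<close> is an antiderivative of the integrand.\<close>

lemma OU_Q_eq:
  assumes "c > 0" "t \<ge> 0"
  shows "(OU_Q c \<sigma> t *v \<xi>) \<bullet> \<eta> = (OU_cov c \<sigma> *v \<xi>) \<bullet> \<eta> - (OU_cov c \<sigma> *v coflow c t \<xi>) \<bullet> coflow c t \<eta>"
proof -
  define F where "F s = - ((OU_cov c \<sigma> *v coflow c s \<xi>) \<bullet> coflow c s \<eta>)" for s
  have "(F has_real_derivative \<sigma>\<^sup>2 * (coflow c s \<xi> \<bullet> coflow c s \<eta>)) (at s within S)" for s S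
  proof -
    let ?x = "coflow c s \<xi>" and ?y = "coflow c s \<eta>"
    have "(F has_real_derivative
       - ((OU_cov c \<sigma> *v vector [- c * ?x $ 1, - c * ?x $ 2 + ?x $ 1, - c * ?x $ 3 + ?x $ 2]) \<bullet> ?y
     + (OU_cov c \<sigma> *v ?x) \<bullet> vector [- c * ?y $ 1, - c * ?y $ 2 + ?y $ 1, - c * ?y $ 3 + ?y $ 2])) (at s within S)"
      unfolding F_def inner_vec_def matrix_vector_mult_def sum_3
      by (auto intro!: derivative_eq_intros coflow_deriv simp: sum_3 algebra_simps)
    then show ?thesis using assms by (simp only: OU_cov_lyapunov) simp
  qed
  then have "((\<lambda>s. \<sigma>\<^sup>2 * (coflow c s \<xi> \<bullet> coflow c s \<eta>)) has_integral F t - F 0) {0..t}"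
    using assms by (intro fundamental_theorem_of_calculus) (auto simp: has_real_derivative_iff_has_vector_derivative)
  with OU_Q_inner[of \<sigma> c \<xi> \<eta> t] show ?thesis
    by (auto simp: F_def dest: has_integral_unique)
qed

lemma OU_Q_sym: "(OU_Q c \<sigma> t *v \<xi>) \<bullet> \<eta> = (OU_Q c \<sigma> t *v \<eta>) \<bullet> \<xi>"
  using OU_Q_inner[of \<sigma> c \<xi> \<eta> t] OU_Q_inner[of \<sigma> c \<eta> \<xi> t]
  by (simp add: inner_commute has_integral_unique)

text \<open>The integrand is continuous and nonnegative, and at time 0, where \<open>coflow\<close>
  is the identity, it is positive.\<close>

lemma OU_Q_pos:
  assumes "t > 0" "\<sigma> > 0" "\<xi> \<noteq> 0"
  shows "(OU_Q c \<sigma> t *v \<xi>) \<bullet> \<xi> > 0"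
proof -
  let ?f = "\<lambda>s. \<sigma>\<^sup>2 * (coflow c s \<xi> \<bullet> coflow c s \<xi>)"
  have cont: "continuous_on {0..t} ?f"
    unfolding inner_vec_def sum_3 coflow_def by (auto intro!: continuous_intros)
  have I: "integral {0..t} ?f = (OU_Q c \<sigma> t *v \<xi>) \<bullet> \<xi>"
    by (rule integral_unique[OF OU_Q_inner])
  have "integral {0..t} ?f \<ge> 0" by (intro Henstock_Kurzweil_Integration.integral_nonneg integrable_continuous_real cont) auto
  moreover have "integral {0..t} ?f \<noteq> 0"
  proof
    assume "integral {0..t} ?f = 0"
    then have "\<forall>s\<in>{0..t}. ?f s = 0" using integral_eq_0_iff[OF cont] assms by auto
    from bspec[OF this, of 0] show False using assms by simp
  qed
  ultimately show ?thesis unfolding I by simp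
qed

text \<open>The polynomial factor is the price of the Jordan block, and 3 is the number of
  coordinates; what matters is the decay as \<open>t\<close> grows.\<close>

lemma norm_coflow_le:
  assumes "c > 0" "t \<ge> 0"
  shows "norm (coflow c t \<xi>) \<le> 3 * (exp (- (c * t)) * (1 + t + t\<^sup>2)) * norm \<xi>"
proof -
  let ?e = "exp (- (c * t))"
  have n: "\<bar>\<xi> $ i\<bar> \<le> norm \<xi>" for i by (rule component_le_norm_cart)
  have b: "\<bar>coflow c t \<xi> $ i\<bar> \<le> ?e * (1 + t + t\<^sup>2) * norm \<xi>" for i
  proof -
    have t2: "t\<^sup>2 / 2 \<le> t\<^sup>2" by simp
    have "\<bar>\<xi> $ 1\<bar> \<le> (1 + t + t\<^sup>2) * norm \<xi>"
      using mult_mono[of 1 "1 + t + t\<^sup>2" "\<bar>\<xi> $ 1\<bar>" "norm \<xi>"] n[of 1] assms by auto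
    moreover have "\<bar>t * \<xi> $ 1 + \<xi> $ 2\<bar> \<le> (1 + t + t\<^sup>2) * norm \<xi>"
    proof -
      have "\<bar>t * \<xi> $ 1 + \<xi> $ 2\<bar> \<le> t * \<bar>\<xi> $ 1\<bar> + \<bar>\<xi> $ 2\<bar>"
        using assms by (intro abs_triangle_ineq[THEN order_trans]) (simp add: abs_mult)
      also have "\<dots> \<le> t * norm \<xi> + norm \<xi> + t\<^sup>2 * norm \<xi>"
        using n assms by (intro add_increasing2 add_mono mult_left_mono) auto
      finally show ?thesis by (simp add: algebra_simps)
    qed
    moreover have "\<bar>t\<^sup>2 / 2 * \<xi> $ 1 + t * \<xi> $ 2 + \<xi> $ 3\<bar> \<le> (1 + t + t\<^sup>2) * norm \<xi>"
    proof -
      have "\<bar>t\<^sup>2 / 2 * \<xi> $ 1 + t * \<xi> $ 2 + \<xi> $ 3\<bar> \<le> t\<^sup>2 / 2 * \<bar>\<xi> $ 1\<bar> + t * \<bar>\<xi> $ 2\<bar> + \<bar>\<xi> $ 3\<bar>"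
        using assms by (intro abs_triangle_ineq[THEN order_trans] add_mono) (auto simp: abs_mult)
      also have "\<dots> \<le> t\<^sup>2 * norm \<xi> + t * norm \<xi> + norm \<xi>"
        using n assms by (intro add_mono mult_mono) auto
      finally show ?thesis by (simp add: algebra_simps)
    qed
    ultimately have "\<bar>?e * (vector [\<xi> $ 1, t * \<xi> $ 1 + \<xi> $ 2, t\<^sup>2 / 2 * \<xi> $ 1 + t * \<xi> $ 2 + \<xi> $ 3] :: real ^ 3) $ i\<bar>
        \<le> ?e * ((1 + t + t\<^sup>2) * norm \<xi>)"
      using exhaust_3[of i] by (auto simp: abs_mult)
    then show ?thesis by (simp add: coflow_def mult.assoc)
  qed
  have "norm (coflow c t \<xi>) \<le> (\<Sum>i\<in>UNIV. \<bar>coflow c t \<xi> $ i\<bar>)" by (rule norm_le_l1_cart)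
  also have "\<dots> \<le> (\<Sum>i\<in>(UNIV :: 3 set). ?e * (1 + t + t\<^sup>2) * norm \<xi>)" by (intro sum_mono b)
  finally show ?thesis by (simp add: mult_ac)
qed

section \<open>Gaussian integrals\<close>

text \<open>Measures are compared on boxes. The preimage of a box under \<open>f\<close> is its
  image under the inverse \<open>g\<close>, and the two determinants are reciprocal.\<close>

lemma lborel_linear_image:
  fixes f :: "real ^ 'n :: {finite, wellorder} \<Rightarrow> real ^ 'n :: {finite, wellorder}"
  assumes "linear f" "det (matrix f) \<noteq> 0"
  shows "lborel = density (distr lborel borel f) (\<lambda>_. ennreal \<bar>det (matrix f)\<bar>)"
proof (rule lborel_eqI)
  have "inj f" using assms by (simp add: det_nz_iff_inj)
  then obtain g where g: "linear g" "\<And>x. f (g x) = x" "\<And>x. g (f x) = x"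
    using linear_injective_isomorphism[OF assms(1)] by blast
  have fb[measurable]: "f \<in> borel_measurable borel"
    by (intro borel_measurable_continuous_onI linear_continuous_on linear_conv_bounded_linear[THEN iffD1] assms)
  have gb[measurable]: "g \<in> borel_measurable borel"
    by (intro borel_measurable_continuous_onI linear_continuous_on linear_conv_bounded_linear[THEN iffD1] g)
  have "f \<circ> g = id" using g by auto
  then have "det (matrix f) * det (matrix g) = 1"
    by (metis assms(1) det_I det_mul g(1) matrix_compose matrix_id_mat_1)
  then have dd: "\<bar>det (matrix f)\<bar> * \<bar>det (matrix g)\<bar> = 1"
    by (simp flip: abs_mult)
  fix l u :: "real ^ 'n :: {finite, wellorder}" assume le: "\<And>b. b \<in> Basis \<Longrightarrow> l \<bullet> b \<le> u \<bullet> b"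
  have vim: "f -` box l u = g ` box l u"
    using g by (auto simp: image_iff) metis
  have bd: "bounded (g ` box l u)"
    by (intro bounded_linear_image bounded_box linear_conv_bounded_linear[THEN iffD1] g)
  have sm: "f -` box l u \<in> sets borel"
    using measurable_sets[OF fb, of "box l u"] by simp
  have "emeasure lborel (f -` box l u) = ennreal (measure lebesgue (g ` box l u))"
  proof -
    have "emeasure lborel (f -` box l u) < \<infinity>"
      unfolding vim by (rule emeasure_bounded_finite[OF bd])
    then have "emeasure lborel (f -` box l u) = ennreal (measure lborel (f -` box l u))"
      by (simp add: emeasure_eq_ennreal_measure)
    also have "measure lborel (f -` box l u) = measure lebesgue (f -` box l u)"
      using sm by (simp add: measure_completion)
    finally show ?thesis unfolding vim .
  qed
  also have "measure lebesgue (g ` box l u) = \<bar>det (matrix g)\<bar> * measure lebesgue (box l u)"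
    by (rule measure_lebesgue_linear_transformation) (auto simp: g)
  also have "measure lebesgue (box l u) = (\<Prod>b\<in>Basis. (u - l) \<bullet> b)"
    using le by (simp add: measure_completion measure_lborel_box_eq)
  finally have em: "emeasure lborel (f -` box l u) = ennreal (\<bar>det (matrix g)\<bar> * (\<Prod>b\<in>Basis. (u - l) \<bullet> b))" .
  have nn: "(\<Prod>b\<in>Basis. (u - l) \<bullet> b) \<ge> 0"
    using le by (intro prod_nonneg) (simp add: inner_diff_left)
  have "emeasure (density (distr lborel borel f) (\<lambda>_. ennreal \<bar>det (matrix f)\<bar>)) (box l u) =
     ennreal \<bar>det (matrix f)\<bar> * emeasure lborel (f -` box l u)"
    by (simp add: emeasure_density_const emeasure_distr)
  also have "\<dots> = ennreal ((\<bar>det (matrix f)\<bar> * \<bar>det (matrix g)\<bar>) * (\<Prod>b\<in>Basis. (u - l) \<bullet> b))"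
    unfolding em using nn by (simp add: mult.assoc flip: ennreal_mult')
  finally show "emeasure (density (distr lborel borel f) (\<lambda>_. ennreal \<bar>det (matrix f)\<bar>)) (box l u) =
     ennreal (\<Prod>b\<in>Basis. (u - l) \<bullet> b)" unfolding dd by simp
qed simp

lemma nn_integral_linear_image:
  fixes f :: "real ^ 'n :: {finite, wellorder} \<Rightarrow> real ^ 'n :: {finite, wellorder}"
  assumes "linear f" "det (matrix f) \<noteq> 0" and [measurable]: "h \<in> borel_measurable borel"
  shows "(\<integral>\<^sup>+x. h x \<partial>lborel) = ennreal \<bar>det (matrix f)\<bar> * (\<integral>\<^sup>+x. h (f x) \<partial>lborel)"
proof -
  have [measurable]: "f \<in> borel_measurable borel"
    by (intro borel_measurable_continuous_onI linear_continuous_on linear_conv_bounded_linear[THEN iffD1] assms)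
  show ?thesis
    by (subst lborel_linear_image[OF assms(1,2)])
       (simp add: nn_integral_density nn_integral_distr nn_integral_cmult)
qed

text \<open>In each coordinate the integrand is \<open>sqrt (4 * pi)\<close> times the normal
  density of variance 2.\<close>

lemma gaussian_nn_integral:
  "(\<integral>\<^sup>+x. ennreal (exp (- (x \<bullet> x) / 4)) \<partial>(lborel :: 'a::euclidean_space measure)) =
     ennreal (sqrt (4 * pi) ^ DIM('a))"
proof -
  have 1: "(\<integral>\<^sup>+x. ennreal (exp (- (x\<^sup>2) / 4)) \<partial>lborel) = ennreal (sqrt (4 * pi))"
  proof -
    have "exp (- (x\<^sup>2) / 4) = sqrt (4 * pi) * normal_density 0 (sqrt 2) x" for x :: real
      by (simp add: normal_density_def)
    then have "(\<integral>\<^sup>+x. ennreal (exp (- (x\<^sup>2) / 4)) \<partial>lborel) =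
      ennreal (sqrt (4 * pi)) * (\<integral>\<^sup>+x. ennreal (normal_density 0 (sqrt 2) x) \<partial>lborel)"
      by (simp add: ennreal_mult' nn_integral_cmult)
    also have "(\<integral>\<^sup>+x. ennreal (normal_density 0 (sqrt 2) x) \<partial>lborel) = 1"
      by (subst nn_integral_eq_integral) auto
    finally show ?thesis by simp
  qed
  interpret product_sigma_finite "\<lambda>_ :: 'a. lborel :: real measure"
    by standard
  have "(\<integral>\<^sup>+x. ennreal (exp (- (x \<bullet> x) / 4)) \<partial>(lborel :: 'a measure)) =
     (\<integral>\<^sup>+f. (\<Prod>b\<in>Basis. ennreal (exp (- ((f b)\<^sup>2) / 4))) \<partial>(\<Pi>\<^sub>M b\<in>(Basis::'a set). lborel))"
  proof (subst lborel_eq, subst nn_integral_distr)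
    show "(\<integral>\<^sup>+f. ennreal (exp (- ((\<Sum>b\<in>Basis. f b *\<^sub>R b) \<bullet> (\<Sum>b\<in>Basis. f b *\<^sub>R b)) / 4)) \<partial>(\<Pi>\<^sub>M b\<in>(Basis::'a set). lborel)) =
       (\<integral>\<^sup>+f. (\<Prod>b\<in>Basis. ennreal (exp (- ((f b)\<^sup>2) / 4))) \<partial>(\<Pi>\<^sub>M b\<in>(Basis::'a set). lborel))"
    proof (rule nn_integral_cong)
      fix f :: "'a \<Rightarrow> real"
      have "(\<Sum>b\<in>Basis. f b *\<^sub>R b) \<bullet> (\<Sum>b\<in>Basis. f b *\<^sub>R b) = (\<Sum>b\<in>Basis. (f b)\<^sup>2)"
        by (subst euclidean_inner) (simp add: power2_eq_square)
      then show "ennreal (exp (- ((\<Sum>b\<in>Basis. f b *\<^sub>R b) \<bullet> (\<Sum>b\<in>Basis. f b *\<^sub>R b)) / 4)) =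
          (\<Prod>b\<in>Basis. ennreal (exp (- ((f b)\<^sup>2) / 4)))"
        by (simp add: prod_ennreal exp_sum[symmetric] sum_negf sum_divide_distrib)
    qed
  qed simp_all
  also have "\<dots> = (\<Prod>b\<in>(Basis::'a set). \<integral>\<^sup>+x. ennreal (exp (- (x\<^sup>2) / 4)) \<partial>lborel)"
    by (rule product_nn_integral_prod) auto
  also have "\<dots> = ennreal (sqrt (4 * pi) ^ DIM('a))"
    unfolding 1 by (simp add: ennreal_power)
  finally show ?thesis .
qed

text \<open>Elimination in the symmetric matrix. The pivots \<open>p\<close>, \<open>a\<close> and
  \<open>d\<close> are values of the quadratic form at suitable nonzero vectors; hence they are
  positive and have the square roots needed for \<open>L\<close>.\<close>

lemma cholesky_3:
  fixes Q :: "real ^ 3 ^ 3"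
  assumes sym: "\<And>\<xi> \<eta>. (Q *v \<xi>) \<bullet> \<eta> = (Q *v \<eta>) \<bullet> \<xi>"
    and pos: "\<And>\<xi>. \<xi> \<noteq> 0 \<Longrightarrow> (Q *v \<xi>) \<bullet> \<xi> > 0"
  obtains L :: "real ^ 3 ^ 3" where "Q = L ** transpose L"
proof -
  have e: "(Q *v axis j 1) \<bullet> axis i 1 = Q $ i $ j" for i j
    by (simp add: inner_axis matrix_vector_mult_basis column_def)
  have s: "Q $ 2 $ 1 = Q $ 1 $ 2" "Q $ 3 $ 1 = Q $ 1 $ 3" "Q $ 3 $ 2 = Q $ 2 $ 3"
    by (simp_all flip: e add: sym[of "axis 1 1"] sym[of "axis 2 1" "axis 3 1"])
  define p q r u v w where "p = Q $ 1 $ 1" "q = Q $ 1 $ 2" "r = Q $ 1 $ 3" "u = Q $ 2 $ 2" "v = Q $ 2 $ 3" "w = Q $ 3 $ 3"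
  note defs = this
  have form: "(Q *v vector [x, y, z]) \<bullet> vector [x, y, z] =
      p * x\<^sup>2 + 2 * q * x * y + 2 * r * x * z + u * y\<^sup>2 + 2 * v * y * z + w * z\<^sup>2" for x y z
    by (simp add: inner_vec_def matrix_vector_mult_def sum_3 defs s power2_eq_square algebra_simps)
  have nz: "(vector [x, y, z] :: real ^ 3) \<noteq> 0 \<longleftrightarrow> x \<noteq> 0 \<or> y \<noteq> 0 \<or> z \<noteq> 0" for x y z :: real
    by (auto simp: vec_eq_iff forall_3)
  have p: "p > 0" using pos[of "vector [1, 0, 0]"] unfolding form nz by simp
  define a where "a = u - q\<^sup>2 / p"
  have a: "a > 0"
    using pos[of "vector [- q / p, 1, 0]"] p unfolding form nz
    by (simp add: a_def field_simps power2_eq_square)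
  define b where "b = v - q * r / p"
  define d where "d = w - r\<^sup>2 / p - b\<^sup>2 / a"
  have d: "d > 0"
  proof -
    \<comment> \<open>With these values both squares in the completed form vanish and only the last
      pivot \<open>d\<close> is left.\<close>
    define y where "y = - b / a"
    define x where "x = - (q * y + r) / p"
    have "p * x\<^sup>2 + 2 * q * x * y + 2 * r * x * 1 + u * y\<^sup>2 + 2 * v * y * 1 + w * 1\<^sup>2
      = p * (x + (q * y + r) / p)\<^sup>2 + a * (y + b / a)\<^sup>2 + d"
    proof -
      have sq: "e * (x + s / e)\<^sup>2 = e * x\<^sup>2 + 2 * x * s + s\<^sup>2 / e" if "e > 0" for e x s :: real
        using that by (simp add: field_simps power2_eq_square)
      have "(q * y + r)\<^sup>2 / p = q\<^sup>2 / p * y\<^sup>2 + 2 * y * (q * r / p) + r\<^sup>2 / p"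
        using p by (simp add: field_simps power2_eq_square)
      then show ?thesis
        unfolding sq[OF p] sq[OF a] d_def by (simp add: a_def b_def algebra_simps)
    qed
    also have "x + (q * y + r) / p = 0" using p by (simp add: x_def field_simps)
    also have "y + b / a = 0" by (simp add: y_def)
    finally show ?thesis using pos[of "vector [x, y, 1]"] unfolding form nz by simp
  qed
  define L :: "real ^ 3 ^ 3" where "L = vector [vector [sqrt p, 0, 0], vector [q / sqrt p, sqrt a, 0],
     vector [r / sqrt p, b / sqrt a, sqrt d]]"
  have "Q = L ** transpose L"
    using p a d
    by (simp add: vec_eq_iff forall_3 matrix_matrix_mult_def sum_3 transpose_def L_def s flip: defs)
       (simp add: a_def b_def d_def power2_eq_square)
  then show thesis using that by blast
qed

lemma matrix_inv_mult:
  fixes A :: "real ^ 'n ^ 'n"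
  assumes "invertible A"
  shows "A ** matrix_inv A = mat 1" "matrix_inv A ** A = mat 1"
proof -
  have "A ** matrix_inv A = mat 1 \<and> matrix_inv A ** A = mat 1"
    using assms unfolding invertible_def matrix_inv_def by (rule someI_ex)
  then show "A ** matrix_inv A = mat 1" "matrix_inv A ** A = mat 1" by auto
qed

text \<open>With Q = L L^T, the substitution y = L u turns the quadratic form of the inverse matrix
  into u \<bullet> u, and the determinant of L is a square root of that of Q up to sign.\<close>

lemma gaussian_nn_integral_matrix:
  fixes Q :: "real ^ 3 ^ 3"
  assumes sym: "\<And>\<xi> \<eta>. (Q *v \<xi>) \<bullet> \<eta> = (Q *v \<eta>) \<bullet> \<xi>"
    and pos: "\<And>\<xi>. \<xi> \<noteq> 0 \<Longrightarrow> (Q *v \<xi>) \<bullet> \<xi> > 0"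
  shows "det Q > 0" and "invertible Q"
    and "(\<integral>\<^sup>+y. ennreal (exp (- ((matrix_inv Q *v y) \<bullet> y) / 4)) \<partial>lborel) = ennreal ((4 * pi) powr (3 / 2) * sqrt (det Q))"
proof -
  have "inj ((*v) Q)"
  proof (rule linear_injective_0[OF matrix_vector_mul_linear, THEN iffD2], intro allI impI)
    fix x assume "Q *v x = 0"
    then show "x = 0" using pos[of x] by auto
  qed
  then have "det Q \<noteq> 0" using det_nz_iff_inj[OF matrix_vector_mul_linear[of Q]] by simp
  obtain L :: "real ^ 3 ^ 3" where L: "Q = L ** transpose L" by (rule cholesky_3[OF assms])
  have detL: "det Q = (det L)\<^sup>2" by (simp only: L det_mul det_transpose power2_eq_square)
  with \<open>det Q \<noteq> 0\<close> have "det L \<noteq> 0" by auto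
  then show "det Q > 0" by (simp add: detL)
  show inv: "invertible Q" using \<open>det Q \<noteq> 0\<close> by (simp add: invertible_det_nz)
  have form: "(matrix_inv Q *v (L *v u)) \<bullet> (L *v u) = u \<bullet> u" for u
  proof -
    have iT: "invertible (transpose L)" using \<open>det L \<noteq> 0\<close> by (simp add: invertible_det_nz det_transpose)
    define x where "x = matrix_inv (transpose L) *v u"
    have x: "transpose L *v x = u"
      by (simp only: x_def matrix_vector_mul_assoc matrix_inv_mult(1)[OF iT] matrix_vector_mul_lid)
    have Lu: "L *v u = Q *v x" by (simp only: L x[symmetric] matrix_vector_mul_assoc)
    have "matrix_inv Q *v (L *v u) = x"
      by (simp only: Lu matrix_vector_mul_assoc matrix_inv_mult(2)[OF inv] matrix_vector_mul_lid)
    then have "(matrix_inv Q *v (L *v u)) \<bullet> (L *v u) = x \<bullet> (L *v u)" by simp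
    also have "\<dots> = (transpose L *v x) \<bullet> u"
      by (simp only: transpose_matrix_vector dot_lmul_matrix)
    finally show ?thesis by (simp only: x)
  qed
  have m: "matrix ((*v) L) = L" by simp
  have "(\<integral>\<^sup>+y. ennreal (exp (- ((matrix_inv Q *v y) \<bullet> y) / 4)) \<partial>lborel) =
      ennreal \<bar>det L\<bar> * (\<integral>\<^sup>+u. ennreal (exp (- (u \<bullet> u) / 4)) \<partial>(lborel :: (real ^ 3) measure))"
  proof (subst nn_integral_linear_image[OF matrix_vector_mul_linear[of L]])
    show "(\<lambda>y. ennreal (exp (- ((matrix_inv Q *v y) \<bullet> y) / 4))) \<in> borel_measurable borel"
      by (intro measurable_compose[OF _ measurable_ennreal] borel_measurable_continuous_onI continuous_intros
          linear_continuous_on linear_conv_bounded_linear[THEN iffD1] matrix_vector_mul_linear) auto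
    show "det (matrix ((*v) L)) \<noteq> 0" using \<open>det L \<noteq> 0\<close> by simp
  qed (simp only: form m)
  also have "\<dots> = ennreal \<bar>det L\<bar> * ennreal (sqrt (4 * pi) ^ 3)"
    by (subst gaussian_nn_integral) simp
  also have "sqrt (4 * pi) ^ 3 = (4 * pi) powr (3 / 2)"
  proof -
    have 1: "sqrt (4 * pi) ^ 3 = sqrt (4 * pi) powr real 3" by (rule powr_realpow[symmetric]) simp
    have 2: "sqrt (4 * pi) = (4 * pi) powr (1 / 2)" by (rule powr_half_sqrt[symmetric]) simp
    show ?thesis by (subst 1, subst 2, subst powr_powr) simp
  qed
  also have "\<bar>det L\<bar> = sqrt (det Q)" by (simp add: detL)
  finally show "(\<integral>\<^sup>+y. ennreal (exp (- ((matrix_inv Q *v y) \<bullet> y) / 4)) \<partial>lborel) = ennreal ((4 * pi) powr (3 / 2) * sqrt (det Q))"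
    by (subst (asm) ennreal_mult'[symmetric]) (auto simp: mult.commute detL)
qed

section \<open>Laplace transforms determine finite measures\<close>

lemma exp_abs_le: "exp \<bar>y\<bar> \<le> exp y + exp (- y :: real)"
  by (cases "y \<ge> 0") (auto simp: add_increasing add_increasing2)

lemma exp_moment_series:
  fixes y :: "'a \<Rightarrow> real" and z :: complex
  assumes int: "\<And>s. integrable M (\<lambda>x. exp (s * y x))" and [measurable]: "y \<in> borel_measurable M"
  shows "(\<lambda>k. of_real ((\<integral>x. y x ^ k \<partial>M) / fact k) * z ^ k) sums (\<integral>x. exp (z * of_real (y x)) \<partial>M)"
proof -
  have dom: "integrable M (\<lambda>x. exp (s * y x) + exp (- s * y x))" for s
    using int[of s] int[of "- s"] by (rule Bochner_Integration.integrable_add)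
  have intk: "integrable M (\<lambda>x. y x ^ k)" for k
  proof -
    have "integrable M (\<lambda>x. fact k * (exp (1 * y x) + exp (- 1 * y x)))"
      using dom[of 1] by (rule integrable_mult_right)
    then show ?thesis
    proof (rule Bochner_Integration.integrable_bound)
      have "\<bar>y x\<bar> ^ k \<le> fact k * (exp (y x) + exp (- y x))" for x
      proof -
        have "\<bar>y x\<bar> ^ k / fact k \<le> exp \<bar>y x\<bar>"
        proof -
          have "(\<Sum>i\<in>{k}. \<bar>y x\<bar> ^ i /\<^sub>R fact i) \<le> (\<Sum>i. \<bar>y x\<bar> ^ i /\<^sub>R fact i)"
            by (intro sum_le_suminf summable_exp_generic) auto
          then show ?thesis by (simp add: exp_def divide_inverse mult.commute)
        qed
        also note exp_abs_le
        finally show ?thesis by (simp add: field_simps)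
      qed
      then show "AE x in M. norm (y x ^ k) \<le> norm (fact k * (exp (1 * y x) + exp (- 1 * y x)))"
        by (auto simp: power_abs abs_mult)
    qed simp
  qed
  have eq: "(\<integral>x. (\<Sum>k<n. (z * of_real (y x)) ^ k /\<^sub>R fact k) \<partial>M) =
      (\<Sum>k<n. of_real ((\<integral>x. y x ^ k \<partial>M) / fact k) * z ^ k)" for n
  proof -
    have "(z * of_real (y x)) ^ k /\<^sub>R fact k = (z ^ k / fact k) * of_real (y x ^ k)" for x k
      by (simp add: power_mult_distrib scaleR_conv_of_real divide_inverse)
    then have "(\<integral>x. (\<Sum>k<n. (z * of_real (y x)) ^ k /\<^sub>R fact k) \<partial>M) =
      (\<integral>x. (\<Sum>k<n. (z ^ k / fact k) * of_real (y x ^ k)) \<partial>M)" by simp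
    also have "\<dots> = (\<Sum>k<n. (z ^ k / fact k) * of_real (\<integral>x. y x ^ k \<partial>M))"
      using intk by (subst Bochner_Integration.integral_sum)
        (simp_all add: integral_complex_of_real integrable_of_real del: of_real_power)
    finally show ?thesis by (simp add: mult.commute)
  qed
  have "(\<lambda>n. \<integral>x. (\<Sum>k<n. (z * of_real (y x)) ^ k /\<^sub>R fact k) \<partial>M) \<longlonglongrightarrow> (\<integral>x. exp (z * of_real (y x)) \<partial>M)"
  proof (rule integral_dominated_convergence)
    show "integrable M (\<lambda>x. exp (norm z * y x) + exp (- norm z * y x))" by (rule dom)
    show "AE x in M. (\<lambda>n. \<Sum>k<n. (z * of_real (y x)) ^ k /\<^sub>R fact k) \<longlonglongrightarrow> exp (z * of_real (y x))"
      using exp_converges[of "z * of_real _"] unfolding sums_def by auto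
    fix n
    have "norm (\<Sum>k<n. (z * of_real (y x)) ^ k /\<^sub>R fact k) \<le> exp (norm z * y x) + exp (- norm z * y x)" for x
    proof -
      have "norm (\<Sum>k<n. (z * of_real (y x)) ^ k /\<^sub>R fact k) \<le> (\<Sum>k<n. norm (z * of_real (y x)) ^ k /\<^sub>R fact k)"
        by (rule order_trans[OF norm_sum]) (simp add: norm_power norm_mult)
      also have "\<dots> \<le> (\<Sum>k. norm (z * of_real (y x)) ^ k /\<^sub>R fact k)"
        by (intro sum_le_suminf summable_exp_generic) auto
      also have "\<dots> = exp \<bar>norm z * y x\<bar>" by (simp add: exp_def norm_mult abs_mult)
      also note exp_abs_le
      finally show ?thesis by simp
    qed
    then show "AE x in M. norm (\<Sum>k<n. (z * of_real (y x)) ^ k /\<^sub>R fact k) \<le> exp (norm z * y x) + exp (- norm z * y x)"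
      by simp
  qed simp_all
  then show ?thesis unfolding sums_def eq .
qed

lemma powser_eq_0:
  fixes d :: "nat \<Rightarrow> real"
  assumes "\<And>s. s \<noteq> 0 \<Longrightarrow> (\<lambda>k. d k * s ^ k) sums 0"
  shows "d k = 0"
  using assms
proof (induction k arbitrary: d)
  case 0
  have "((\<lambda>_. 0) \<longlongrightarrow> d 0) (at (0::real))"
    by (rule powser_limit_0_strong[of 1]) (use 0 in auto)
  from LIM_const_eq[OF this] show ?case by simp
next
  case (Suc k)
  have "((\<lambda>_. 0) \<longlongrightarrow> d 0) (at (0::real))"
    by (rule powser_limit_0_strong[of 1]) (use Suc.prems in auto)
  from LIM_const_eq[OF this] have "d 0 = 0" by simp
  have "(\<lambda>k. d (Suc k) * s ^ k) sums 0" if "s \<noteq> 0" for s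
  proof -
    have "(\<lambda>k. d (Suc k) * s ^ Suc k) sums 0"
      using Suc.prems[OF that] \<open>d 0 = 0\<close> by (subst sums_Suc_iff) simp
    from sums_mult[OF this, of "inverse s"] show ?thesis
      using that by (simp add: field_simps)
  qed
  then show ?case by (rule Suc.IH)
qed

text \<open>Both transforms are power series in the same moments. Equality at real arguments forces
  equal moments, and the series at \<i> then agree.\<close>

lemma mgf_eq_imp_char_eq:
  fixes y :: "'a \<Rightarrow> real"
  assumes "\<And>s. integrable M (\<lambda>x. exp (s * y x))" "\<And>s. integrable N (\<lambda>x. exp (s * y x))"
    and "y \<in> borel_measurable M" "y \<in> borel_measurable N"
    and eq: "\<And>s. (\<integral>x. exp (s * y x) \<partial>M) = (\<integral>x. exp (s * y x) \<partial>N)"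
  shows "(\<integral>x. exp (\<i> * of_real (y x)) \<partial>M) = (\<integral>x. exp (\<i> * of_real (y x)) \<partial>N)"
proof -
  define m where "m L k = (\<integral>x. y x ^ k \<partial>L) / fact k" for L k
  have ser: "(\<lambda>k. m L k * s ^ k) sums (\<integral>x. exp (s * y x) \<partial>L)"
    if "L = M \<or> L = N" for L s
  proof -
    have "(\<lambda>k. complex_of_real (m L k) * of_real s ^ k) sums (\<integral>x. exp (of_real s * of_real (y x)) \<partial>L)"
      using that exp_moment_series[of L y "of_real s"] assms unfolding m_def by blast
    also have "(\<integral>x. exp (of_real s * of_real (y x)) \<partial>L) = complex_of_real (\<integral>x. exp (s * y x) \<partial>L)"
    proof -
      have "exp (of_real s * of_real (y x)) = complex_of_real (exp (s * y x))" for x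
        by (simp only: of_real_mult[symmetric] exp_of_real)
      then show ?thesis by (simp only: integral_complex_of_real)
    qed
    also have "(\<lambda>k. complex_of_real (m L k) * of_real s ^ k) = (\<lambda>k. of_real (m L k * s ^ k))" by simp
    finally show ?thesis by (subst (asm) sums_of_real_iff)
  qed
  have "(\<lambda>k. (m M k - m N k) * s ^ k) sums 0" for s
    using sums_diff[OF ser[of M s] ser[of N s]] eq[of s] by (simp add: left_diff_distrib)
  then have "m M k - m N k = 0" for k
    by (intro powser_eq_0)
  then have "m M k = m N k" for k by simp
  then have mm: "m M = m N" by (rule ext)
  have *: "(\<lambda>k. of_real (m L k) * \<i> ^ k) sums (\<integral>x. exp (\<i> * of_real (y x)) \<partial>L)"
    if "L = M \<or> L = N" for L
    using that exp_moment_series[of L y \<i>] assms unfolding m_def by blast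
  show ?thesis
    using sums_unique2[OF *[of M]] *[of N] by (simp add: mm)
qed

section \<open>Characteristic functions determine finite measures\<close>

inductive_set trig_sums :: "('a::euclidean_space \<Rightarrow> complex) set" where
  zero: "(\<lambda>x. 0) \<in> trig_sums"
| add_term: "f \<in> trig_sums \<Longrightarrow> (\<lambda>x. f x + a * exp (\<i> * of_real (\<xi> \<bullet> x))) \<in> trig_sums"

lemma trig_sums_add: "g \<in> trig_sums \<Longrightarrow> f \<in> trig_sums \<Longrightarrow> (\<lambda>x. f x + g x) \<in> trig_sums"
proof (induction rule: trig_sums.induct)
  case (add_term g a \<xi>)
  then show ?case using trig_sums.add_term[of "\<lambda>x. f x + g x" a \<xi>] by (simp add: add.assoc)
qed simp

lemma trig_sums_term: "(\<lambda>x. a * exp (\<i> * of_real (\<xi> \<bullet> x))) \<in> trig_sums"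
  using trig_sums.add_term[OF trig_sums.zero] by simp

lemma trig_sums_mult_term: "f \<in> trig_sums \<Longrightarrow> (\<lambda>x. f x * (a * exp (\<i> * of_real (\<xi> \<bullet> x)))) \<in> trig_sums"
proof (induction rule: trig_sums.induct)
  case (add_term f b \<eta>)
  have "(\<lambda>x. f x * (a * exp (\<i> * of_real (\<xi> \<bullet> x))) + (b * a) * exp (\<i> * of_real ((\<eta> + \<xi>) \<bullet> x))) \<in> trig_sums"
    by (rule trig_sums.add_term[OF add_term.IH])
  then show ?case by (simp add: inner_add_left algebra_simps exp_add)
qed (simp add: trig_sums.zero)

lemma trig_sums_mult: "g \<in> trig_sums \<Longrightarrow> f \<in> trig_sums \<Longrightarrow> (\<lambda>x. f x * g x) \<in> trig_sums"
proof (induction rule: trig_sums.induct)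
  case (add_term g a \<xi>)
  show ?case
    using trig_sums_add[OF trig_sums_mult_term[OF add_term.prems] add_term.IH[OF add_term.prems]]
    by (simp add: algebra_simps)
qed (simp add: trig_sums.zero)

lemma trig_sums_sum: "(\<And>i. i \<in> I \<Longrightarrow> f i \<in> trig_sums) \<Longrightarrow> (\<lambda>x. \<Sum>i\<in>I. f i x) \<in> trig_sums"
  by (induction I rule: infinite_finite_induct) (auto intro: trig_sums.zero trig_sums_add)

lemma trig_sums_integral:
  fixes M N :: "'a::euclidean_space measure"
  assumes "finite_measure M" "finite_measure N" "sets M = sets borel" "sets N = sets borel"
    and char: "\<And>\<xi>. (\<integral>x. exp (\<i> * of_real (\<xi> \<bullet> x)) \<partial>M) = (\<integral>x. exp (\<i> * of_real (\<xi> \<bullet> x)) \<partial>N)"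
    and "f \<in> trig_sums"
  shows "integrable M f \<and> integrable N f \<and> (\<integral>x. f x \<partial>M) = (\<integral>x. f x \<partial>N)"
  using assms(6)
proof induction
  case (add_term f a \<xi>)
  have I: "integrable L (\<lambda>x. exp (\<i> * of_real (\<xi> \<bullet> x)))"
    if "L = M \<or> L = N" for L :: "'a measure"
  proof -
    interpret finite_measure L using that assms by auto
    have [measurable_cong]: "sets L = sets borel" using that assms by auto
    show ?thesis by (intro integrable_const_bound[of _ 1]) auto
  qed
  then show ?case using add_term char by simp
qed simp

text \<open>A bounded approximation of the identity whose composition with any polynomial is a trigonometric sum.\<close>

definition sin_map :: "real \<Rightarrow> 'a::euclidean_space \<Rightarrow> 'a" where
  "sin_map K x = (\<Sum>b\<in>Basis. (K * sin ((x \<bullet> b) / K)) *\<^sub>R b)"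

lemma poly_sin_map_trig:
  assumes "real_polynomial_function p"
  shows "(\<lambda>x. complex_of_real (p (sin_map K x))) \<in> trig_sums"
  using assms
proof induction
  case (linear p)
  then interpret bounded_linear p .
  have "complex_of_real (p (sin_map K x)) = (\<Sum>b\<in>Basis. (K * p b / (2 * \<i>)) * exp (\<i> * of_real ((b /\<^sub>R K) \<bullet> x))
     + (- (K * p b / (2 * \<i>))) * exp (\<i> * of_real ((- b /\<^sub>R K) \<bullet> x)))" for x
  proof -
    have "complex_of_real (sin t) = (exp (\<i> * of_real t) - exp (\<i> * of_real (- t))) / (2 * \<i>)" for t
      by (simp flip: sin_of_real add: sin_exp_eq)
    note sin = this
    have "complex_of_real (K * sin ((x \<bullet> b) / K) * p b) = (K * p b / (2 * \<i>)) * exp (\<i> * of_real ((b /\<^sub>R K) \<bullet> x))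
     + (- (K * p b / (2 * \<i>))) * exp (\<i> * of_real ((- b /\<^sub>R K) \<bullet> x))" for b
    proof -
      have 1: "(b /\<^sub>R K) \<bullet> x = (x \<bullet> b) / K" "(- b /\<^sub>R K) \<bullet> x = - ((x \<bullet> b) / K)"
        by (simp_all add: inner_commute divide_inverse mult.commute)
      have 2: "A * ((e1 - e2) / (2 * \<i>)) = (A / (2 * \<i>)) * e1 + (- (A / (2 * \<i>))) * e2" for A e1 e2 :: complex
        by (simp add: diff_divide_distrib right_diff_distrib mult_ac)
      have "complex_of_real (K * sin ((x \<bullet> b) / K) * p b) = of_real (K * p b) * complex_of_real (sin ((x \<bullet> b) / K))"
        by simp
      then show ?thesis by (simp only: sin 1 2)
    qed
    moreover have "p (sin_map K x) = (\<Sum>b\<in>Basis. K * sin ((x \<bullet> b) / K) * p b)"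
      by (simp add: sin_map_def sum scaleR)
    ultimately show ?thesis by (simp del: of_real_mult)
  qed
  then show ?case
    by (simp only:) (intro trig_sums_sum trig_sums_add trig_sums_term)
next
  case (const c)
  then show ?case using trig_sums_term[of c 0] by simp
next
  case (add f g)
  then show ?case using trig_sums_add by (simp add: trig_sums_add)
next
  case (mult f g)
  then show ?case by (simp add: trig_sums_mult)
qed

lemma norm_sin_map_le:
  assumes "K > 0"
  shows "norm (sin_map K x :: 'a::euclidean_space) \<le> K * DIM('a)"
proof -
  have "norm (sin_map K x :: 'a) \<le> (\<Sum>b\<in>(Basis :: 'a set). norm ((K * sin ((x \<bullet> b) / K)) *\<^sub>R b))"
    unfolding sin_map_def by (rule norm_sum)
  also have "\<dots> \<le> (\<Sum>b\<in>(Basis :: 'a set). K)"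
    using assms by (intro sum_mono) (simp add: abs_mult mult_left_le)
  finally show ?thesis by (simp add: mult.commute)
qed

lemma sin_map_tendsto: "(\<lambda>n. sin_map (real (Suc n)) x) \<longlonglongrightarrow> x"
proof -
  have "(\<lambda>n. real (Suc n) * sin (y / real (Suc n))) \<longlonglongrightarrow> y" for y :: real
    by real_asymp
  then have "(\<lambda>n. sin_map (real (Suc n)) x) \<longlonglongrightarrow> (\<Sum>b\<in>Basis. (x \<bullet> b) *\<^sub>R b)"
    unfolding sin_map_def by (intro tendsto_sum tendsto_scaleR tendsto_const)
  then show ?thesis by (simp add: euclidean_representation)
qed

text \<open>The range of \<open>sin_map\<close> is bounded, so Stone-Weierstrass provides a
  polynomial close to \<open>\<phi>\<close> on it. Composed with \<open>sin_map\<close>, the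
  polynomial is a trigonometric sum, whose integrals agree, and it stays bounded by
  \<open>C + 1\<close>. Dominated convergence passes to \<open>\<phi>\<close>.\<close>

lemma char_eq_imp_integral_eq:
  fixes M N :: "'a::euclidean_space measure" and \<phi> :: "'a \<Rightarrow> real"
  assumes fin: "finite_measure M" "finite_measure N" and sets: "sets M = sets borel" "sets N = sets borel"
    and char: "\<And>\<xi>. (\<integral>x. exp (\<i> * of_real (\<xi> \<bullet> x)) \<partial>M) = (\<integral>x. exp (\<i> * of_real (\<xi> \<bullet> x)) \<partial>N)"
    and \<phi>: "continuous_on UNIV \<phi>" "\<And>x. \<bar>\<phi> x\<bar> \<le> C"
  shows "(\<integral>x. \<phi> x \<partial>M) = (\<integral>x. \<phi> x \<partial>N)"
proof -
  have "\<exists>p. real_polynomial_function p \<and> (\<forall>x\<in>cball 0 (real (Suc n) * DIM('a)). \<bar>\<phi> x - p x\<bar> < inverse (real (Suc n)))" for n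
  proof -
    have "continuous_on (cball 0 (real (Suc n) * DIM('a))) \<phi>"
      using \<phi>(1) by (rule continuous_on_subset) simp
    then obtain p where "real_polynomial_function p"
      "\<And>x. x \<in> cball 0 (real (Suc n) * DIM('a)) \<Longrightarrow> \<bar>\<phi> x - p x\<bar> < inverse (real (Suc n))"
      by (rule Stone_Weierstrass_real_polynomial_function[OF compact_cball, of _ _ _ "inverse (real (Suc n))"]) auto
    then show ?thesis by blast
  qed
  then obtain p where p: "\<And>n. real_polynomial_function (p n)"
    "\<And>n x. x \<in> cball 0 (real (Suc n) * DIM('a)) \<Longrightarrow> \<bar>\<phi> x - p n x\<bar> < inverse (real (Suc n))" by metis
  define g where "g n x = p n (sin_map (real (Suc n)) x)" for n and x :: 'a
  have g: "\<bar>\<phi> (sin_map (real (Suc n)) x) - g n x\<bar> < inverse (real (Suc n))" for n x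
    unfolding g_def using norm_sin_map_le[of "real (Suc n)" x] by (intro p) simp
  have lim: "(\<lambda>n. g n x) \<longlonglongrightarrow> \<phi> x" for x
  proof -
    have 1: "(\<lambda>n. \<phi> (sin_map (real (Suc n)) x)) \<longlonglongrightarrow> \<phi> x"
      using continuous_on_tendsto_compose[OF \<phi>(1) sin_map_tendsto] by simp
    have "(\<lambda>n. \<phi> (sin_map (real (Suc n)) x) - g n x) \<longlonglongrightarrow> 0"
      by (rule Lim_null_comparison[OF _ LIMSEQ_inverse_real_of_nat]) (use g in \<open>auto intro!: always_eventually less_imp_le\<close>)
    from tendsto_diff[OF 1 this] show ?thesis by simp
  qed
  have bd: "\<bar>g n x\<bar> \<le> C + 1" for n x
  proof -
    have "inverse (real (Suc n)) \<le> 1" by (simp add: field_simps)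
    then show ?thesis using g[of n x] \<phi>(2)[of "sin_map (real (Suc n)) x"] by linarith
  qed
  have tr: "(\<lambda>x. complex_of_real (g n x)) \<in> trig_sums" for n
    unfolding g_def by (intro poly_sin_map_trig p)
  have eq: "(\<integral>x. g n x \<partial>M) = (\<integral>x. g n x \<partial>N)" for n
    using trig_sums_integral[OF fin sets char tr[of n]] by (simp add: integral_complex_of_real)
  have meas: "g n \<in> borel_measurable L" if "L = M \<or> L = N" for n L
  proof -
    have "integrable L (\<lambda>x. complex_of_real (g n x))"
      using trig_sums_integral[OF fin sets char tr[of n]] that by auto
    from measurable_compose[OF borel_measurable_integrable[OF this] borel_measurable_Re]
    show ?thesis by simp
  qed
  have "(\<lambda>n. \<integral>x. g n x \<partial>L) \<longlonglongrightarrow> (\<integral>x. \<phi> x \<partial>L)" if L: "L = M \<or> L = N" for L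
  proof (rule integral_dominated_convergence[where w = "\<lambda>_. C + 1"])
    interpret finite_measure L using L fin by auto
    show "integrable L (\<lambda>_. C + 1)" by simp
    have "\<phi> \<in> borel_measurable borel" by (rule borel_measurable_continuous_onI[OF \<phi>(1)])
    then show "\<phi> \<in> borel_measurable L" using L sets by (auto cong: measurable_cong_sets)
  qed (use meas L bd lim in auto)
  from LIMSEQ_unique[OF this[of M]] this[of N] show ?thesis by (simp add: eq)
qed

text \<open>Closed sets generate the Borel sets and are stable under intersection, and the indicator
  of a nonempty closed set is a limit of continuous functions of the distance to it.\<close>

lemma char_eq_imp_measure_eq:
  fixes M N :: "'a::euclidean_space measure"
  assumes fin: "finite_measure M" "finite_measure N" and sets: "sets M = sets borel" "sets N = sets borel"
    and char: "\<And>\<xi>. (\<integral>x. exp (\<i> * of_real (\<xi> \<bullet> x)) \<partial>M) = (\<integral>x. exp (\<i> * of_real (\<xi> \<bullet> x)) \<partial>N)"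
  shows "M = N"
proof (rule measure_eqI_generator_eq[where E = "Collect closed" and \<Omega> = UNIV and A = "\<lambda>_. UNIV"])
  show "sets M = sigma_sets UNIV (Collect closed)" "sets N = sigma_sets UNIV (Collect closed)"
    unfolding sets by (simp_all add: borel_eq_closed)
  show "emeasure M UNIV \<noteq> \<infinity>" using finite_measure.emeasure_finite[OF fin(1)] by simp
  fix A :: "'a set" assume "A \<in> Collect closed"
  then have A: "closed A" by simp
  show "emeasure M A = emeasure N A"
  \<comment> \<open>The distance to the empty set is 0 by convention, so the functions used below
    would tend to 1 instead of 0 there.\<close>
  proof (cases "A = {}")
    case False
    define f where "f n x = max 0 (1 - real n * infdist x A)" for n x
    have "(\<integral>x. f n x \<partial>M) = (\<integral>x. f n x \<partial>N)" for n
    proof (rule char_eq_imp_integral_eq[OF fin sets char, where C = 1])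
      show "continuous_on UNIV (f n)" unfolding f_def by (intro continuous_intros)
      show "\<bar>f n x\<bar> \<le> 1" for x using infdist_nonneg[of x A] by (auto simp: f_def)
    qed
    note eq = this
    have "(\<lambda>n. \<integral>x. f n x \<partial>L) \<longlonglongrightarrow> (\<integral>x. indicator A x \<partial>L)" if L: "L = M \<or> L = N" for L
    proof (rule integral_dominated_convergence[where w = "\<lambda>_. 1"])
      interpret finite_measure L using L fin by auto
      have [measurable_cong]: "sets L = sets borel" using L sets by auto
      show "integrable L (\<lambda>_. 1 :: real)" by simp
      have "f n \<in> borel_measurable borel" for n
        unfolding f_def by (intro borel_measurable_continuous_onI continuous_intros)
      then show "f n \<in> borel_measurable L" for n by (simp cong: measurable_cong_sets)
      have "A \<in> sets L" using A by simp
      then show "(indicator A :: 'a \<Rightarrow> real) \<in> borel_measurable L" by simp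
      show "AE x in L. (\<lambda>n. f n x) \<longlonglongrightarrow> indicator A x"
      proof (rule AE_I2)
        fix x
        show "(\<lambda>n. f n x) \<longlonglongrightarrow> indicator A x"
        proof (cases "x \<in> A")
          case True
          then show ?thesis by (simp add: f_def)
        next
          case nA: False
          then have "infdist x A > 0"
            using A False in_closed_iff_infdist_zero[of A x] infdist_nonneg[of x A] by (auto simp: less_le)
          then obtain n0 where "1 < real n0 * infdist x A" using reals_Archimedean3 by blast
          then have "f n x = 0" if "n \<ge> n0" for n
          proof -
            have "real n0 * infdist x A \<le> real n * infdist x A"
              using that \<open>infdist x A > 0\<close> by (intro mult_right_mono) auto
            then show ?thesis using \<open>1 < real n0 * infdist x A\<close> by (simp add: f_def max_def)
          qed
          then have "eventually (\<lambda>n. f n x = 0) sequentially"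
            by (rule eventually_sequentiallyI)
          then show ?thesis using nA by (simp add: tendsto_eventually)
        qed
      qed
      show "AE x in L. norm (f n x) \<le> 1" for n using infdist_nonneg[of _ A] by (auto simp: f_def)
    qed
    note lim = this
    have "(\<integral>x. indicator A x \<partial>M) = (\<integral>x. indicator A x \<partial>N :: real)"
      using LIMSEQ_unique[OF lim[of M]] lim[of N] by (simp add: eq)
    moreover have "A \<in> sets M" "A \<in> sets N" using A sets by auto
    ultimately have "measure M A = measure N A" by simp
    then show ?thesis
      using fin by (simp add: finite_measure.emeasure_eq_measure)
  qed simp
qed (auto simp: Int_stable_def)

theorem laplace_eq_imp_measure_eq:
  fixes M N :: "'a::euclidean_space measure"
  assumes fin: "finite_measure M" "finite_measure N" and sets: "sets M = sets borel" "sets N = sets borel"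
    and int: "\<And>\<xi>. integrable M (\<lambda>x. exp (\<xi> \<bullet> x))" "\<And>\<xi>. integrable N (\<lambda>x. exp (\<xi> \<bullet> x))"
    and eq: "\<And>\<xi>. (\<integral>x. exp (\<xi> \<bullet> x) \<partial>M) = (\<integral>x. exp (\<xi> \<bullet> x) \<partial>N)"
  shows "M = N"
proof (rule char_eq_imp_measure_eq[OF fin sets])
  fix \<xi> :: 'a
  note sets[measurable_cong]
  show "(\<integral>x. exp (\<i> * of_real (\<xi> \<bullet> x)) \<partial>M) = (\<integral>x. exp (\<i> * of_real (\<xi> \<bullet> x)) \<partial>N)"
    by (rule mgf_eq_imp_char_eq) (use int[of "_ *\<^sub>R \<xi>"] eq[of "_ *\<^sub>R \<xi>"] in simp_all)
qed

section \<open>The invariant measure\<close>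

text \<open>With 1/4 in the exponent, a positive definite \<open>Q\<close> gives the centred
  Gaussian law of covariance 2 Q, whose moment generating function is exp of the form of
  \<open>Q\<close> without a factor 1/2.\<close>

definition gauss :: "real ^ 3 ^ 3 \<Rightarrow> (real ^ 3) measure" where
  "gauss Q = density lborel
     (\<lambda>y. ennreal (exp (- ((matrix_inv Q *v y) \<bullet> y) / 4) / ((4 * pi) powr (3 / 2) * sqrt (det Q))))"

lemma matrix_vector_measurable [measurable]: "(\<lambda>y. (A :: real ^ 3 ^ 3) *v y) \<in> borel \<rightarrow>\<^sub>M borel"
  by (intro borel_measurable_continuous_onI linear_continuous_on linear_conv_bounded_linear[THEN iffD1] matrix_vector_mul_linear)

lemma sets_gauss [simp, measurable_cong]: "sets (gauss Q) = sets borel"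
  by (simp add: gauss_def)

lemma space_gauss [simp]: "space (gauss Q) = UNIV"
  by (simp add: gauss_def)

lemma nn_integral_lborel_translate:
  fixes a :: "'a::euclidean_space"
  assumes [measurable]: "f \<in> borel_measurable borel"
  shows "(\<integral>\<^sup>+x. f (x + a) \<partial>lborel) = (\<integral>\<^sup>+x. f x \<partial>lborel)"
proof -
  have "(\<integral>\<^sup>+x. f x \<partial>lborel) = (\<integral>\<^sup>+x. f x \<partial>distr lborel borel ((+) a))"
    by (simp add: lborel_distr_plus)
  also have "\<dots> = (\<integral>\<^sup>+x. f (a + x) \<partial>lborel)" by (rule nn_integral_distr) simp_all
  finally show ?thesis by (simp add: add.commute)
qed

text \<open>Completing the square moves the centre of the Gaussian to 2 Q \<xi>; the rest is
  translation invariance of Lebesgue measure.\<close>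

lemma gauss_nn_mgf:
  assumes sym: "\<And>\<xi> \<eta>. (Q *v \<xi>) \<bullet> \<eta> = (Q *v \<eta>) \<bullet> \<xi>"
    and pos: "\<And>\<xi>. \<xi> \<noteq> 0 \<Longrightarrow> (Q *v \<xi>) \<bullet> \<xi> > 0"
  shows "(\<integral>\<^sup>+y. ennreal (exp (\<xi> \<bullet> y)) \<partial>gauss Q) = ennreal (exp ((Q *v \<xi>) \<bullet> \<xi>))"
proof -
  let ?R = "matrix_inv Q" and ?Z = "(4 * pi) powr (3 / 2) * sqrt (det Q)"
  have inv: "invertible Q" and det: "det Q > 0"
    using gaussian_nn_integral_matrix[OF assms] by auto
  have RQ: "?R *v (Q *v x) = x" and QR: "Q *v (?R *v x) = x" for x
    using matrix_inv_mult[OF inv] by (simp_all add: matrix_vector_mul_assoc)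
  have Rsym: "(?R *v x) \<bullet> y = (?R *v y) \<bullet> x" for x y
    using sym[of "?R *v x" "?R *v y"] by (simp add: QR inner_commute)
  have Z: "?Z > 0" using det by simp
  have sq: "\<xi> \<bullet> y - ((?R *v y) \<bullet> y) / 4 =
     (Q *v \<xi>) \<bullet> \<xi> - ((?R *v (y + - (2 *\<^sub>R (Q *v \<xi>)))) \<bullet> (y + - (2 *\<^sub>R (Q *v \<xi>)))) / 4" for y
  proof -
    have 1: "?R *v (y + - (2 *\<^sub>R (Q *v \<xi>))) = ?R *v y - 2 *\<^sub>R \<xi>"
      by (simp add: matrix_vector_mult_diff_distrib matrix_vector_mult_scaleR RQ)
    have 2: "(?R *v y) \<bullet> (Q *v \<xi>) = y \<bullet> \<xi>"
      using Rsym[of y "Q *v \<xi>"] by (simp add: RQ inner_commute)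
    show ?thesis
      unfolding 1 using 2 by (simp add: inner_diff_left inner_diff_right inner_commute field_simps)
  qed
  have "(\<integral>\<^sup>+y. ennreal (exp (\<xi> \<bullet> y)) \<partial>gauss Q) =
     (\<integral>\<^sup>+y. ennreal (exp (- ((?R *v y) \<bullet> y) / 4) / ?Z) * ennreal (exp (\<xi> \<bullet> y)) \<partial>lborel)"
    unfolding gauss_def by (subst nn_integral_density) simp_all
  also have "\<dots> = (\<integral>\<^sup>+y. ennreal (exp ((Q *v \<xi>) \<bullet> \<xi>) / ?Z) *
       ennreal (exp (- ((?R *v (y + - (2 *\<^sub>R (Q *v \<xi>)))) \<bullet> (y + - (2 *\<^sub>R (Q *v \<xi>)))) / 4)) \<partial>lborel)"
  proof (rule nn_integral_cong)
    fix y
    let ?y = "y + - (2 *\<^sub>R (Q *v \<xi>))"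
    have "exp (- ((?R *v y) \<bullet> y) / 4) * exp (\<xi> \<bullet> y) = exp ((Q *v \<xi>) \<bullet> \<xi>) * exp (- ((?R *v ?y) \<bullet> ?y) / 4)"
      using sq[of y] by (simp only: exp_add[symmetric]) simp
    then have "exp (- ((?R *v y) \<bullet> y) / 4) / ?Z * exp (\<xi> \<bullet> y) = exp ((Q *v \<xi>) \<bullet> \<xi>) / ?Z * exp (- ((?R *v ?y) \<bullet> ?y) / 4)"
      by (simp only: times_divide_eq_left)
    then show "ennreal (exp (- ((?R *v y) \<bullet> y) / 4) / ?Z) * ennreal (exp (\<xi> \<bullet> y)) =
        ennreal (exp ((Q *v \<xi>) \<bullet> \<xi>) / ?Z) * ennreal (exp (- ((?R *v ?y) \<bullet> ?y) / 4))"
      by (simp only: ennreal_mult''[symmetric] exp_ge_zero)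
  qed
  also have "\<dots> = ennreal (exp ((Q *v \<xi>) \<bullet> \<xi>) / ?Z) *
       (\<integral>\<^sup>+y. ennreal (exp (- ((?R *v (y + - (2 *\<^sub>R (Q *v \<xi>)))) \<bullet> (y + - (2 *\<^sub>R (Q *v \<xi>)))) / 4)) \<partial>lborel)"
    by (rule nn_integral_cmult) simp
  also have "(\<integral>\<^sup>+y. ennreal (exp (- ((?R *v (y + - (2 *\<^sub>R (Q *v \<xi>)))) \<bullet> (y + - (2 *\<^sub>R (Q *v \<xi>)))) / 4)) \<partial>lborel)
     = (\<integral>\<^sup>+y. ennreal (exp (- ((?R *v y) \<bullet> y) / 4)) \<partial>lborel)"
    by (rule nn_integral_lborel_translate) simp
  also have "\<dots> = ennreal ?Z" by (rule gaussian_nn_integral_matrix[OF assms])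
  also have "ennreal (exp ((Q *v \<xi>) \<bullet> \<xi>) / ?Z) * ennreal ?Z = ennreal (exp ((Q *v \<xi>) \<bullet> \<xi>))"
    using Z det by (subst ennreal_mult''[symmetric]) simp_all
  finally show ?thesis .
qed

lemma gauss_prob_space:
  assumes "\<And>\<xi> \<eta>. (Q *v \<xi>) \<bullet> \<eta> = (Q *v \<eta>) \<bullet> \<xi>"
    and "\<And>\<xi>. \<xi> \<noteq> 0 \<Longrightarrow> (Q *v \<xi>) \<bullet> \<xi> > 0"
  shows "prob_space (gauss Q)"
proof
  have "(\<integral>\<^sup>+y. ennreal (exp (0 \<bullet> y)) \<partial>gauss Q) = 1"
    using gauss_nn_mgf[OF assms, of 0] by simp
  then show "emeasure (gauss Q) (space (gauss Q)) = 1" by simp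
qed

section \<open>Invariance as an identity of laws, and the moment generating function of
  \<mu>\<close>

locale OU_process =
  fixes c \<sigma> :: real and \<mu> :: "(real ^ 3) measure"
  assumes c_pos: "c > 0" and sigma_pos: "\<sigma> > 0" and invariant: "OU_invariant c \<sigma> \<mu>"
begin

lemma sets_mu [simp, measurable_cong]: "sets \<mu> = sets borel"
  using invariant by (simp add: OU_invariant_def)

lemma space_mu [simp]: "space \<mu> = UNIV"
  using sets_eq_imp_space_eq[OF sets_mu] by simp

sublocale mu: prob_space \<mu>
  by (rule prob_spaceI) (use invariant in \<open>simp add: OU_invariant_def\<close>)

definition kern :: "real \<Rightarrow> (real ^ 3) measure" where
  "kern t = gauss (OU_Q c \<sigma> t)"

lemma sets_kern [simp, measurable_cong]: "sets (kern t) = sets borel"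
  by (simp add: kern_def)

lemma space_kern [simp]: "space (kern t) = UNIV"
  by (simp add: kern_def)

lemma kern_prob_space: "t > 0 \<Longrightarrow> prob_space (kern t)"
  unfolding kern_def by (intro gauss_prob_space OU_Q_sym OU_Q_pos sigma_pos)

lemma kern_nn_mgf:
  "t > 0 \<Longrightarrow> (\<integral>\<^sup>+y. ennreal (exp (\<xi> \<bullet> y)) \<partial>kern t) = ennreal (exp ((OU_Q c \<sigma> t *v \<xi>) \<bullet> \<xi>))"
  unfolding kern_def by (intro gauss_nn_mgf OU_Q_sym OU_Q_pos sigma_pos)

lemma flow_measurable [measurable]: "flow c t \<in> borel \<rightarrow>\<^sub>M borel"
  unfolding flow_mat_mult[symmetric, abs_def] by simp

lemma semigroup_eq:
  assumes "t > 0" and [measurable]: "f \<in> borel_measurable borel"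
  shows "OU_semigroup c \<sigma> t f x = (\<integral>y. f (flow c t x - y) \<partial>kern t)"
proof -
  let ?Q = "OU_Q c \<sigma> t"
  have "det ?Q > 0"
    by (intro gaussian_nn_integral_matrix OU_Q_sym OU_Q_pos sigma_pos assms(1))
  then have "(\<integral>y. f (flow c t x - y) \<partial>kern t) =
     (\<integral>y. 1 / ((4 * pi) powr (3 / 2) * sqrt (det ?Q)) * (exp (- ((matrix_inv ?Q *v y) \<bullet> y) / 4) * f (flow c t x - y)) \<partial>lborel)"
    unfolding kern_def gauss_def by (subst integral_density) auto
  also have "\<dots> = OU_semigroup c \<sigma> t f x"
    using assms(1) unfolding integral_mult_right_zero by (simp add: OU_semigroup_def mat_exp_OU_B_mult)
  finally show ?thesis ..
qed

text \<open>In probabilistic terms: if X has law \<open>\<mu>\<close> and Y is independent of X with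
  law \<open>kern t\<close>, then \<open>flow c t X - Y\<close> has law \<open>\<mu>\<close>.
  Testing the hypothesis on indicators gives this identity of measures, after which unbounded
  functions may be integrated as well.\<close>

lemma mu_invariant:
  assumes t: "t > 0"
  shows "distr (\<mu> \<Otimes>\<^sub>M kern t) borel (\<lambda>(x, y). flow c t x - y) = \<mu>"
proof (rule measure_eqI)
  interpret K: prob_space "kern t" by (rule kern_prob_space[OF t])
  fix A assume "A \<in> sets (distr (\<mu> \<Otimes>\<^sub>M kern t) borel (\<lambda>(x, y). flow c t x - y))"
  then have A[measurable]: "A \<in> sets borel" by simp
  have "indicator A \<in> bounded_Borel"
    unfolding bounded_Borel_def by (auto intro!: boundedI[of _ 1] split: split_indicator)
  then have inv: "(\<integral>x. OU_semigroup c \<sigma> t (indicator A) x \<partial>\<mu>) = (\<integral>x. indicator A x \<partial>\<mu>)"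
    using invariant t by (simp add: OU_invariant_def)
  define h :: "real ^ 3 \<Rightarrow> real" where "h x = (\<integral>y. indicator A (flow c t x - y) \<partial>kern t)" for x
  have h_meas[measurable]: "h \<in> borel_measurable \<mu>"
  proof -
    have "(\<lambda>p. indicator A (flow c t (fst p) - snd p) :: real) \<in> borel_measurable (\<mu> \<Otimes>\<^sub>M kern t)"
      by measurable
    then show ?thesis
      unfolding h_def by (intro K.borel_measurable_lebesgue_integral) (simp add: split_def)
  qed
  have h: "(\<integral>\<^sup>+y. indicator A (flow c t x - y) \<partial>kern t) = ennreal (h x)" for x
  proof -
    have "integrable (kern t) (\<lambda>y. indicator A (flow c t x - y) :: real)"
      by (rule K.integrable_const_bound[of _ 1]) (auto split: split_indicator)
    then have "(\<integral>\<^sup>+y. ennreal (indicator A (flow c t x - y)) \<partial>kern t) = ennreal (h x)"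
      unfolding h_def by (intro nn_integral_eq_integral) auto
    then show ?thesis by (simp add: ennreal_indicator)
  qed
  have h01: "0 \<le> h x" "h x \<le> 1" for x
  proof -
    show "0 \<le> h x" unfolding h_def by (rule Bochner_Integration.integral_nonneg) simp
    have "ennreal (h x) \<le> (\<integral>\<^sup>+y. 1 \<partial>kern t)"
      unfolding h[symmetric] by (intro nn_integral_mono) (simp split: split_indicator)
    then show "h x \<le> 1" by (simp add: K.emeasure_space_1[unfolded space_kern])
  qed
  have "emeasure (distr (\<mu> \<Otimes>\<^sub>M kern t) borel (\<lambda>(x, y). flow c t x - y)) A =
     (\<integral>\<^sup>+z. indicator A z \<partial>distr (\<mu> \<Otimes>\<^sub>M kern t) borel (\<lambda>(x, y). flow c t x - y))"
    by simp
  also have "\<dots> = (\<integral>\<^sup>+p. indicator A (flow c t (fst p) - snd p) \<partial>(\<mu> \<Otimes>\<^sub>M kern t))"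
    by (subst nn_integral_distr) (auto simp: split_def)
  also have "\<dots> = (\<integral>\<^sup>+x. (\<integral>\<^sup>+y. indicator A (flow c t x - y) \<partial>kern t) \<partial>\<mu>)"
    by (subst K.nn_integral_fst[symmetric]) auto
  also have "\<dots> = (\<integral>\<^sup>+x. ennreal (h x) \<partial>\<mu>)" by (simp only: h)
  also have "\<dots> = ennreal (\<integral>x. h x \<partial>\<mu>)"
    by (intro nn_integral_eq_integral mu.integrable_const_bound[of _ 1]) (use h01 in auto)
  also have "(\<integral>x. h x \<partial>\<mu>) = (\<integral>x. OU_semigroup c \<sigma> t (indicator A) x \<partial>\<mu>)"
    by (simp add: semigroup_eq[OF t] h_def)
  also have "\<dots> = measure \<mu> A" using inv by simp
  finally show "emeasure (distr (\<mu> \<Otimes>\<^sub>M kern t) borel (\<lambda>(x, y). flow c t x - y)) A = emeasure \<mu> A"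
    by (simp add: mu.emeasure_eq_measure)
qed simp

lemma nn_integral_invariant:
  assumes t: "t > 0" and [measurable]: "F \<in> borel_measurable borel"
  shows "(\<integral>\<^sup>+x. (\<integral>\<^sup>+y. F (flow c t x - y) \<partial>kern t) \<partial>\<mu>) = (\<integral>\<^sup>+x. F x \<partial>\<mu>)"
proof -
  interpret K: prob_space "kern t" by (rule kern_prob_space[OF t])
  have "(\<integral>\<^sup>+x. F x \<partial>\<mu>) = (\<integral>\<^sup>+p. F (flow c t (fst p) - snd p) \<partial>(\<mu> \<Otimes>\<^sub>M kern t))"
    by (subst mu_invariant[OF t, symmetric], subst nn_integral_distr) (auto simp: split_def)
  also have "\<dots> = (\<integral>\<^sup>+x. (\<integral>\<^sup>+y. F (flow c t x - y) \<partial>kern t) \<partial>\<mu>)"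
    by (subst K.nn_integral_fst[symmetric]) auto
  finally show ?thesis ..
qed

lemma kern_nn_mgf_shift:
  assumes "t > 0"
  shows "(\<integral>\<^sup>+y. ennreal (exp (\<xi> \<bullet> (flow c t x - y))) \<partial>kern t) =
     ennreal (exp ((OU_Q c \<sigma> t *v \<xi>) \<bullet> \<xi> + coflow c t \<xi> \<bullet> x))"
proof -
  have "(\<integral>\<^sup>+y. ennreal (exp (\<xi> \<bullet> (flow c t x - y))) \<partial>kern t) =
     (\<integral>\<^sup>+y. ennreal (exp (coflow c t \<xi> \<bullet> x)) * ennreal (exp ((- \<xi>) \<bullet> y)) \<partial>kern t)"
    by (intro nn_integral_cong) (simp add: inner_diff_right inner_flow exp_diff exp_minus divide_inverse ennreal_mult)
  also have "\<dots> = ennreal (exp (coflow c t \<xi> \<bullet> x)) * ennreal (exp ((OU_Q c \<sigma> t *v (- \<xi>)) \<bullet> (- \<xi>)))"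
    unfolding kern_nn_mgf[OF assms, symmetric] by (rule nn_integral_cmult) simp
  also have "(OU_Q c \<sigma> t *v (- \<xi>)) \<bullet> (- \<xi>) = (OU_Q c \<sigma> t *v \<xi>) \<bullet> \<xi>"
    using matrix_vector_mult_scaleR[of "OU_Q c \<sigma> t" "-1" \<xi>] by simp
  finally show ?thesis by (simp add: exp_add ennreal_mult mult.commute)
qed

lemma coflow_tendsto_0: "(\<lambda>n. coflow c (real (Suc n)) \<xi>) \<longlonglongrightarrow> 0"
proof (rule Lim_null_comparison)
  show "eventually (\<lambda>n. norm (coflow c (real (Suc n)) \<xi>) \<le>
      3 * (exp (- (c * real (Suc n))) * (1 + real (Suc n) + (real (Suc n))\<^sup>2)) * norm \<xi>) sequentially"
    by (intro always_eventually allI norm_coflow_le c_pos) simp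
  have "(\<lambda>n. exp (- (c * real (Suc n))) * (1 + real (Suc n) + (real (Suc n))\<^sup>2)) \<longlonglongrightarrow> 0"
    using c_pos by real_asymp
  from tendsto_mult_left[OF tendsto_mult_right[OF this], of 3 "norm \<xi>"]
  show "(\<lambda>n. 3 * (exp (- (c * real (Suc n))) * (1 + real (Suc n) + (real (Suc n))\<^sup>2)) * norm \<xi>) \<longlonglongrightarrow> 0"
    by (simp add: mult_ac)
qed

lemma OU_Q_tendsto: "(\<lambda>n. (OU_Q c \<sigma> (real (Suc n)) *v \<xi>) \<bullet> \<xi>) \<longlonglongrightarrow> (OU_cov c \<sigma> *v \<xi>) \<bullet> \<xi>"
proof -
  have "(\<lambda>n. OU_cov c \<sigma> *v coflow c (real (Suc n)) \<xi>) \<longlonglongrightarrow> OU_cov c \<sigma> *v 0"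
    by (intro isCont_tendsto_compose[OF linear_continuous_at coflow_tendsto_0]
        linear_conv_bounded_linear[THEN iffD1] matrix_vector_mul_linear)
  then have "(\<lambda>n. (OU_cov c \<sigma> *v \<xi>) \<bullet> \<xi> - (OU_cov c \<sigma> *v coflow c (real (Suc n)) \<xi>) \<bullet> coflow c (real (Suc n)) \<xi>)
      \<longlonglongrightarrow> (OU_cov c \<sigma> *v \<xi>) \<bullet> \<xi> - (OU_cov c \<sigma> *v 0) \<bullet> 0"
    by (intro tendsto_diff tendsto_const tendsto_inner coflow_tendsto_0)
  then show ?thesis by (simp add: OU_Q_eq c_pos)
qed

text \<open>The truncated exponential is bounded, so its integral may be rewritten by invariance at
  a large time. Averaging over the kernel inside the minimum only increases it, and the averaged
  exponential tends to a constant because \<open>coflow\<close> tends to 0. The truncation is then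
  removed by monotone convergence.\<close>

lemma mu_nn_mgf_le: "(\<integral>\<^sup>+x. ennreal (exp (\<xi> \<bullet> x)) \<partial>\<mu>) \<le> ennreal (exp ((OU_cov c \<sigma> *v \<xi>) \<bullet> \<xi>))"
proof -
  let ?q = "(OU_cov c \<sigma> *v \<xi>) \<bullet> \<xi>"
  have trunc: "(\<integral>\<^sup>+x. ennreal (min (exp (\<xi> \<bullet> x)) K) \<partial>\<mu>) \<le> ennreal (exp ?q)" if K: "K > 0" for K
  proof -
    define g where "g n x = min (exp ((OU_Q c \<sigma> (real (Suc n)) *v \<xi>) \<bullet> \<xi> + coflow c (real (Suc n)) \<xi> \<bullet> x)) K" for n and x :: "real ^ 3"
    have le: "(\<integral>\<^sup>+x. ennreal (min (exp (\<xi> \<bullet> x)) K) \<partial>\<mu>) \<le> ennreal (\<integral>x. g n x \<partial>\<mu>)" for n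
    proof -
      let ?t = "real (Suc n)"
      interpret K: prob_space "kern ?t" by (rule kern_prob_space) simp
      have "(\<integral>\<^sup>+x. ennreal (min (exp (\<xi> \<bullet> x)) K) \<partial>\<mu>) =
          (\<integral>\<^sup>+x. (\<integral>\<^sup>+y. ennreal (min (exp (\<xi> \<bullet> (flow c ?t x - y))) K) \<partial>kern ?t) \<partial>\<mu>)"
        by (rule nn_integral_invariant[symmetric]) simp_all
      also have "\<dots> \<le> (\<integral>\<^sup>+x. ennreal (g n x) \<partial>\<mu>)"
      proof (rule nn_integral_mono)
        fix x
        have "(\<integral>\<^sup>+y. ennreal (min (exp (\<xi> \<bullet> (flow c ?t x - y))) K) \<partial>kern ?t) \<le> (\<integral>\<^sup>+y. ennreal K \<partial>kern ?t)"
          by (intro nn_integral_mono ennreal_leI) simp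
        also have "\<dots> = ennreal K" by (simp add: K.emeasure_space_1[simplified])
        finally have 1: "(\<integral>\<^sup>+y. ennreal (min (exp (\<xi> \<bullet> (flow c ?t x - y))) K) \<partial>kern ?t) \<le> ennreal K" .
        have "(\<integral>\<^sup>+y. ennreal (min (exp (\<xi> \<bullet> (flow c ?t x - y))) K) \<partial>kern ?t) \<le>
            (\<integral>\<^sup>+y. ennreal (exp (\<xi> \<bullet> (flow c ?t x - y))) \<partial>kern ?t)"
          by (intro nn_integral_mono ennreal_leI) simp
        also have "\<dots> = ennreal (exp ((OU_Q c \<sigma> ?t *v \<xi>) \<bullet> \<xi> + coflow c ?t \<xi> \<bullet> x))"
          by (rule kern_nn_mgf_shift) simp
        finally show "(\<integral>\<^sup>+y. ennreal (min (exp (\<xi> \<bullet> (flow c ?t x - y))) K) \<partial>kern ?t) \<le> ennreal (g n x)"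
          using 1 unfolding g_def by (auto simp: min_def)
      qed
      also have "\<dots> = ennreal (\<integral>x. g n x \<partial>\<mu>)"
        using K by (intro nn_integral_eq_integral mu.integrable_const_bound[of _ K]) (auto simp: g_def)
      finally show ?thesis .
    qed
    have "(\<lambda>n. \<integral>x. g n x \<partial>\<mu>) \<longlonglongrightarrow> (\<integral>x. min (exp (?q + 0 \<bullet> x)) K \<partial>\<mu>)"
    proof (rule integral_dominated_convergence[where w = "\<lambda>_. K"])
      show "AE x in \<mu>. (\<lambda>n. g n x) \<longlonglongrightarrow> min (exp (?q + 0 \<bullet> x)) K"
        unfolding g_def
        by (intro AE_I2 tendsto_min tendsto_exp tendsto_add tendsto_inner OU_Q_tendsto coflow_tendsto_0 tendsto_const)
      show "AE x in \<mu>. norm (g n x) \<le> K" for n using K by (auto simp: g_def)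
    qed (simp_all add: g_def)
    then have "(\<lambda>n. ennreal (\<integral>x. g n x \<partial>\<mu>)) \<longlonglongrightarrow> ennreal (min (exp ?q) K)"
      by (intro tendsto_ennrealI) (simp add: mu.prob_space[simplified])
    from LIMSEQ_le_const[OF this] le have "(\<integral>\<^sup>+x. ennreal (min (exp (\<xi> \<bullet> x)) K) \<partial>\<mu>) \<le> ennreal (min (exp ?q) K)"
      by blast
    also have "\<dots> \<le> ennreal (exp ?q)" by (intro ennreal_leI) simp
    finally show ?thesis .
  qed
  have "(\<integral>\<^sup>+x. ennreal (exp (\<xi> \<bullet> x)) \<partial>\<mu>) = (\<integral>\<^sup>+x. (SUP n. ennreal (min (exp (\<xi> \<bullet> x)) (real (Suc n)))) \<partial>\<mu>)"
  proof (rule nn_integral_cong)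
    fix x
    have "(\<lambda>n. ennreal (min (exp (\<xi> \<bullet> x)) (real (Suc n)))) \<longlonglongrightarrow> ennreal (exp (\<xi> \<bullet> x))"
    proof (rule tendsto_eventually)
      obtain n0 where "exp (\<xi> \<bullet> x) \<le> real n0" using real_arch_simple by blast
      then show "eventually (\<lambda>n. ennreal (min (exp (\<xi> \<bullet> x)) (real (Suc n))) = ennreal (exp (\<xi> \<bullet> x))) sequentially"
        by (intro eventually_sequentiallyI[of n0]) (simp add: min_def)
    qed
    moreover have "incseq (\<lambda>n. ennreal (min (exp (\<xi> \<bullet> x)) (real (Suc n))))"
      by (intro incseq_SucI ennreal_leI) auto
    ultimately show "ennreal (exp (\<xi> \<bullet> x)) = (SUP n. ennreal (min (exp (\<xi> \<bullet> x)) (real (Suc n))))"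
      using LIMSEQ_SUP LIMSEQ_unique by blast
  qed
  also have "\<dots> = (SUP n. \<integral>\<^sup>+x. ennreal (min (exp (\<xi> \<bullet> x)) (real (Suc n))) \<partial>\<mu>)"
    by (rule nn_integral_monotone_convergence_SUP) (auto intro!: incseq_SucI le_funI ennreal_leI)
  also have "\<dots> \<le> ennreal (exp ?q)"
    by (intro SUP_least trunc) simp
  finally show ?thesis .
qed

lemma integrable_exp_inner: "integrable \<mu> (\<lambda>x. exp (\<xi> \<bullet> x))"
  using mu_nn_mgf_le[of \<xi>]
  by (intro integrableI_bounded) (auto simp: less_top[symmetric] top_unique)

text \<open>The norm is at most three times the largest coordinate in absolute value; summing over
  all coordinates and both signs avoids naming that coordinate.\<close>

lemma exp_norm_le: "exp (a * norm x) \<le> (\<Sum>i\<in>UNIV. exp (3 * a * x $ i) + exp (- (3 * a) * x $ i))"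
  if "a \<ge> 0" for x :: "real ^ 3" and a
proof -
  obtain j where j: "\<And>i. \<bar>x $ i\<bar> \<le> \<bar>x $ j\<bar>"
  proof -
    have "Max (range (\<lambda>i. \<bar>x $ i\<bar>)) \<in> range (\<lambda>i. \<bar>x $ i\<bar>)" by (rule Max_in) auto
    then obtain j where "Max (range (\<lambda>i. \<bar>x $ i\<bar>)) = \<bar>x $ j\<bar>" by blast
    then show thesis using Max_ge[of "range (\<lambda>i. \<bar>x $ i\<bar>)"] by (intro that[of j]) auto
  qed
  have "norm x \<le> (\<Sum>i\<in>UNIV. \<bar>x $ i\<bar>)" by (rule norm_le_l1_cart)
  also have "\<dots> \<le> (\<Sum>i\<in>(UNIV :: 3 set). \<bar>x $ j\<bar>)" by (intro sum_mono j)
  finally have "norm x \<le> 3 * \<bar>x $ j\<bar>" by simp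
  then have "exp (a * norm x) \<le> exp \<bar>3 * a * x $ j\<bar>"
    using that mult_left_mono[of "norm x" "3 * \<bar>x $ j\<bar>" a] by (simp add: abs_mult mult_ac)
  also have "\<dots> \<le> exp (3 * a * x $ j) + exp (- (3 * a * x $ j))" by (rule exp_abs_le)
  also have "\<dots> \<le> (\<Sum>i\<in>UNIV. exp (3 * a * x $ i) + exp (- (3 * a) * x $ i))"
    using member_le_sum[of j UNIV "\<lambda>i. exp (3 * a * x $ i) + exp (- (3 * a) * x $ i)"] by (simp add: add_nonneg_nonneg)
  finally show ?thesis .
qed

lemma integrable_exp_norm: "integrable \<mu> (\<lambda>x. exp (a * norm x))"
proof -
  define b where "b = max a 0"
  have "integrable \<mu> (\<lambda>x. \<Sum>i\<in>(UNIV :: 3 set). exp (3 * b * x $ i) + exp (- (3 * b) * x $ i))"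
    using integrable_exp_inner[of "axis _ (3 * b)"] integrable_exp_inner[of "axis _ (- (3 * b))"]
    by (intro Bochner_Integration.integrable_sum Bochner_Integration.integrable_add) (simp_all add: inner_axis')
  then show ?thesis
  proof (rule Bochner_Integration.integrable_bound)
    have "norm (exp (a * norm x)) \<le> norm (\<Sum>i\<in>UNIV. exp (3 * b * x $ i) + exp (- (3 * b) * x $ i))" for x :: "real ^ 3"
    proof -
      have "exp (a * norm x) \<le> exp (b * norm x)" by (simp add: b_def mult_right_mono)
      also note exp_norm_le
      finally show ?thesis by (simp add: b_def)
    qed
    then show "AE x in \<mu>. norm (exp (a * norm x)) \<le> norm (\<Sum>i\<in>UNIV. exp (3 * b * x $ i) + exp (- (3 * b) * x $ i))"
      by simp
  qed simp
qed

text \<open>Invariance yields m \<xi> = exp (Q_t \<xi> \<bullet> \<xi>) m (coflow \<xi>) for the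
  moment generating function m. As \<open>t\<close> grows, \<open>coflow\<close> tends to 0 and the
  last factor to m 0 = 1.\<close>

lemma mu_mgf: "(\<integral>x. exp (\<xi> \<bullet> x) \<partial>\<mu>) = exp ((OU_cov c \<sigma> *v \<xi>) \<bullet> \<xi>)"
proof -
  define m where "m \<eta> = (\<integral>x. exp (\<eta> \<bullet> x) \<partial>\<mu>)" for \<eta>
  have nn: "(\<integral>\<^sup>+x. ennreal (exp (\<eta> \<bullet> x)) \<partial>\<mu>) = ennreal (m \<eta>)" for \<eta>
    unfolding m_def by (intro nn_integral_eq_integral integrable_exp_inner) simp
  have step: "m \<xi> = exp ((OU_Q c \<sigma> t *v \<xi>) \<bullet> \<xi>) * m (coflow c t \<xi>)" if t: "t > 0" for t
  proof -
    have "ennreal (m \<xi>) = (\<integral>\<^sup>+x. (\<integral>\<^sup>+y. ennreal (exp (\<xi> \<bullet> (flow c t x - y))) \<partial>kern t) \<partial>\<mu>)"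
      unfolding nn[symmetric] by (rule nn_integral_invariant[OF t, symmetric]) simp
    also have "\<dots> = (\<integral>\<^sup>+x. ennreal (exp ((OU_Q c \<sigma> t *v \<xi>) \<bullet> \<xi>)) * ennreal (exp (coflow c t \<xi> \<bullet> x)) \<partial>\<mu>)"
      by (simp add: kern_nn_mgf_shift[OF t] exp_add ennreal_mult)
    also have "\<dots> = ennreal (exp ((OU_Q c \<sigma> t *v \<xi>) \<bullet> \<xi>)) * ennreal (m (coflow c t \<xi>))"
      unfolding nn[symmetric] by (rule nn_integral_cmult) simp
    finally have "ennreal (m \<xi>) = ennreal (exp ((OU_Q c \<sigma> t *v \<xi>) \<bullet> \<xi>) * m (coflow c t \<xi>))"
      by (simp add: ennreal_mult')
    then show ?thesis
      by (subst (asm) ennreal_inj) (auto simp: m_def)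
  qed
  obtain B where B: "\<And>n. norm (coflow c (real (Suc n)) \<xi>) \<le> B"
    using convergent_imp_Bseq[OF convergentI[OF coflow_tendsto_0[of \<xi>]]] unfolding Bseq_def by blast
  have "(\<lambda>n. m (coflow c (real (Suc n)) \<xi>)) \<longlonglongrightarrow> (\<integral>x. exp (0 \<bullet> x) \<partial>\<mu>)"
    unfolding m_def
  proof (rule integral_dominated_convergence[where w = "\<lambda>x. exp (B * norm x)"])
    show "AE x in \<mu>. (\<lambda>n. exp (coflow c (real (Suc n)) \<xi> \<bullet> x)) \<longlonglongrightarrow> exp (0 \<bullet> x)"
      by (intro AE_I2 tendsto_exp tendsto_inner coflow_tendsto_0 tendsto_const)
    have "coflow c (real (Suc n)) \<xi> \<bullet> x \<le> B * norm x" for n x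
      using norm_cauchy_schwarz[of "coflow c (real (Suc n)) \<xi>" x] mult_right_mono[OF B[of n] norm_ge_zero[of x]] by linarith
    then show "AE x in \<mu>. norm (exp (coflow c (real (Suc n)) \<xi> \<bullet> x)) \<le> exp (B * norm x)" for n
      by simp
  qed (simp_all add: integrable_exp_norm)
  then have "(\<lambda>n. exp ((OU_Q c \<sigma> (real (Suc n)) *v \<xi>) \<bullet> \<xi>) * m (coflow c (real (Suc n)) \<xi>)) \<longlonglongrightarrow>
      exp ((OU_cov c \<sigma> *v \<xi>) \<bullet> \<xi>) * 1"
    by (intro tendsto_mult tendsto_exp OU_Q_tendsto) (simp add: mu.prob_space[simplified])
  then have "(\<lambda>n. m \<xi>) \<longlonglongrightarrow> exp ((OU_cov c \<sigma> *v \<xi>) \<bullet> \<xi>)"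
    by (simp flip: step)
  then show ?thesis by (simp add: m_def LIMSEQ_const_iff)
qed

end

section \<open>Smoothing with the invariant measure\<close>

text \<open>A class that contains polynomials and exponentials and is closed under sums, products
  and translations. Its members turn out to be square-integrable for the invariant measure, so that
  integrability becomes a matter of closure rules.\<close>

definition exp_bounded :: "(real ^ 3 \<Rightarrow> real) set" where
  "exp_bounded = {f \<in> borel_measurable borel. \<exists>C a. \<forall>x. \<bar>f x\<bar> \<le> C * exp (a * norm x)}"

lemma exp_boundedE:
  assumes "f \<in> exp_bounded"
  obtains C a where "C \<ge> 0" "a \<ge> 0" "\<And>x. \<bar>f x\<bar> \<le> C * exp (a * norm x)"
proof -
  obtain C a where Ca: "\<And>x. \<bar>f x\<bar> \<le> C * exp (a * norm x)"
    using assms by (auto simp: exp_bounded_def)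
  have "\<bar>f x\<bar> \<le> \<bar>C\<bar> * exp (\<bar>a\<bar> * norm x)" for x
  proof -
    have "C * exp (a * norm x) \<le> \<bar>C\<bar> * exp (\<bar>a\<bar> * norm x)"
      by (intro mult_mono) (auto intro: mult_right_mono)
    then show ?thesis using Ca[of x] by linarith
  qed
  then show thesis by (intro that[of "\<bar>C\<bar>" "\<bar>a\<bar>"]) auto
qed

lemma exp_bounded_measurable: "f \<in> exp_bounded \<Longrightarrow> f \<in> borel_measurable borel"
  by (simp add: exp_bounded_def)

lemma exp_boundedI:
  "f \<in> borel_measurable borel \<Longrightarrow> (\<And>x. \<bar>f x\<bar> \<le> C * exp (a * norm x)) \<Longrightarrow> f \<in> exp_bounded"
  by (auto simp: exp_bounded_def)

lemma exp_bounded_add: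
  assumes "f \<in> exp_bounded" "g \<in> exp_bounded"
  shows "(\<lambda>x. f x + g x) \<in> exp_bounded"
proof -
  note [measurable] = assms[THEN exp_bounded_measurable]
  obtain C a where f: "C \<ge> 0" "a \<ge> 0" "\<And>x. \<bar>f x\<bar> \<le> C * exp (a * norm x)" using assms(1) by (rule exp_boundedE) blast
  obtain D b where g: "D \<ge> 0" "b \<ge> 0" "\<And>x. \<bar>g x\<bar> \<le> D * exp (b * norm x)" using assms(2) by (rule exp_boundedE) blast
  have "\<bar>f x + g x\<bar> \<le> (C + D) * exp ((a + b) * norm x)" for x
  proof -
    have "C * exp (a * norm x) \<le> C * exp ((a + b) * norm x)" "D * exp (b * norm x) \<le> D * exp ((a + b) * norm x)"
      using f g by (auto intro!: mult_left_mono mult_right_mono)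
    then show ?thesis using f(3)[of x] g(3)[of x] by (simp add: distrib_right)
  qed
  then show ?thesis by (intro exp_boundedI) simp_all
qed

lemma exp_bounded_mult:
  assumes "f \<in> exp_bounded" "g \<in> exp_bounded"
  shows "(\<lambda>x. f x * g x) \<in> exp_bounded"
proof -
  note [measurable] = assms[THEN exp_bounded_measurable]
  obtain C a where f: "C \<ge> 0" "a \<ge> 0" "\<And>x. \<bar>f x\<bar> \<le> C * exp (a * norm x)" using assms(1) by (rule exp_boundedE) blast
  obtain D b where g: "D \<ge> 0" "b \<ge> 0" "\<And>x. \<bar>g x\<bar> \<le> D * exp (b * norm x)" using assms(2) by (rule exp_boundedE) blast
  have "\<bar>f x * g x\<bar> \<le> (C * D) * exp ((a + b) * norm x)" for x
    using mult_mono[OF f(3)[of x] g(3)[of x]] f g by (simp add: abs_mult exp_add algebra_simps)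
  then show ?thesis by (intro exp_boundedI) simp_all
qed

lemma exp_bounded_const: "(\<lambda>x. a) \<in> exp_bounded"
  by (rule exp_boundedI[of _ "\<bar>a\<bar>" 0]) auto

lemma exp_bounded_scale: "f \<in> exp_bounded \<Longrightarrow> (\<lambda>x. a * f x) \<in> exp_bounded"
  by (intro exp_bounded_mult exp_bounded_const)

lemma exp_bounded_norm: "(\<lambda>x. norm x) \<in> exp_bounded"
proof (rule exp_boundedI[of _ 1 1])
  fix x :: "real ^ 3"
  have "norm x \<le> exp (norm x)" using exp_ge_add_one_self[of "norm x"] by linarith
  then show "\<bar>norm x\<bar> \<le> 1 * exp (1 * norm x)" by simp
qed simp

lemma exp_bounded_nth: "(\<lambda>x. x $ i) \<in> exp_bounded"
proof (rule exp_boundedI[of _ 1 1])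
  fix x :: "real ^ 3"
  have "\<bar>x $ i\<bar> \<le> exp (norm x)"
    using exp_ge_add_one_self[of "norm x"] component_le_norm_cart[of x i] by linarith
  then show "\<bar>x $ i\<bar> \<le> 1 * exp (1 * norm x)" by simp
qed (intro borel_measurable_continuous_onI continuous_intros)

lemma exp_bounded_power: "f \<in> exp_bounded \<Longrightarrow> (\<lambda>x. f x ^ k) \<in> exp_bounded"
  by (induction k) (auto intro: exp_bounded_mult exp_bounded_const)

lemma exp_bounded_affine: "(\<lambda>x. \<xi> \<bullet> x - a) \<in> exp_bounded"
proof -
  have "(\<lambda>x. \<xi> \<bullet> x - a) = (\<lambda>x. (\<xi> $ 1 * x $ 1 + \<xi> $ 2 * x $ 2 + \<xi> $ 3 * x $ 3) + - a)"
    by (auto simp: inner_vec_def sum_3)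
  also have "\<dots> \<in> exp_bounded"
    by (intro exp_bounded_add exp_bounded_scale exp_bounded_nth exp_bounded_const)
  finally show ?thesis .
qed

lemma exp_bounded_exp_inner: "(\<lambda>x. exp (\<xi> \<bullet> x)) \<in> exp_bounded"
  by (rule exp_boundedI[of _ 1 "norm \<xi>"]) (auto intro: norm_cauchy_schwarz)

lemma exp_bounded_monom3: "monom3 i j k \<in> exp_bounded"
  unfolding monom3_def by (intro exp_bounded_mult exp_bounded_power exp_bounded_nth)

lemma exp_bounded_lpoly: "p \<in> lpoly n \<Longrightarrow> p \<in> exp_bounded"
  unfolding lpoly_def
  by (induction rule: lspan.induct)
     (auto intro!: exp_bounded_add exp_bounded_scale exp_bounded_const exp_bounded_monom3)

section \<open>Square-integrable functions\<close>

lemma L2_mult_integrable: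
  assumes "f \<in> L2 M" "g \<in> L2 M"
  shows "integrable M (\<lambda>x. f x * g x)"
proof -
  have [measurable]: "f \<in> borel_measurable M" "g \<in> borel_measurable M" using assms by (auto simp: L2_def)
  have "integrable M (\<lambda>x. (f x)\<^sup>2 + (g x)\<^sup>2)" using assms by (auto simp: L2_def)
  then show ?thesis
  proof (rule Bochner_Integration.integrable_bound)
    have "\<bar>f x * g x\<bar> \<le> (f x)\<^sup>2 + (g x)\<^sup>2" for x
    proof -
      have "2 * (\<bar>f x\<bar> * \<bar>g x\<bar>) \<le> (f x)\<^sup>2 + (g x)\<^sup>2"
        using sum_squares_bound[of "\<bar>f x\<bar>" "\<bar>g x\<bar>"] by (simp add: mult.assoc)
      moreover have "0 \<le> \<bar>f x\<bar> * \<bar>g x\<bar>" by simp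
      ultimately show ?thesis unfolding abs_mult by linarith
    qed
    then show "AE x in M. norm (f x * g x) \<le> norm ((f x)\<^sup>2 + (g x)\<^sup>2)" by simp
  qed simp
qed

lemma L2_add:
  assumes "f \<in> L2 M" "g \<in> L2 M"
  shows "(\<lambda>x. f x + g x) \<in> L2 M"
proof -
  have "integrable M (\<lambda>x. (f x)\<^sup>2 + 2 * (f x * g x) + (g x)\<^sup>2)"
    using assms L2_mult_integrable[OF assms] by (auto simp: L2_def)
  then have "integrable M (\<lambda>x. (f x + g x)\<^sup>2)" by (simp add: power2_sum algebra_simps)
  then show ?thesis using assms by (auto simp: L2_def)
qed

lemma L2_scale: "f \<in> L2 M \<Longrightarrow> (\<lambda>x. a * f x) \<in> L2 M"
  by (auto simp: L2_def power_mult_distrib)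

lemma L2_diff: "f \<in> L2 M \<Longrightarrow> g \<in> L2 M \<Longrightarrow> (\<lambda>x. f x - g x) \<in> L2 M"
  using L2_add[OF _ L2_scale[of g M "- 1"], of f] by simp

lemma L2_zero: "(\<lambda>x. 0) \<in> L2 M" by (simp add: L2_def)

lemma L2_sum: "(\<And>i. i \<in> I \<Longrightarrow> f i \<in> L2 M) \<Longrightarrow> (\<lambda>x. \<Sum>i\<in>I. f i x) \<in> L2 M"
  by (induction I rule: infinite_finite_induct) (auto intro: L2_add L2_zero)

lemma L2_cauchy_schwarz:
  assumes "f \<in> L2 M" "g \<in> L2 M"
  shows "(\<integral>x. f x * g x \<partial>M)\<^sup>2 \<le> (\<integral>x. (f x)\<^sup>2 \<partial>M) * (\<integral>x. (g x)\<^sup>2 \<partial>M)"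
proof -
  define A B C where "A = (\<integral>x. (f x)\<^sup>2 \<partial>M)" "B = (\<integral>x. f x * g x \<partial>M)" "C = (\<integral>x. (g x)\<^sup>2 \<partial>M)"
  note defs = this
  have If: "integrable M (\<lambda>x. (f x)\<^sup>2)" and Ig: "integrable M (\<lambda>x. (g x)\<^sup>2)"
    using assms by (auto simp: L2_def)
  note Ifg = L2_mult_integrable[OF assms]
  have quad: "0 \<le> A - 2 * l * B + l\<^sup>2 * C" for l
  proof -
    have "0 \<le> (\<integral>x. (f x - l * g x)\<^sup>2 \<partial>M)" by (rule Bochner_Integration.integral_nonneg) simp
    also have "(\<lambda>x. (f x - l * g x)\<^sup>2) = (\<lambda>x. (f x)\<^sup>2 - 2 * l * (f x * g x) + l\<^sup>2 * (g x)\<^sup>2)"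
      by (auto simp: power2_eq_square algebra_simps)
    also have "(\<integral>x. (f x)\<^sup>2 - 2 * l * (f x * g x) + l\<^sup>2 * (g x)\<^sup>2 \<partial>M) = A - 2 * l * B + l\<^sup>2 * C"
      using If Ig Ifg by (simp add: defs)
    finally show ?thesis .
  qed
  have "C \<ge> 0" unfolding defs by (rule Bochner_Integration.integral_nonneg) simp
  have "B\<^sup>2 \<le> A * C"
  proof (cases "C = 0")
    case True
    have "B = 0"
    proof (rule ccontr)
      assume "B \<noteq> 0"
      \<comment> \<open>For C = 0 the quadratic polynomial in \<open>l\<close> is affine, and this
        value of \<open>l\<close> would make it -1.\<close>
      have "0 \<le> A - 2 * ((A + 1) / (2 * B)) * B" using quad[of "(A + 1) / (2 * B)"] True by simp
      then show False using \<open>B \<noteq> 0\<close> by simp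
    qed
    then show ?thesis using True by simp
  next
    case False
    then have "C > 0" using \<open>C \<ge> 0\<close> by simp
    have "0 \<le> (A - 2 * (B / C) * B + (B / C)\<^sup>2 * C) * C"
      using quad[of "B / C"] \<open>C > 0\<close> by (intro mult_nonneg_nonneg) auto
    also have "\<dots> = A * C - B\<^sup>2" using \<open>C > 0\<close> by (simp add: field_simps power2_eq_square)
    finally show ?thesis by simp
  qed
  then show ?thesis by (simp add: defs)
qed

lemma L2_norm_sq_eq: "f \<in> L2 M \<Longrightarrow> L2_norm_sq M f = ennreal (\<integral>x. (f x)\<^sup>2 \<partial>M)"
  unfolding L2_norm_sq_def L2_def by (intro nn_integral_eq_integral) auto

lemma L2_norm_sq_cong_AE: "(AE x in M. f x = g x) \<Longrightarrow> L2_norm_sq M f = L2_norm_sq M g"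
  unfolding L2_norm_sq_def by (intro nn_integral_cong_AE) auto

text \<open>The factors 2 are the price of working with squared norms; they do not matter for limits
  equal to 0.\<close>

lemma L2_norm_sq_triangle:
  assumes [measurable]: "f \<in> borel_measurable M" "g \<in> borel_measurable M"
  shows "L2_norm_sq M (\<lambda>x. f x - g x) \<le> 2 * L2_norm_sq M f + 2 * L2_norm_sq M g"
proof -
  have "L2_norm_sq M (\<lambda>x. f x - g x) \<le> (\<integral>\<^sup>+x. 2 * ennreal ((f x)\<^sup>2) + 2 * ennreal ((g x)\<^sup>2) \<partial>M)"
    unfolding L2_norm_sq_def
  proof (rule nn_integral_mono)
    fix x
    have "(f x - g x)\<^sup>2 \<le> 2 * (f x)\<^sup>2 + 2 * (g x)\<^sup>2"
      using zero_le_power2[of "f x + g x"] by (simp add: power2_eq_square algebra_simps)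
    then have "ennreal ((f x - g x)\<^sup>2) \<le> ennreal (2 * (f x)\<^sup>2 + 2 * (g x)\<^sup>2)" by (rule ennreal_leI)
    also have "\<dots> = 2 * ennreal ((f x)\<^sup>2) + 2 * ennreal ((g x)\<^sup>2)"
      by (simp add: ennreal_plus ennreal_mult)
    finally show "ennreal ((f x - g x)\<^sup>2) \<le> 2 * ennreal ((f x)\<^sup>2) + 2 * ennreal ((g x)\<^sup>2)" .
  qed
  also have "\<dots> = 2 * L2_norm_sq M f + 2 * L2_norm_sq M g"
    unfolding L2_norm_sq_def by (subst nn_integral_add) (simp_all add: nn_integral_cmult)
  finally show ?thesis .
qed

lemma L2_norm_sq_eq_0:
  assumes "f \<in> borel_measurable M" "L2_norm_sq M f = 0"
  shows "AE x in M. f x = 0"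
  using assms unfolding L2_norm_sq_def by (simp add: nn_integral_0_iff_AE)

lemma L2_norm_sq_limit_unique:
  assumes "F \<noteq> bot" "\<And>i. \<phi> i \<in> borel_measurable M" "f \<in> borel_measurable M" "g \<in> borel_measurable M"
    and f: "((\<lambda>i. L2_norm_sq M (\<lambda>x. \<phi> i x - f x)) \<longlongrightarrow> 0) F"
    and g: "((\<lambda>i. L2_norm_sq M (\<lambda>x. \<phi> i x - g x)) \<longlongrightarrow> 0) F"
  shows "AE x in M. f x = g x"
proof -
  have "L2_norm_sq M (\<lambda>x. g x - f x) \<le> 2 * L2_norm_sq M (\<lambda>x. \<phi> i x - f x) + 2 * L2_norm_sq M (\<lambda>x. \<phi> i x - g x)" for i
    using L2_norm_sq_triangle[of "\<lambda>x. \<phi> i x - f x" M "\<lambda>x. \<phi> i x - g x"] assms(2-4) by simp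
  moreover have "((\<lambda>i. 2 * L2_norm_sq M (\<lambda>x. \<phi> i x - f x) + 2 * L2_norm_sq M (\<lambda>x. \<phi> i x - g x)) \<longlongrightarrow> 2 * 0 + 2 * 0) F"
    by (intro tendsto_add ennreal_tendsto_cmult f g) simp_all
  ultimately have "L2_norm_sq M (\<lambda>x. g x - f x) \<le> 2 * 0 + 2 * 0"
    by (intro tendsto_lowerbound[OF _ _ assms(1)] always_eventually) auto
  then have "L2_norm_sq M (\<lambda>x. g x - f x) = 0" by simp
  then have "AE x in M. g x - f x = 0" by (intro L2_norm_sq_eq_0) (use assms(3,4) in auto)
  then show ?thesis by auto
qed

section \<open>Normalised exponentials, the Cameron-Martin formula, and injectivity of
  smoothing\<close>

context OU_process
begin

lemma exp_bounded_integrable: "f \<in> exp_bounded \<Longrightarrow> integrable \<mu> f"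
proof -
  assume f: "f \<in> exp_bounded"
  obtain C a where Ca: "C \<ge> 0" "\<And>x. \<bar>f x\<bar> \<le> C * exp (a * norm x)" using f by (rule exp_boundedE) blast
  have "integrable \<mu> (\<lambda>x. C * exp (a * norm x))" by (intro integrable_mult_right integrable_exp_norm)
  then show "integrable \<mu> f"
    by (rule Bochner_Integration.integrable_bound)
       (use Ca exp_bounded_measurable[OF f] in \<open>auto simp: abs_mult\<close>)
qed

lemma exp_bounded_L2: "f \<in> exp_bounded \<Longrightarrow> f \<in> L2 \<mu>"
  using exp_bounded_integrable[OF exp_bounded_power[of f 2]] exp_bounded_measurable[of f]
  by (simp add: L2_def)

lemma L2_measurable: "f \<in> L2 \<mu> \<Longrightarrow> f \<in> borel_measurable borel"
  by (simp add: L2_def measurable_cong_sets[OF sets_mu refl])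

lemma L2_integrable: "f \<in> L2 \<mu> \<Longrightarrow> integrable \<mu> f"
  using L2_mult_integrable[OF _ exp_bounded_L2[OF exp_bounded_const[of 1]], of f] by simp

abbreviation "cov \<equiv> OU_cov c \<sigma>"

text \<open>The exponential normalised to have integral 1 with respect to \<open>\<mu>\<close>;
  these functions are the densities of the translates of \<open>\<mu>\<close>.\<close>

definition wick_exp :: "real ^ 3 \<Rightarrow> real ^ 3 \<Rightarrow> real" where
  "wick_exp \<eta> x = exp (\<eta> \<bullet> x - (cov *v \<eta>) \<bullet> \<eta>)"

lemma wick_exp_eq: "wick_exp \<eta> x = exp (- ((cov *v \<eta>) \<bullet> \<eta>)) * exp (\<eta> \<bullet> x)"
  by (simp add: wick_exp_def exp_diff exp_minus field_simps)

lemma wick_exp_bounded: "wick_exp \<eta> \<in> exp_bounded"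
  unfolding wick_exp_eq[abs_def] by (intro exp_bounded_scale exp_bounded_exp_inner)

lemma wick_exp_mult: "wick_exp \<eta> x * wick_exp \<eta>' x =
    exp (2 * ((cov *v \<eta>) \<bullet> \<eta>')) * wick_exp (\<eta> + \<eta>') x"
  using OU_cov_sym[of c \<sigma> \<eta> \<eta>']
  by (simp add: wick_exp_def inner_add_left inner_add_right matrix_vector_right_distrib flip: exp_add)

lemma wick_exp_integral: "(\<integral>x. wick_exp \<eta> x \<partial>\<mu>) = 1"
  unfolding wick_exp_eq by (subst integral_mult_right_zero) (simp add: mu_mgf flip: exp_add)

lemma wick_exp_gram: "(\<integral>x. wick_exp \<eta> x * wick_exp \<eta>' x \<partial>\<mu>) = exp (2 * ((cov *v \<eta>) \<bullet> \<eta>'))"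
  by (simp add: wick_exp_mult wick_exp_integral)

text \<open>Both measures are finite and their Laplace transforms are explicit Gaussian expressions,
  which agree by symmetry of \<open>cov\<close>. The translation carries a factor 2 because the
  covariance of \<open>\<mu>\<close> is twice \<open>cov\<close>.\<close>

lemma cameron_martin:
  "distr \<mu> borel (\<lambda>x. x + 2 *\<^sub>R (cov *v \<eta>)) = density \<mu> (\<lambda>x. ennreal (wick_exp \<eta> x))" (is "?L = ?R")
proof (rule laplace_eq_imp_measure_eq)
  have [measurable]: "wick_exp \<eta> \<in> borel_measurable borel"
    by (rule exp_bounded_measurable[OF wick_exp_bounded])
  have wnn: "wick_exp \<eta> x \<ge> 0" for x by (simp add: wick_exp_def)
  interpret L: prob_space ?L by (rule mu.prob_space_distr) simp
  show "finite_measure ?L" by (rule L.finite_measure_axioms)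
  have wi: "integrable \<mu> (\<lambda>x. wick_exp \<eta> x * exp (\<xi> \<bullet> x))" for \<xi>
    by (intro exp_bounded_integrable exp_bounded_mult wick_exp_bounded exp_bounded_exp_inner)
  show "finite_measure ?R"
  proof
    have "(\<integral>\<^sup>+x. ennreal (wick_exp \<eta> x) \<partial>\<mu>) = ennreal (\<integral>x. wick_exp \<eta> x \<partial>\<mu>)"
      using wnn by (intro nn_integral_eq_integral exp_bounded_integrable wick_exp_bounded) auto
    then show "emeasure ?R (space ?R) \<noteq> \<infinity>" by (simp add: emeasure_density)
  qed
  show "sets ?L = sets borel" "sets ?R = sets borel" by simp_all
  fix \<xi>
  have s: "exp (\<xi> \<bullet> (x + 2 *\<^sub>R (cov *v \<eta>))) = exp (2 * (\<xi> \<bullet> (cov *v \<eta>))) * exp (\<xi> \<bullet> x)" for x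
    by (simp add: inner_add_right flip: exp_add)
  show "integrable ?L (\<lambda>x. exp (\<xi> \<bullet> x))"
    by (subst integrable_distr_eq) (simp_all add: s integrable_exp_inner)
  show "integrable ?R (\<lambda>x. exp (\<xi> \<bullet> x))"
    using wi[of \<xi>] wnn by (subst integrable_density) auto
  have "(\<integral>x. exp (\<xi> \<bullet> x) \<partial>?L) = exp (2 * (\<xi> \<bullet> (cov *v \<eta>))) * exp ((cov *v \<xi>) \<bullet> \<xi>)"
    by (subst integral_distr) (simp_all add: s mu_mgf)
  also have "\<dots> = (\<integral>x. wick_exp \<eta> x * exp (\<xi> \<bullet> x) \<partial>\<mu>)"
  proof -
    have "wick_exp \<eta> x * exp (\<xi> \<bullet> x) = exp (- ((cov *v \<eta>) \<bullet> \<eta>)) * exp ((\<eta> + \<xi>) \<bullet> x)" for x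
      by (simp add: wick_exp_eq inner_add_left exp_add)
    then have "(\<integral>x. wick_exp \<eta> x * exp (\<xi> \<bullet> x) \<partial>\<mu>) = exp (- ((cov *v \<eta>) \<bullet> \<eta>)) * exp ((cov *v (\<eta> + \<xi>)) \<bullet> (\<eta> + \<xi>))"
      by (simp add: mu_mgf)
    then show ?thesis
      using OU_cov_sym[of c \<sigma> \<eta> \<xi>]
      by (simp add: inner_add_left inner_add_right matrix_vector_right_distrib inner_commute flip: exp_add)
  qed
  also have "\<dots> = (\<integral>x. exp (\<xi> \<bullet> x) \<partial>?R)"
    using wnn by (subst integral_density) auto
  finally show "(\<integral>x. exp (\<xi> \<bullet> x) \<partial>?L) = (\<integral>x. exp (\<xi> \<bullet> x) \<partial>?R)" .
qed

text \<open>The inverse of \<eta> \<mapsto> 2 Q \<eta>: \<open>wick_exp (eta \<zeta>)\<close> is the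
  density of the translate by \<open>\<zeta>\<close>.\<close>

definition eta :: "real ^ 3 \<Rightarrow> real ^ 3" where
  "eta \<zeta> = (1 / 2) *\<^sub>R (matrix_inv cov *v \<zeta>)"

lemma invertible_cov: "invertible cov"
  using det_OU_cov[OF c_pos sigma_pos] by (simp add: invertible_det_nz)

lemma cov_eta: "2 *\<^sub>R (cov *v eta \<zeta>) = \<zeta>"
  by (simp add: eta_def matrix_vector_mult_scaleR matrix_vector_mul_assoc matrix_inv_mult[OF invertible_cov])

lemma eta_cov: "eta (2 *\<^sub>R (cov *v \<eta>)) = \<eta>"
  by (simp add: eta_def matrix_vector_mult_scaleR matrix_vector_mul_assoc matrix_inv_mult[OF invertible_cov])

lemma linear_eta: "linear eta"
  unfolding eta_def[abs_def] by (intro linear_compose_scale_right matrix_vector_mul_linear)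

definition smooth :: "(real ^ 3 \<Rightarrow> real) \<Rightarrow> real ^ 3 \<Rightarrow> real" where
  "smooth f \<zeta> = (\<integral>x. f (x + \<zeta>) \<partial>\<mu>)"

text \<open>By the Cameron--Martin formula, translates of \<open>\<mu>\<close> have square-integrable densities; so \<^const>\<open>smooth\<close>
  makes sense on \<open>L\<^sup>2\<close> and does not see null sets.\<close>

lemma translate_integrable:
  assumes "f \<in> L2 \<mu>"
  shows "integrable \<mu> (\<lambda>x. f (x + \<zeta>))"
    and "smooth f \<zeta> = (\<integral>x. f x * wick_exp (eta \<zeta>) x \<partial>\<mu>)"
proof -
  have [measurable]: "f \<in> borel_measurable borel" "wick_exp (eta \<zeta>) \<in> borel_measurable borel"
    using L2_measurable[OF assms] exp_bounded_measurable[OF wick_exp_bounded] by auto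
  have wnn: "wick_exp (eta \<zeta>) x \<ge> 0" for x by (simp add: wick_exp_def)
  note cm = cameron_martin[of "eta \<zeta>", unfolded cov_eta]
  have "integrable \<mu> (\<lambda>x. wick_exp (eta \<zeta>) x * f x)"
    using L2_mult_integrable[OF exp_bounded_L2[OF wick_exp_bounded] assms] .
  then have "integrable (distr \<mu> borel (\<lambda>x. x + \<zeta>)) f"
    unfolding cm using wnn by (subst integrable_density) auto
  then show "integrable \<mu> (\<lambda>x. f (x + \<zeta>))"
    by (subst (asm) integrable_distr_eq) simp_all
  have "smooth f \<zeta> = (\<integral>x. f x \<partial>distr \<mu> borel (\<lambda>x. x + \<zeta>))"
    unfolding smooth_def by (subst integral_distr) simp_all
  also have "\<dots> = (\<integral>x. f x * wick_exp (eta \<zeta>) x \<partial>\<mu>)"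
    unfolding cm using wnn by (subst integral_density) (auto simp: mult.commute)
  finally show "smooth f \<zeta> = (\<integral>x. f x * wick_exp (eta \<zeta>) x \<partial>\<mu>)" .
qed

lemma smooth_cong_AE:
  assumes "f \<in> L2 \<mu>" "g \<in> L2 \<mu>" "AE x in \<mu>. f x = g x"
  shows "smooth f = smooth g"
proof
  fix \<zeta>
  have [measurable]: "f \<in> borel_measurable borel" "g \<in> borel_measurable borel" "wick_exp (eta \<zeta>) \<in> borel_measurable borel"
    using assms L2_measurable exp_bounded_measurable[OF wick_exp_bounded] by auto
  show "smooth f \<zeta> = smooth g \<zeta>"
    unfolding translate_integrable(2)[OF assms(1)] translate_integrable(2)[OF assms(2)]
    by (rule integral_cong_AE) (use assms(3) in auto)
qed

lemma smooth_add: "f \<in> L2 \<mu> \<Longrightarrow> g \<in> L2 \<mu> \<Longrightarrow> smooth (\<lambda>x. f x + g x) \<zeta> = smooth f \<zeta> + smooth g \<zeta>"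
  unfolding smooth_def by (intro Bochner_Integration.integral_add translate_integrable)

lemma smooth_diff: "f \<in> L2 \<mu> \<Longrightarrow> g \<in> L2 \<mu> \<Longrightarrow> smooth (\<lambda>x. f x - g x) \<zeta> = smooth f \<zeta> - smooth g \<zeta>"
  unfolding smooth_def by (intro Bochner_Integration.integral_diff translate_integrable)

lemma smooth_scale: "smooth (\<lambda>x. a * f x) \<zeta> = a * smooth f \<zeta>"
  unfolding smooth_def by simp

lemma smooth_zero [simp]: "smooth (\<lambda>x. 0) \<zeta> = 0"
  unfolding smooth_def by simp

lemma smooth_sum: "(\<And>i. i \<in> I \<Longrightarrow> f i \<in> L2 \<mu>) \<Longrightarrow> smooth (\<lambda>x. \<Sum>i\<in>I. f i x) \<zeta> = (\<Sum>i\<in>I. smooth (f i) \<zeta>)"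
  unfolding smooth_def by (intro Bochner_Integration.integral_sum translate_integrable)

lemma smooth_bound:
  assumes "f \<in> L2 \<mu>"
  shows "(smooth f \<zeta>)\<^sup>2 \<le> (\<integral>x. (f x)\<^sup>2 \<partial>\<mu>) * exp (2 * ((cov *v eta \<zeta>) \<bullet> eta \<zeta>))"
proof -
  have "(smooth f \<zeta>)\<^sup>2 \<le> (\<integral>x. (f x)\<^sup>2 \<partial>\<mu>) * (\<integral>x. (wick_exp (eta \<zeta>) x)\<^sup>2 \<partial>\<mu>)"
    unfolding translate_integrable(2)[OF assms]
    by (intro L2_cauchy_schwarz assms exp_bounded_L2 wick_exp_bounded)
  then show ?thesis using wick_exp_gram[of "eta \<zeta>" "eta \<zeta>"] by (simp add: power2_eq_square)
qed

lemma isCont_eta: "isCont eta \<zeta>"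
  using linear_eta by (simp add: linear_continuous_at linear_conv_bounded_linear)

lemma isCont_cov: "isCont (\<lambda>\<zeta>. cov *v eta \<zeta>) x"
  by (intro isCont_o2[OF isCont_eta] linear_continuous_at linear_conv_bounded_linear[THEN iffD1] matrix_vector_mul_linear)

text \<open>By Cauchy-Schwarz the increment is at most the norm of \<open>f\<close> times the L2
  distance of two normalised exponentials, and \<open>wick_exp_gram\<close> makes that distance
  explicit and continuous.\<close>

lemma isCont_smooth:
  assumes "f \<in> L2 \<mu>"
  shows "isCont (smooth f) \<zeta>"
proof -
  let ?N = "\<integral>x. (f x)\<^sup>2 \<partial>\<mu>"
  define b where "b \<zeta>' = ?N * (exp (2 * ((cov *v eta \<zeta>') \<bullet> eta \<zeta>')) + exp (2 * ((cov *v eta \<zeta>) \<bullet> eta \<zeta>))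
     - 2 * exp (2 * ((cov *v eta \<zeta>') \<bullet> eta \<zeta>)))" for \<zeta>'
  have le: "(smooth f \<zeta>' - smooth f \<zeta>)\<^sup>2 \<le> b \<zeta>'" for \<zeta>'
  proof -
    let ?w = "wick_exp (eta \<zeta>)" and ?w' = "wick_exp (eta \<zeta>')"
    have w: "?w \<in> L2 \<mu>" "?w' \<in> L2 \<mu>" by (intro exp_bounded_L2 wick_exp_bounded)+
    have "smooth f \<zeta>' - smooth f \<zeta> = (\<integral>x. f x * (?w' x - ?w x) \<partial>\<mu>)"
      unfolding translate_integrable(2)[OF assms] right_diff_distrib
      by (rule Bochner_Integration.integral_diff[symmetric]) (intro L2_mult_integrable assms w)+
    then have "(smooth f \<zeta>' - smooth f \<zeta>)\<^sup>2 \<le> ?N * (\<integral>x. (?w' x - ?w x)\<^sup>2 \<partial>\<mu>)"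
      by (simp only:) (intro L2_cauchy_schwarz assms L2_diff w)
    also have "(\<integral>x. (?w' x - ?w x)\<^sup>2 \<partial>\<mu>) = (\<integral>x. ?w' x * ?w' x + ?w x * ?w x - 2 * (?w' x * ?w x) \<partial>\<mu>)"
      by (simp add: power2_eq_square algebra_simps)
    also have "\<dots> = (\<integral>x. ?w' x * ?w' x \<partial>\<mu>) + (\<integral>x. ?w x * ?w x \<partial>\<mu>) - 2 * (\<integral>x. ?w' x * ?w x \<partial>\<mu>)"
      using w by (simp add: L2_mult_integrable)
    finally show ?thesis unfolding wick_exp_gram b_def .
  qed
  have "isCont b \<zeta>"
    unfolding b_def by (intro continuous_intros isCont_eta isCont_cov)
  then have "b \<midarrow>\<zeta>\<rightarrow> b \<zeta>" by (simp add: isCont_def)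
  moreover have "b \<zeta> = 0" by (simp add: b_def)
  ultimately have b0: "b \<midarrow>\<zeta>\<rightarrow> 0" by simp
  have "(\<lambda>\<zeta>'. (smooth f \<zeta>' - smooth f \<zeta>)\<^sup>2) \<midarrow>\<zeta>\<rightarrow> 0"
    by (rule tendsto_sandwich[OF always_eventually always_eventually tendsto_const b0]) (simp_all add: le)
  then have "(\<lambda>\<zeta>'. sqrt ((smooth f \<zeta>' - smooth f \<zeta>)\<^sup>2)) \<midarrow>\<zeta>\<rightarrow> sqrt 0" by (rule tendsto_real_sqrt)
  then have "(\<lambda>\<zeta>'. smooth f \<zeta>' - smooth f \<zeta>) \<midarrow>\<zeta>\<rightarrow> 0" by (simp add: tendsto_rabs_zero_iff)
  then show ?thesis by (simp add: isCont_def LIM_zero_iff)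
qed

text \<open>Since every frequency \<xi> belongs to the translation by 2 Q \<xi>, vanishing of
  \<open>smooth f\<close> says that the measures with densities the positive and the negative part
  of \<open>f\<close> have the same Laplace transform.\<close>

lemma smooth_inj:
  assumes f: "f \<in> L2 \<mu>" and zero: "\<And>\<zeta>. smooth f \<zeta> = 0"
  shows "AE x in \<mu>. f x = 0"
proof -
  have [measurable]: "f \<in> borel_measurable borel" by (rule L2_measurable[OF f])
  \<comment> \<open>\<open>P 1\<close> is the positive part of \<open>f\<close> and
    \<open>P (- 1)\<close> the negative part, so that both are treated at once.\<close>
  define P where "P s x = max 0 (s * f x)" for s :: real and x
  have [measurable]: "P s \<in> borel_measurable borel" for s unfolding P_def by measurable
  have Pnn: "P s x \<ge> 0" for s x by (simp add: P_def)
  have PL2: "P s \<in> L2 \<mu>" for s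
  proof -
    have "integrable \<mu> (\<lambda>x. (s * f x)\<^sup>2)" using L2_scale[OF f] by (simp add: L2_def)
    then have "integrable \<mu> (\<lambda>x. (P s x)\<^sup>2)"
      by (rule Bochner_Integration.integrable_bound) (auto simp: P_def max_def)
    then show ?thesis by (simp add: L2_def)
  qed
  have Pint: "integrable \<mu> (\<lambda>x. P s x * exp (\<xi> \<bullet> x))" for s \<xi>
    by (intro L2_mult_integrable PL2 exp_bounded_L2 exp_bounded_exp_inner)
  have fin: "finite_measure (density \<mu> (\<lambda>x. ennreal (P s x)))" for s
  proof
    have "(\<integral>\<^sup>+x. ennreal (P s x) \<partial>\<mu>) = ennreal (\<integral>x. P s x \<partial>\<mu>)"
      using Pnn by (intro nn_integral_eq_integral L2_integrable PL2) auto
    then show "emeasure (density \<mu> (\<lambda>x. ennreal (P s x))) (space (density \<mu> (\<lambda>x. ennreal (P s x)))) \<noteq> \<infinity>"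
      by (simp add: emeasure_density)
  qed
  have "density \<mu> (\<lambda>x. ennreal (P 1 x)) = density \<mu> (\<lambda>x. ennreal (P (- 1) x))"
  proof (rule laplace_eq_imp_measure_eq[OF fin fin])
    fix \<xi>
    show "integrable (density \<mu> (\<lambda>x. ennreal (P 1 x))) (\<lambda>x. exp (\<xi> \<bullet> x))"
         "integrable (density \<mu> (\<lambda>x. ennreal (P (- 1) x))) (\<lambda>x. exp (\<xi> \<bullet> x))"
      using Pint Pnn by (subst integrable_density; auto)+
    have e: "(\<integral>x. exp (\<xi> \<bullet> x) \<partial>density \<mu> (\<lambda>x. ennreal (P s x))) = (\<integral>x. P s x * exp (\<xi> \<bullet> x) \<partial>\<mu>)" for s
      using Pnn by (subst integral_density) auto
    have "(\<integral>x. P 1 x * exp (\<xi> \<bullet> x) \<partial>\<mu>) - (\<integral>x. P (- 1) x * exp (\<xi> \<bullet> x) \<partial>\<mu>) =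
        (\<integral>x. P 1 x * exp (\<xi> \<bullet> x) - P (- 1) x * exp (\<xi> \<bullet> x) \<partial>\<mu>)"
      by (intro Bochner_Integration.integral_diff[symmetric] Pint)
    also have "\<dots> = (\<integral>x. exp ((cov *v \<xi>) \<bullet> \<xi>) * (f x * wick_exp \<xi> x) \<partial>\<mu>)"
      by (intro Bochner_Integration.integral_cong) (auto simp: P_def max_def wick_exp_def exp_diff field_simps)
    also have "\<dots> = exp ((cov *v \<xi>) \<bullet> \<xi>) * smooth f (2 *\<^sub>R (cov *v \<xi>))"
      unfolding translate_integrable(2)[OF f] eta_cov by simp
    finally show "(\<integral>x. exp (\<xi> \<bullet> x) \<partial>density \<mu> (\<lambda>x. ennreal (P 1 x))) =
        (\<integral>x. exp (\<xi> \<bullet> x) \<partial>density \<mu> (\<lambda>x. ennreal (P (- 1) x)))"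
      unfolding e by (simp add: zero)
  qed simp_all
  then have "AE x in \<mu>. ennreal (P 1 x) = ennreal (P (- 1) x)"
    by (subst (asm) mu.density_unique_iff) auto
  then show ?thesis
    by eventually_elim (auto simp: P_def max_def split: if_splits)
qed

end

section \<open>The semigroup and its generator\<close>

context OU_process
begin

abbreviation "T \<equiv> OU_semigroup c \<sigma>"

lemma T_0 [simp]: "T 0 f = f"
  by (auto simp: OU_semigroup_def)

lemma T_measurable:
  assumes "t \<ge> 0" and [measurable]: "f \<in> borel_measurable borel"
  shows "T t f \<in> borel_measurable borel"
proof (cases "t = 0")
  case False
  then have t: "t > 0" using assms by simp
  interpret K: prob_space "kern t" by (rule kern_prob_space[OF t])
  have "(\<lambda>p. f (flow c t (fst p) - snd p)) \<in> borel_measurable (borel \<Otimes>\<^sub>M kern t)"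
    by measurable
  then have "(\<lambda>x. \<integral>y. f (flow c t x - y) \<partial>kern t) \<in> borel_measurable borel"
    by (intro K.borel_measurable_lebesgue_integral) (simp add: split_def)
  moreover have "T t f = (\<lambda>x. \<integral>y. f (flow c t x - y) \<partial>kern t)"
    using semigroup_eq[OF t assms(2)] by (rule ext)
  ultimately show ?thesis by simp
qed simp

text \<open>Cauchy-Schwarz against the constant 1 for the probability measure \<open>kern t\<close>;
  an infinite right-hand side is trivial.\<close>

lemma T_jensen:
  assumes t: "t > 0" and [measurable]: "f \<in> borel_measurable borel"
  shows "ennreal ((T t f x)\<^sup>2) \<le> (\<integral>\<^sup>+y. ennreal ((f (flow c t x - y))\<^sup>2) \<partial>kern t)"
proof (cases "(\<integral>\<^sup>+y. ennreal ((f (flow c t x - y))\<^sup>2) \<partial>kern t) = \<infinity>")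
  case False
  interpret K: prob_space "kern t" by (rule kern_prob_space[OF t])
  let ?g = "\<lambda>y. f (flow c t x - y)"
  have I: "integrable (kern t) (\<lambda>y. (?g y)\<^sup>2)"
    using False by (intro integrableI_bounded) (auto simp: top.not_eq_extremum)
  then have "?g \<in> L2 (kern t)" "(\<lambda>y. 1) \<in> L2 (kern t)" by (auto simp: L2_def)
  from L2_cauchy_schwarz[OF this] have "(\<integral>y. ?g y \<partial>kern t)\<^sup>2 \<le> (\<integral>y. (?g y)\<^sup>2 \<partial>kern t)"
    by (simp add: K.prob_space[unfolded space_kern])
  then have "ennreal ((T t f x)\<^sup>2) \<le> ennreal (\<integral>y. (?g y)\<^sup>2 \<partial>kern t)"
    unfolding semigroup_eq[OF t assms(2)] by (rule ennreal_leI)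
  also have "\<dots> = (\<integral>\<^sup>+y. ennreal ((?g y)\<^sup>2) \<partial>kern t)"
    using I by (intro nn_integral_eq_integral[symmetric]) auto
  finally show ?thesis .
qed simp

lemma T_contraction:
  assumes "t \<ge> 0" and [measurable]: "f \<in> borel_measurable borel"
  shows "L2_norm_sq \<mu> (T t f) \<le> L2_norm_sq \<mu> f"
proof (cases "t = 0")
  case False
  then have t: "t > 0" using assms by simp
  have "L2_norm_sq \<mu> (T t f) \<le> (\<integral>\<^sup>+x. (\<integral>\<^sup>+y. ennreal ((f (flow c t x - y))\<^sup>2) \<partial>kern t) \<partial>\<mu>)"
    unfolding L2_norm_sq_def by (intro nn_integral_mono T_jensen t assms)
  also have "\<dots> = L2_norm_sq \<mu> f"
    unfolding L2_norm_sq_def by (rule nn_integral_invariant[OF t]) simp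
  finally show ?thesis .
qed simp

lemma L2I:
  assumes [measurable]: "f \<in> borel_measurable borel" and "L2_norm_sq \<mu> f < \<infinity>"
  shows "f \<in> L2 \<mu>"
proof -
  have "integrable \<mu> (\<lambda>x. (f x)\<^sup>2)"
    using assms(2) unfolding L2_norm_sq_def by (intro integrableI_bounded) auto
  then show ?thesis by (simp add: L2_def)
qed

lemma T_L2:
  assumes "t \<ge> 0" "f \<in> L2 \<mu>"
  shows "T t f \<in> L2 \<mu>"
proof (rule L2I)
  note f = L2_measurable[OF assms(2)]
  show "T t f \<in> borel_measurable borel" by (rule T_measurable[OF assms(1) f])
  have "L2_norm_sq \<mu> (T t f) \<le> L2_norm_sq \<mu> f" by (rule T_contraction[OF assms(1) f])
  also have "\<dots> < \<infinity>" by (simp add: L2_norm_sq_eq[OF assms(2)])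
  finally show "L2_norm_sq \<mu> (T t f) < \<infinity>" .
qed

text \<open>For unbounded \<open>f\<close> the integral defining the semigroup may diverge at some
  points, where it takes the default value 0 and additivity fails. By invariance these points form a
  null set.\<close>

lemma kern_integrable_AE:
  assumes t: "t > 0" and f: "f \<in> L2 \<mu>"
  shows "AE x in \<mu>. integrable (kern t) (\<lambda>y. f (flow c t x - y))"
proof -
  interpret K: prob_space "kern t" by (rule kern_prob_space[OF t])
  have [measurable]: "f \<in> borel_measurable borel" by (rule L2_measurable[OF f])
  have "(\<integral>\<^sup>+x. (\<integral>\<^sup>+y. ennreal \<bar>f (flow c t x - y)\<bar> \<partial>kern t) \<partial>\<mu>) = (\<integral>\<^sup>+x. ennreal \<bar>f x\<bar> \<partial>\<mu>)"
    by (rule nn_integral_invariant[OF t]) simp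
  also have "\<dots> = ennreal (\<integral>x. \<bar>f x\<bar> \<partial>\<mu>)"
    using L2_integrable[OF f] by (intro nn_integral_eq_integral) auto
  finally have "(\<integral>\<^sup>+x. (\<integral>\<^sup>+y. ennreal \<bar>f (flow c t x - y)\<bar> \<partial>kern t) \<partial>\<mu>) \<noteq> \<infinity>" by simp
  moreover have "(\<lambda>x. \<integral>\<^sup>+y. ennreal \<bar>f (flow c t x - y)\<bar> \<partial>kern t) \<in> borel_measurable \<mu>"
  proof -
    have "(\<lambda>p. ennreal \<bar>f (flow c t (fst p) - snd p)\<bar>) \<in> borel_measurable (\<mu> \<Otimes>\<^sub>M kern t)"
      by measurable
    then show ?thesis by (intro K.borel_measurable_nn_integral) (simp add: split_def)
  qed
  ultimately have "AE x in \<mu>. (\<integral>\<^sup>+y. ennreal \<bar>f (flow c t x - y)\<bar> \<partial>kern t) \<noteq> \<infinity>"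
    by (intro nn_integral_noteq_infinite)
  then show ?thesis
    by eventually_elim (auto intro!: integrableI_bounded simp: top.not_eq_extremum)
qed

lemma T_diff:
  assumes "t \<ge> 0" and f: "f \<in> L2 \<mu>" and g: "g \<in> L2 \<mu>"
  shows "AE x in \<mu>. T t (\<lambda>x. f x - g x) x = T t f x - T t g x"
proof (cases "t = 0")
  case False
  then have t: "t > 0" using assms by simp
  have [measurable]: "f \<in> borel_measurable borel" "g \<in> borel_measurable borel"
    using L2_measurable f g by auto
  from kern_integrable_AE[OF t f] kern_integrable_AE[OF t g] show ?thesis
    by eventually_elim (simp add: semigroup_eq[OF t])
qed simp

lemma flow_plus: "flow c t (x + y) = flow c t x + flow c t y"
  by (rule linear_add[OF linear_flow])

text \<open>As the flow is linear, flow (x + \<zeta>) - y = (flow x - y) + flow \<zeta>. By Fubini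
  and invariance the bracket is distributed according to \<open>\<mu>\<close>.\<close>

lemma smooth_T:
  assumes "t \<ge> 0" and f: "f \<in> L2 \<mu>"
  shows "smooth (T t f) \<zeta> = smooth f (flow c t \<zeta>)"
proof (cases "t = 0")
  case False
  then have t: "t > 0" using assms by simp
  interpret K: prob_space "kern t" by (rule kern_prob_space[OF t])
  interpret P: pair_sigma_finite \<mu> "kern t" ..
  have [measurable]: "f \<in> borel_measurable borel" by (rule L2_measurable[OF f])
  let ?Z = "\<lambda>(x, y). flow c t x - y"
  define F where "F z = f (z + flow c t \<zeta>)" for z
  have [measurable]: "F \<in> borel_measurable borel" unfolding F_def by measurable
  have "integrable \<mu> F" unfolding F_def by (rule translate_integrable[OF f])
  then have "integrable (distr (\<mu> \<Otimes>\<^sub>M kern t) borel ?Z) F" by (simp only: mu_invariant[OF t])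
  then have I: "integrable (\<mu> \<Otimes>\<^sub>M kern t) (\<lambda>p. F (?Z p))"
    by (subst (asm) integrable_distr_eq) (simp_all add: split_def)
  have "smooth (T t f) \<zeta> = (\<integral>x. (\<integral>y. F (?Z (x, y)) \<partial>kern t) \<partial>\<mu>)"
    by (simp add: smooth_def semigroup_eq[OF t] F_def flow_plus algebra_simps)
  also have "\<dots> = (\<integral>p. F (?Z p) \<partial>(\<mu> \<Otimes>\<^sub>M kern t))"
    by (rule P.integral_fst'[OF I])
  also have "\<dots> = (\<integral>z. F z \<partial>distr (\<mu> \<Otimes>\<^sub>M kern t) borel ?Z)"
    by (subst integral_distr) (simp_all add: split_def)
  also have "\<dots> = smooth f (flow c t \<zeta>)"
    by (simp add: mu_invariant[OF t] F_def smooth_def)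
  finally show ?thesis .
qed simp

lemma bounded_Borel_L2: "f \<in> bounded_Borel \<Longrightarrow> f \<in> L2 \<mu>"
proof -
  assume f: "f \<in> bounded_Borel"
  then obtain C where C: "\<And>x. \<bar>f x\<bar> \<le> C" by (auto simp: bounded_Borel_def bounded_iff)
  then have "f \<in> exp_bounded" using f by (intro exp_boundedI[of _ C 0]) (auto simp: bounded_Borel_def)
  then show "f \<in> L2 \<mu>" by (rule exp_bounded_L2)
qed

lemma truncation:
  assumes f: "f \<in> L2 \<mu>"
  obtains \<phi> :: "nat \<Rightarrow> real ^ 3 \<Rightarrow> real" where "\<And>i. \<phi> i \<in> bounded_Borel"
    "(\<lambda>i. L2_norm_sq \<mu> (\<lambda>x. \<phi> i x - f x)) \<longlonglongrightarrow> 0"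
proof
  define \<phi> where "\<phi> i x = (if \<bar>f x\<bar> \<le> real i then f x else 0)" for i :: nat and x
  have [measurable]: "f \<in> borel_measurable borel" by (rule L2_measurable[OF f])
  have [measurable]: "\<phi> i \<in> borel_measurable borel" for i unfolding \<phi>_def by measurable
  show "\<phi> i \<in> bounded_Borel" for i
    by (auto simp: bounded_Borel_def \<phi>_def intro!: boundedI[of _ "real i"])
  have "(\<lambda>i. \<integral>\<^sup>+x. ennreal ((\<phi> i x - f x)\<^sup>2) \<partial>\<mu>) \<longlonglongrightarrow> (\<integral>\<^sup>+x. 0 \<partial>\<mu>)"
  proof (rule nn_integral_dominated_convergence[where w = "\<lambda>x. ennreal ((f x)\<^sup>2)"])
    show "(\<integral>\<^sup>+x. ennreal ((f x)\<^sup>2) \<partial>\<mu>) < \<infinity>"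
      using L2_norm_sq_eq[OF f] by (simp add: L2_norm_sq_def)
    show "AE x in \<mu>. (\<lambda>i. ennreal ((\<phi> i x - f x)\<^sup>2)) \<longlonglongrightarrow> 0"
    proof (rule AE_I2)
      fix x
      obtain n where "\<bar>f x\<bar> \<le> real n" using real_arch_simple by blast
      then show "(\<lambda>i. ennreal ((\<phi> i x - f x)\<^sup>2)) \<longlonglongrightarrow> 0"
        by (intro tendsto_eventually eventually_sequentiallyI[of n]) (auto simp: \<phi>_def)
    qed
    show "AE x in \<mu>. ennreal ((\<phi> i x - f x)\<^sup>2) \<le> ennreal ((f x)\<^sup>2)" for i
      by (auto simp: \<phi>_def intro!: ennreal_leI)
  qed simp_all
  then show "(\<lambda>i. L2_norm_sq \<mu> (\<lambda>x. \<phi> i x - f x)) \<longlonglongrightarrow> 0"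
    by (simp add: L2_norm_sq_def)
qed

lemma T_approx:
  assumes "t \<ge> 0" and f: "f \<in> L2 \<mu>" and \<phi>: "\<And>i. \<phi> i \<in> bounded_Borel"
    and lim: "(\<lambda>i. L2_norm_sq \<mu> (\<lambda>x. \<phi> i x - f x)) \<longlonglongrightarrow> 0"
  shows "(\<lambda>i::nat. L2_norm_sq \<mu> (\<lambda>x. T t (\<phi> i) x - T t f x)) \<longlonglongrightarrow> 0"
proof (rule tendsto_sandwich[OF always_eventually always_eventually tendsto_const lim])
  show "\<forall>i. 0 \<le> L2_norm_sq \<mu> (\<lambda>x. T t (\<phi> i) x - T t f x)" by simp
  show "\<forall>i. L2_norm_sq \<mu> (\<lambda>x. T t (\<phi> i) x - T t f x) \<le> L2_norm_sq \<mu> (\<lambda>x. \<phi> i x - f x)"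
  proof
    fix i
    have pL: "\<phi> i \<in> L2 \<mu>" by (rule bounded_Borel_L2[OF \<phi>])
    have "L2_norm_sq \<mu> (\<lambda>x. T t (\<phi> i) x - T t f x) = L2_norm_sq \<mu> (T t (\<lambda>x. \<phi> i x - f x))"
      by (rule L2_norm_sq_cong_AE) (use T_diff[OF assms(1) pL f] in auto)
    also have "\<dots> \<le> L2_norm_sq \<mu> (\<lambda>x. \<phi> i x - f x)"
      by (rule T_contraction[OF assms(1) L2_measurable[OF L2_diff[OF pL f]]])
    finally show "L2_norm_sq \<mu> (\<lambda>x. T t (\<phi> i) x - T t f x) \<le> L2_norm_sq \<mu> (\<lambda>x. \<phi> i x - f x)" .
  qed
qed

text \<open>The integral formula for the semigroup, applied to \<open>f\<close> itself, is an
  admissible value of the extension by continuity. The contraction property makes the limit the same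
  for every approximating sequence, so whichever representative is chosen agrees with it almost
  everywhere.\<close>

lemma OU_L2_AE:
  assumes t: "t \<ge> 0" and f: "f \<in> L2 \<mu>"
  shows "AE x in \<mu>. OU_L2 c \<sigma> \<mu> t f x = T t f x"
proof -
  define P where "P g \<longleftrightarrow> g \<in> L2 \<mu> \<and>
        (\<exists>\<phi>. (\<forall>i::nat. \<phi> i \<in> bounded_Borel) \<and>
             (\<lambda>i. L2_norm_sq \<mu> (\<lambda>x. \<phi> i x - f x)) \<longlonglongrightarrow> 0 \<and>
             (\<lambda>i. L2_norm_sq \<mu> (\<lambda>x. T t (\<phi> i) x - g x)) \<longlonglongrightarrow> 0)" for g
  obtain \<phi> where \<phi>: "\<And>i::nat. \<phi> i \<in> bounded_Borel" "(\<lambda>i. L2_norm_sq \<mu> (\<lambda>x. \<phi> i x - f x)) \<longlonglongrightarrow> 0"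
    using truncation[OF f] by blast
  have "P (T t f)"
    unfolding P_def using \<phi> T_approx[OF t f \<phi>] T_L2[OF t f] by blast
  then have "P (OU_L2 c \<sigma> \<mu> t f)"
    unfolding OU_L2_def P_def[symmetric] by (rule someI[of P])
  then obtain \<psi> where g: "OU_L2 c \<sigma> \<mu> t f \<in> L2 \<mu>" and \<psi>: "\<And>i::nat. \<psi> i \<in> bounded_Borel"
    "(\<lambda>i. L2_norm_sq \<mu> (\<lambda>x. \<psi> i x - f x)) \<longlonglongrightarrow> 0"
    "(\<lambda>i. L2_norm_sq \<mu> (\<lambda>x. T t (\<psi> i) x - OU_L2 c \<sigma> \<mu> t f x)) \<longlonglongrightarrow> 0"
    unfolding P_def by blast
  show ?thesis
  proof (rule L2_norm_sq_limit_unique[OF _ _ _ _ \<psi>(3) T_approx[OF t f \<psi>(1,2)]])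
    show "T t (\<psi> i) \<in> borel_measurable \<mu>" for i
      using T_measurable[OF t, of "\<psi> i"] \<psi>(1)[of i] by (auto simp: bounded_Borel_def)
    show "OU_L2 c \<sigma> \<mu> t f \<in> borel_measurable \<mu>" "T t f \<in> borel_measurable \<mu>"
      using g T_L2[OF t f] by (auto simp: L2_def)
  qed simp
qed

section \<open>The generator and the derivative along the flow\<close>

abbreviation "gen_rel \<equiv> OU_gen_rel c \<sigma> \<mu>"

lemma gen_rel_iff:
  "gen_rel f g \<longleftrightarrow> f \<in> L2 \<mu> \<and> g \<in> L2 \<mu> \<and>
     ((\<lambda>t. L2_norm_sq \<mu> (\<lambda>x. (T t f x - f x) / t - g x)) \<longlongrightarrow> 0) (at_right 0)"
proof -
  have "((\<lambda>t. L2_norm_sq \<mu> (\<lambda>x. (OU_L2 c \<sigma> \<mu> t f x - f x) / t - g x)) \<longlongrightarrow> 0) (at_right 0) \<longleftrightarrow>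
     ((\<lambda>t. L2_norm_sq \<mu> (\<lambda>x. (T t f x - f x) / t - g x)) \<longlongrightarrow> 0) (at_right 0)" if "f \<in> L2 \<mu>"
  proof (rule tendsto_cong, rule eventually_at_right_less[THEN eventually_mono])
    fix t :: real assume "0 < t"
    then have "AE x in \<mu>. OU_L2 c \<sigma> \<mu> t f x = T t f x" using that by (intro OU_L2_AE) auto
    then show "L2_norm_sq \<mu> (\<lambda>x. (OU_L2 c \<sigma> \<mu> t f x - f x) / t - g x) = L2_norm_sq \<mu> (\<lambda>x. (T t f x - f x) / t - g x)"
      by (intro L2_norm_sq_cong_AE) auto
  qed
  then show ?thesis unfolding OU_gen_rel_def by blast
qed

lemma gen_rel_L2: "gen_rel f g \<Longrightarrow> f \<in> L2 \<mu>" "gen_rel f g \<Longrightarrow> g \<in> L2 \<mu>"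
  by (simp_all add: OU_gen_rel_def)

lemma gen_rel_cong:
  assumes "gen_rel f g" "f' \<in> L2 \<mu>" "g' \<in> L2 \<mu>" "AE x in \<mu>. f x = f' x" "AE x in \<mu>. g x = g' x"
  shows "gen_rel f' g'"
proof -
  have "L2_norm_sq \<mu> (\<lambda>x. \<phi> x - f x) = L2_norm_sq \<mu> (\<lambda>x. \<phi> x - f' x)" for \<phi>
    by (rule L2_norm_sq_cong_AE) (use assms(4) in auto)
  \<comment> \<open>The description under the choice operator involves \<open>f\<close> only through
    L2 distances; hence the two chosen functions are identical, not merely equal almost
    everywhere.\<close>
  then have eq: "OU_L2 c \<sigma> \<mu> t f = OU_L2 c \<sigma> \<mu> t f'" for t
    by (simp add: OU_L2_def)
  have "L2_norm_sq \<mu> (\<lambda>x. (OU_L2 c \<sigma> \<mu> t f x - f x) / t - g x) =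
     L2_norm_sq \<mu> (\<lambda>x. (OU_L2 c \<sigma> \<mu> t f' x - f' x) / t - g' x)" for t
    unfolding eq by (rule L2_norm_sq_cong_AE) (use assms(4,5) in auto)
  then show ?thesis using assms by (simp add: OU_gen_rel_def)
qed

lemma gen_rel_unique:
  assumes "gen_rel f g" "gen_rel f g'"
  shows "AE x in \<mu>. g x = g' x"
proof -
  have f: "f \<in> L2 \<mu>" by (rule gen_rel_L2[OF assms(1)])
  \<comment> \<open>The value 0 at negative times makes every member of the family measurable, as
    the uniqueness of limits requires; the limit itself sees positive times only.\<close>
  define \<phi> where "\<phi> t x = (if t \<ge> 0 then (T t f x - f x) / t else 0)" for t x
  have ev: "eventually (\<lambda>t. L2_norm_sq \<mu> (\<lambda>x. (T t f x - f x) / t - h x) = L2_norm_sq \<mu> (\<lambda>x. \<phi> t x - h x)) (at_right 0)" for h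
    by (rule eventually_at_right_less[THEN eventually_mono]) (simp add: \<phi>_def)
  show ?thesis
  proof (rule L2_norm_sq_limit_unique[of "at_right 0" \<phi>])
    show "\<phi> t \<in> borel_measurable \<mu>" for t
      using T_L2[OF _ f, of t] f unfolding \<phi>_def L2_def by (cases "t \<ge> 0") auto
    show "((\<lambda>t. L2_norm_sq \<mu> (\<lambda>x. \<phi> t x - g x)) \<longlongrightarrow> 0) (at_right 0)"
      using assms(1) unfolding gen_rel_iff by (simp add: tendsto_cong[OF ev])
    show "((\<lambda>t. L2_norm_sq \<mu> (\<lambda>x. \<phi> t x - g' x)) \<longlongrightarrow> 0) (at_right 0)"
      using assms(2) unfolding gen_rel_iff by (simp add: tendsto_cong[OF ev])
  qed (use gen_rel_L2[OF assms(1)] gen_rel_L2[OF assms(2)] in \<open>auto simp: L2_def\<close>)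
qed

lemma OU_dom_gen: "f \<in> OU_dom c \<sigma> \<mu> \<Longrightarrow> gen_rel f (OU_gen c \<sigma> \<mu> f)"
  using someI_ex[of "gen_rel f"] unfolding OU_dom_def OU_gen_def by simp

lemma flow_continuous: "isCont (\<lambda>s. flow c s \<zeta>) s"
proof -
  have "shear s \<zeta> = \<zeta> + s *\<^sub>R vector [\<zeta> $ 2, \<zeta> $ 3, 0] + (s\<^sup>2 / 2) *\<^sub>R vector [\<zeta> $ 3, 0, 0]" for s
    by (simp add: vec_eq_iff forall_3)
  then show ?thesis unfolding flow_def by (simp only:) (intro continuous_intros, simp_all)
qed

text \<open>By \<open>smooth_T\<close> the difference quotients of the semigroup become those of
  \<open>u\<close>, and \<open>smooth_bound\<close> turns convergence in L2 into convergence at each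
  point of the flow line. This yields the right derivative.\<close>

lemma gen_flow_deriv:
  assumes "gen_rel f g"
  shows "((\<lambda>s. smooth f (flow c s \<zeta>)) has_real_derivative smooth g (flow c s \<zeta>)) (at s)"
proof -
  have f: "f \<in> L2 \<mu>" and g: "g \<in> L2 \<mu>" using gen_rel_L2[OF assms] by auto
  define u where "u s = smooth f (flow c s \<zeta>)" for s
  define v where "v s = smooth g (flow c s \<zeta>)" for s
  define d where "d t x = (T t f x - f x) / t - g x" for t x
  define N where "N t = (\<integral>x. (d t x)\<^sup>2 \<partial>\<mu>)" for t
  define q where "q s = exp (2 * ((cov *v eta (flow c s \<zeta>)) \<bullet> eta (flow c s \<zeta>)))" for s
  have dL2: "d t \<in> L2 \<mu>" if "t > 0" for t
    unfolding d_def divide_inverse using that L2_scale[OF L2_diff[OF T_L2[OF _ f, of t] f], of "inverse t"]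
    by (intro L2_diff g) (simp_all add: mult.commute)
  have N0: "(N \<longlongrightarrow> 0) (at_right 0)"
  proof (rule tendsto_ennrealD)
    have "((\<lambda>t. L2_norm_sq \<mu> (d t)) \<longlongrightarrow> 0) (at_right 0)"
      using assms unfolding gen_rel_iff d_def by simp
    moreover have "eventually (\<lambda>t. L2_norm_sq \<mu> (d t) = ennreal (N t)) (at_right 0)"
      by (rule eventually_at_right_less[THEN eventually_mono]) (simp add: L2_norm_sq_eq[OF dL2] N_def)
    ultimately show "((\<lambda>t. ennreal (N t)) \<longlongrightarrow> ennreal 0) (at_right 0)"
      by (simp add: tendsto_cong)
    show "eventually (\<lambda>t. 0 \<le> N t) (at_right 0)"
      by (intro always_eventually) (simp add: N_def)
  qed simp
  have est: "\<bar>(u (s + t) - u s) / t - v s\<bar> \<le> sqrt (N t * q s)" if t: "t > 0" for s t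
  proof -
    have "smooth (d t) (flow c s \<zeta>) = smooth (\<lambda>x. (1 / t) * (T t f x - f x)) (flow c s \<zeta>) - v s"
      unfolding d_def v_def
      using smooth_diff[OF L2_scale[OF L2_diff[OF T_L2[OF _ f, of t] f], of "1 / t"] g] t by simp
    also have "smooth (\<lambda>x. (1 / t) * (T t f x - f x)) (flow c s \<zeta>) = (u (s + t) - u s) / t"
      unfolding smooth_scale u_def
      using t smooth_diff[OF T_L2[OF _ f, of t] f] by (simp add: smooth_T[OF _ f] flow_add add.commute)
    finally have "((u (s + t) - u s) / t - v s)\<^sup>2 \<le> N t * q s"
      using smooth_bound[OF dL2[OF t], of "flow c s \<zeta>"] by (simp add: N_def q_def)
    then show ?thesis by (simp add: real_le_rsqrt flip: real_sqrt_abs)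
  qed
  have qc: "isCont q s"
    unfolding q_def
    by (intro continuous_intros isCont_o2[OF flow_continuous isCont_eta] isCont_o2[OF flow_continuous isCont_cov])
  have vc: "isCont v s"
    unfolding v_def by (rule isCont_o2[OF flow_continuous isCont_smooth[OF g]])
  have right: "((\<lambda>h. (u (s + h) - u s) / h) \<longlongrightarrow> v s) (at_right 0)"
  proof -
    have "((\<lambda>t. sqrt (N t * q s)) \<longlongrightarrow> sqrt (0 * q s)) (at_right 0)"
      by (intro tendsto_intros N0)
    then have lim: "((\<lambda>t. sqrt (N t * q s)) \<longlongrightarrow> 0) (at_right 0)" by simp
    have "eventually (\<lambda>h. norm ((u (s + h) - u s) / h - v s) \<le> sqrt (N h * q s)) (at_right 0)"
      by (rule eventually_at_right_less[THEN eventually_mono]) (use est in \<open>simp only: real_norm_def\<close>)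
    from Lim_null_comparison[OF this lim] have "((\<lambda>h. (u (s + h) - u s) / h - v s) \<longlongrightarrow> 0) (at_right 0)" .
    then show ?thesis by (simp add: LIM_zero_iff)
  qed
  \<comment> \<open>The semigroup does not run backwards, so the forward estimate is used with
    starting point \<open>s - h\<close>. Continuity of \<open>q\<close> and \<open>v\<close> then
    moves the starting point to \<open>s\<close>.\<close>
  have left: "((\<lambda>h. (u (s + h) - u s) / h) \<longlongrightarrow> v s) (at_left 0)"
  proof -
    have m: "((\<lambda>h. s - h) \<longlongrightarrow> s) (at_right 0)"
      by (rule tendsto_eq_intros tendsto_ident_at refl | simp)+
    have q: "((\<lambda>h. q (s - h)) \<longlongrightarrow> q s) (at_right 0)" by (rule isCont_tendsto_compose[OF qc m])
    have v: "((\<lambda>h. v (s - h)) \<longlongrightarrow> v s) (at_right 0)" by (rule isCont_tendsto_compose[OF vc m])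
    have "((\<lambda>t. sqrt (N t * q (s - t))) \<longlongrightarrow> sqrt (0 * q s)) (at_right 0)"
      by (intro tendsto_intros N0 q)
    then have lim: "((\<lambda>t. sqrt (N t * q (s - t))) \<longlongrightarrow> 0) (at_right 0)" by simp
    have "eventually (\<lambda>h. norm ((u s - u (s - h)) / h - v (s - h)) \<le> sqrt (N h * q (s - h))) (at_right 0)"
    proof (rule eventually_at_right_less[THEN eventually_mono])
      fix h :: real assume "0 < h"
      from est[OF this, of "s - h"] show "norm ((u s - u (s - h)) / h - v (s - h)) \<le> sqrt (N h * q (s - h))"
        by (simp only: real_norm_def diff_add_cancel)
    qed
    from Lim_null_comparison[OF this lim]
    have "((\<lambda>h. (u s - u (s - h)) / h - v (s - h)) \<longlongrightarrow> 0) (at_right 0)" .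
    from tendsto_add[OF this v] have "((\<lambda>h. (u s - u (s - h)) / h) \<longlongrightarrow> v s) (at_right 0)" by simp
    moreover have "(u (s + - h) - u s) / - h = (u s - u (s - h)) / h" for h
      by (simp add: minus_divide_right[symmetric] minus_divide_left)
    ultimately show ?thesis
      by (subst filterlim_at_left_to_right) simp
  qed
  have "((\<lambda>h. (u (s + h) - u s) / h) \<longlongrightarrow> v s) (at 0)"
    using left right by (simp add: filterlim_at_split)
  then show ?thesis by (simp add: DERIV_def u_def v_def)
qed

end

section \<open>Polynomial Jordan chains of the generator\<close>

lemma exp_bounded_translate:
  assumes "f \<in> exp_bounded"
  shows "(\<lambda>x. f (x + \<zeta>)) \<in> exp_bounded"
proof -
  note [measurable] = exp_bounded_measurable[OF assms]
  obtain C a where Ca: "C \<ge> 0" "a \<ge> 0" "\<And>x. \<bar>f x\<bar> \<le> C * exp (a * norm x)" using assms by (rule exp_boundedE) blast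
  have "\<bar>f (x + \<zeta>)\<bar> \<le> C * exp (a * norm \<zeta>) * exp (a * norm x)" for x
  proof -
    have "a * norm (x + \<zeta>) \<le> a * norm \<zeta> + a * norm x"
      using mult_left_mono[OF norm_triangle_ineq[of x \<zeta>] Ca(2)] by (simp add: algebra_simps)
    then have "C * exp (a * norm (x + \<zeta>)) \<le> C * (exp (a * norm \<zeta>) * exp (a * norm x))"
      using Ca(1) by (intro mult_left_mono) (simp_all flip: exp_add)
    then show ?thesis using Ca(3)[of "x + \<zeta>"] by (simp add: mult.assoc)
  qed
  then show ?thesis by (intro exp_boundedI) simp_all
qed

lemma L2_norm_sq_scale: "L2_norm_sq M (\<lambda>x. a * f x) = ennreal (a\<^sup>2) * L2_norm_sq M f"
  if "f \<in> borel_measurable M"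
  unfolding L2_norm_sq_def using that
  by (simp add: power_mult_distrib ennreal_mult nn_integral_cmult)

text \<open>For finite combinations of fixed functions with coefficients depending on
  \<open>t\<close>, this reduces convergence in L2 to limits of scalars.\<close>

lemma L2_norm_sq_sum_tendsto:
  assumes "finite I" "\<And>i. i \<in> I \<Longrightarrow> f i \<in> L2 M" "\<And>i. i \<in> I \<Longrightarrow> ((\<lambda>t. a i t) \<longlongrightarrow> 0) F"
  shows "((\<lambda>t. L2_norm_sq M (\<lambda>x. \<Sum>i\<in>I. a i t * f i x)) \<longlongrightarrow> 0) F"
  using assms
proof (induction I rule: finite_induct)
  case empty
  then show ?case by (simp add: L2_norm_sq_def)
next
  case (insert j I)
  have fj: "f j \<in> L2 M" using insert.prems by simp
  have S: "(\<lambda>x. \<Sum>i\<in>I. a i t * f i x) \<in> L2 M" for t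
    using insert.prems by (intro L2_sum L2_scale) auto
  have bound: "L2_norm_sq M (\<lambda>x. \<Sum>i\<in>insert j I. a i t * f i x) \<le>
      2 * L2_norm_sq M (\<lambda>x. a j t * f j x) + 2 * L2_norm_sq M (\<lambda>x. \<Sum>i\<in>I. a i t * f i x)" for t
  proof -
    have "L2_norm_sq M (\<lambda>x. a j t * f j x - (- 1) * (\<Sum>i\<in>I. a i t * f i x)) \<le>
      2 * L2_norm_sq M (\<lambda>x. a j t * f j x) + 2 * L2_norm_sq M (\<lambda>x. (- 1) * (\<Sum>i\<in>I. a i t * f i x))"
      using L2_scale[OF fj, of "a j t"] L2_scale[OF S, of "- 1"] by (intro L2_norm_sq_triangle) (auto simp: L2_def)
    moreover have "L2_norm_sq M (\<lambda>x. (- 1) * (\<Sum>i\<in>I. a i t * f i x)) = L2_norm_sq M (\<lambda>x. \<Sum>i\<in>I. a i t * f i x)"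
      using S[of t] by (subst L2_norm_sq_scale) (auto simp: L2_def)
    ultimately show ?thesis using insert.hyps by simp
  qed
  have "((\<lambda>t. ennreal ((a j t)\<^sup>2 * (\<integral>x. (f j x)\<^sup>2 \<partial>M))) \<longlongrightarrow> ennreal (0\<^sup>2 * (\<integral>x. (f j x)\<^sup>2 \<partial>M))) F"
    using insert.prems by (intro tendsto_ennrealI tendsto_mult tendsto_power tendsto_const) auto
  moreover have "L2_norm_sq M (\<lambda>x. a j t * f j x) = ennreal ((a j t)\<^sup>2 * (\<integral>x. (f j x)\<^sup>2 \<partial>M))" for t
    using fj by (subst L2_norm_sq_scale) (auto simp: L2_def L2_norm_sq_eq ennreal_mult')
  ultimately have "((\<lambda>t. L2_norm_sq M (\<lambda>x. a j t * f j x)) \<longlongrightarrow> 0) F" by simp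
  moreover have "((\<lambda>t. L2_norm_sq M (\<lambda>x. \<Sum>i\<in>I. a i t * f i x)) \<longlongrightarrow> 0) F"
    using insert by auto
  ultimately have "((\<lambda>t. 2 * L2_norm_sq M (\<lambda>x. a j t * f j x) + 2 * L2_norm_sq M (\<lambda>x. \<Sum>i\<in>I. a i t * f i x)) \<longlongrightarrow> 2 * 0 + 2 * 0) F"
    by (intro tendsto_add ennreal_tendsto_cmult) simp_all
  then have lim: "((\<lambda>t. 2 * L2_norm_sq M (\<lambda>x. a j t * f j x) + 2 * L2_norm_sq M (\<lambda>x. \<Sum>i\<in>I. a i t * f i x)) \<longlongrightarrow> 0) F"
    by simp
  show ?case
    by (rule tendsto_sandwich[OF always_eventually always_eventually tendsto_const lim]) (simp, use bound in blast)
qed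

context OU_process
begin

lemma lpoly_L2: "p \<in> lpoly n \<Longrightarrow> p \<in> L2 \<mu>"
  by (intro exp_bounded_L2 exp_bounded_lpoly)

text \<open>The weight \<open>e\<close> makes the induction on the degree work: it absorbs a factor \<open>x\<^sub>a\<close>.\<close>

lemma weighted_translate_monom3:
  assumes "i + j + k = d" "e \<in> exp_bounded"
  shows "(\<lambda>\<zeta>. (\<integral>x. monom3 i j k (x + \<zeta>) * e x \<partial>\<mu>) - (\<integral>x. e x \<partial>\<mu>) * monom3 i j k \<zeta>) \<in> lpoly d"
  using assms
proof (induction d arbitrary: i j k e)
  case 0
  then have "monom3 i j k = (\<lambda>v. 1)" by (auto simp: monom3_def)
  then show ?case by (simp add: lpoly_zero)
next
  case (Suc d)
  obtain a i' j' k' where d: "i' + j' + k' = d" and M: "monom3 i j k = (\<lambda>v. v $ a * monom3 i' j' k' v)"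
    by (rule monom3_cases[OF Suc.prems(1)])
  let ?M = "monom3 i' j' k'"
  define I where "I e \<zeta> = (\<integral>x. ?M (x + \<zeta>) * e x \<partial>\<mu>)" for e \<zeta>
  define m where "m e = (\<integral>x. e x \<partial>\<mu>)" for e :: "real ^ 3 \<Rightarrow> real"
  have xe: "(\<lambda>x. x $ a * e x) \<in> exp_bounded" by (intro exp_bounded_mult exp_bounded_nth Suc.prems)
  have int: "integrable \<mu> (\<lambda>x. ?M (x + \<zeta>) * e x)" if "e \<in> exp_bounded" for e \<zeta>
    using that by (intro exp_bounded_integrable exp_bounded_mult exp_bounded_translate[OF exp_bounded_monom3])
  have IH: "(\<lambda>\<zeta>. I e \<zeta> - m e * ?M \<zeta>) \<in> lpoly d" if "e \<in> exp_bounded" for e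
    unfolding I_def m_def by (rule Suc.IH[OF d that])
  have "(\<integral>x. monom3 i j k (x + \<zeta>) * e x \<partial>\<mu>) = I (\<lambda>x. x $ a * e x) \<zeta> + \<zeta> $ a * I e \<zeta>" for \<zeta>
  proof -
    have "(\<integral>x. monom3 i j k (x + \<zeta>) * e x \<partial>\<mu>) =
        (\<integral>x. ?M (x + \<zeta>) * (x $ a * e x) + \<zeta> $ a * (?M (x + \<zeta>) * e x) \<partial>\<mu>)"
      by (rule Bochner_Integration.integral_cong) (simp_all add: M algebra_simps)
    also have "\<dots> = I (\<lambda>x. x $ a * e x) \<zeta> + \<zeta> $ a * I e \<zeta>"
      unfolding I_def using int[OF xe] int[OF Suc.prems(2)] by simp
    finally show ?thesis .
  qed
  then have "(\<lambda>\<zeta>. (\<integral>x. monom3 i j k (x + \<zeta>) * e x \<partial>\<mu>) - m e * monom3 i j k \<zeta>) =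
     (\<lambda>\<zeta>. (I (\<lambda>x. x $ a * e x) \<zeta> - m (\<lambda>x. x $ a * e x) * ?M \<zeta>) + m (\<lambda>x. x $ a * e x) * ?M \<zeta>
        + (\<zeta> $ a) * (I e \<zeta> - m e * ?M \<zeta>))"
    by (auto simp: M algebra_simps)
  also have "\<dots> \<in> lpoly (Suc d)"
  proof (intro lpoly_add)
    show "(\<lambda>\<zeta>. I (\<lambda>x. x $ a * e x) \<zeta> - m (\<lambda>x. x $ a * e x) * ?M \<zeta>) \<in> lpoly (Suc d)"
      by (rule lpoly_le[OF IH[OF xe]]) simp
    show "(\<lambda>\<zeta>. m (\<lambda>x. x $ a * e x) * ?M \<zeta>) \<in> lpoly (Suc d)"
      using d by (intro lpoly_scale monom3_lpoly) simp
    have "(\<lambda>\<zeta>. \<zeta> $ a) \<in> lpoly (Suc 1)" by (rule hpoly_lpoly[OF hpoly_nth]) simp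
    from lpoly_mult[OF IH[OF Suc.prems(2)] this]
    show "(\<lambda>\<zeta>. \<zeta> $ a * (I e \<zeta> - m e * ?M \<zeta>)) \<in> lpoly (Suc d)" by (simp add: mult.commute)
  qed
  finally show ?case by (simp add: m_def)
qed

lemma smooth_lpoly:
  assumes "p \<in> lpoly (Suc n)"
  shows "(\<lambda>\<zeta>. smooth p \<zeta> - p \<zeta>) \<in> lpoly n"
proof -
  from assms have "p \<in> L2 \<mu> \<and> (\<lambda>\<zeta>. smooth p \<zeta> - p \<zeta>) \<in> lpoly n"
    unfolding lpoly_def[of "Suc n"]
  proof induction
    case zero
    then show ?case by (simp add: L2_zero lpoly_zero)
  next
    case (add_base f g a)
    then obtain i j k where g: "g = monom3 i j k" and n: "i + j + k < Suc n" by blast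
    have gL: "(\<lambda>x. a * g x) \<in> L2 \<mu>" unfolding g by (intro L2_scale exp_bounded_L2 exp_bounded_monom3)
    have "(\<lambda>\<zeta>. smooth g \<zeta> - g \<zeta>) \<in> lpoly n"
      using lpoly_le[OF weighted_translate_monom3[OF refl exp_bounded_const[of 1], of i j k], of n] n
      by (simp add: g smooth_def mu.prob_space[unfolded space_mu])
    from lpoly_add[OF conjunct2[OF add_base.IH] lpoly_scale[OF this, of a]]
    have "(\<lambda>\<zeta>. smooth (\<lambda>x. f x + a * g x) \<zeta> - (f \<zeta> + a * g \<zeta>)) \<in> lpoly n"
      using add_base.IH gL by (simp add: smooth_add smooth_scale algebra_simps)
    then show ?case using add_base.IH gL by (auto intro: L2_add)
  qed
  then show ?thesis ..
qed

text \<open>On polynomials, smoothing is the identity plus a map that lowers the degree. If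
  \<open>g\<close> is a preimage of \<open>smooth p - p\<close>, which exists by induction, then
  \<open>p - g\<close> is a preimage of \<open>p\<close>.\<close>

lemma smooth_surj_aux: "p \<in> lpoly n \<Longrightarrow> \<exists>f\<in>lpoly n. smooth f = p"
proof (induction n arbitrary: p)
  case 0
  then have "p = (\<lambda>v. 0)" unfolding lpoly_def by (induction rule: lspan.induct) auto
  then show ?case by (intro bexI[of _ "\<lambda>v. 0"]) (auto simp: lpoly_zero)
next
  case (Suc n)
  from Suc.IH[OF smooth_lpoly[OF Suc.prems]] obtain g where g: "g \<in> lpoly n" "smooth g = (\<lambda>\<zeta>. smooth p \<zeta> - p \<zeta>)"
    by blast
  have "smooth (\<lambda>v. p v - g v) = p"
    using smooth_diff[OF lpoly_L2[OF Suc.prems] lpoly_L2[OF g(1)]] g(2) by auto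
  moreover have "(\<lambda>v. p v - g v) \<in> lpoly (Suc n)"
    using Suc.prems g(1) by (intro lpoly_diff lpoly_le[OF g(1)]) auto
  ultimately show ?case by blast
qed

lemma smooth_surj:
  assumes "p \<in> lpoly (Suc n)"
  obtains f where "f \<in> lpoly (Suc n)" "smooth f = p" "(\<lambda>v. f v - p v) \<in> lpoly n"
proof -
  obtain f where f: "f \<in> lpoly (Suc n)" "smooth f = p" using smooth_surj_aux[OF assms] by blast
  from lpoly_scale[OF smooth_lpoly[OF f(1)], of "- 1"] have "(\<lambda>v. f v - p v) \<in> lpoly n"
    by (simp add: f(2))
  with f that show thesis by blast
qed

section \<open>Lifting the chains to polynomials in the domain of the generator\<close>

definition chain_const :: "nat \<Rightarrow> nat \<Rightarrow> real" where
  "chain_const n k = fact (2 * (n - 2 * k)) / 2 ^ (n - 2 * k)"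

lemma chain_const_pos: "chain_const n k > 0" by (simp add: chain_const_def)

text \<open>Normalised so that \<open>\<gamma> - A\<close> shifts the index \<open>j\<close> (whence the signs) and the last member of the chain is
  exactly \<open>z\<^sup>m w\<^sup>k\<close>.\<close>

definition schain :: "nat \<Rightarrow> nat \<Rightarrow> nat \<Rightarrow> real ^ 3 \<Rightarrow> real" where
  "schain n k j v = (- 1) ^ j / chain_const n k * chain n k j v"

lemma schain_hpoly: "k \<le> n div 2 \<Longrightarrow> schain n k j \<in> hpoly n"
  unfolding schain_def[abs_def] by (intro hpoly_scale chain_hpoly)

lemma schain_top: "schain n k (2 * (n - 2 * k)) v = v $ 3 ^ (n - 2 * k) * disc v ^ k"
  using chain_const_pos[of n k] by (simp add: schain_def chain_top chain_const_def[symmetric])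

lemma schain_eq_0: "j > 2 * (n - 2 * k) \<Longrightarrow> schain n k j v = 0"
  by (simp add: schain_def chain_eq_0)

text \<open>The range is longer than that of \<open>chain_shear\<close> by one zero term, so that
  the index 1 is present even for n = 0 when the terms of order 0 and 1 in \<open>t\<close> are
  split off.\<close>

lemma schain_flow:
  assumes "k \<le> n div 2"
  shows "schain n k j (flow c t v) =
     (\<Sum>i\<le>2 * n + 1. exp (- (real n * c * t)) * ((- t) ^ i / fact i) * schain n k (j + i) v)"
proof -
  have "schain n k j (flow c t v) = exp (- (c * t)) ^ n * schain n k j (shear t v)"
    unfolding flow_def by (rule hpoly_homogeneous[OF schain_hpoly[OF assms]])
  also have "exp (- (c * t)) ^ n = exp (- (real n * c * t))"
    by (simp flip: exp_of_nat_mult)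
  also have "schain n k j (shear t v) = (\<Sum>i\<le>2 * n. (- t) ^ i / fact i * schain n k (j + i) v)"
  proof -
    have sgn: "(- 1) ^ j * t ^ i = (- t) ^ i * (- 1) ^ (j + i)" for i
    proof -
      have "(- t) ^ i * (- 1) ^ (j + i) = ((- 1) ^ i * (- 1) ^ i) * ((- 1) ^ j * t ^ i)"
        by (simp only: power_minus[of t] power_add mult_ac)
      moreover have "(- 1) ^ i * (- 1) ^ i = (1 :: real)"
        by (simp flip: power_mult_distrib)
      ultimately show ?thesis by simp
    qed
    have "(- 1) ^ j / chain_const n k * (t ^ i / fact i * chain n k (j + i) v) =
       (- t) ^ i / fact i * ((- 1) ^ (j + i) / chain_const n k * chain n k (j + i) v)" for i
    proof -
      have "(- 1) ^ j / chain_const n k * (t ^ i / fact i * chain n k (j + i) v) =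
         ((- 1) ^ j * t ^ i) / (chain_const n k * fact i) * chain n k (j + i) v" by simp
      also have "\<dots> = (- t) ^ i / fact i * ((- 1) ^ (j + i) / chain_const n k * chain n k (j + i) v)"
        unfolding sgn by (simp add: mult_ac)
      finally show ?thesis .
    qed
    then show ?thesis by (simp only: schain_def chain_shear sum_distrib_left)
  qed
  also have "\<dots> = (\<Sum>i\<le>2 * n + 1. (- t) ^ i / fact i * schain n k (j + i) v)"
    by (simp add: schain_eq_0)
  finally show ?thesis by (simp only: sum_distrib_left mult.assoc)
qed

text \<open>The polynomial lift of \<open>schain\<close>. The members of a chain are chosen
  independently of each other; injectivity of \<open>smooth\<close> makes them fit together almost
  everywhere.\<close>

definition efun :: "nat \<Rightarrow> nat \<Rightarrow> nat \<Rightarrow> real ^ 3 \<Rightarrow> real" where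
  "efun n k j = (SOME f. f \<in> lpoly (Suc n) \<and> smooth f = schain n k j \<and> (\<lambda>v. f v - schain n k j v) \<in> lpoly n)"

lemma efun:
  assumes "k \<le> n div 2"
  shows efun_lpoly: "efun n k j \<in> lpoly (Suc n)"
    and smooth_efun: "smooth (efun n k j) = schain n k j"
    and efun_lead: "(\<lambda>v. efun n k j v - schain n k j v) \<in> lpoly n"
proof -
  have "schain n k j \<in> lpoly (Suc n)" by (rule hpoly_lpoly_Suc[OF schain_hpoly[OF assms]])
  then have "\<exists>f. f \<in> lpoly (Suc n) \<and> smooth f = schain n k j \<and> (\<lambda>v. f v - schain n k j v) \<in> lpoly n"
    by (rule smooth_surj) blast
  from someI_ex[OF this] show "efun n k j \<in> lpoly (Suc n)" "smooth (efun n k j) = schain n k j"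
    "(\<lambda>v. efun n k j v - schain n k j v) \<in> lpoly n"
    unfolding efun_def[symmetric] by auto
qed

lemma efun_L2: "k \<le> n div 2 \<Longrightarrow> efun n k j \<in> L2 \<mu>"
  by (rule lpoly_L2[OF efun_lpoly])

lemma smooth_eq_imp_AE_eq:
  assumes "f \<in> L2 \<mu>" "g \<in> L2 \<mu>" "\<And>\<zeta>. smooth f \<zeta> = smooth g \<zeta>"
  shows "AE x in \<mu>. f x = g x"
proof -
  have "AE x in \<mu>. f x - g x = 0"
    by (rule smooth_inj) (use assms in \<open>auto simp: smooth_diff L2_diff\<close>)
  then show ?thesis by auto
qed

text \<open>Both sides have the same smoothed function, namely the chain composed with the
  flow.\<close>

lemma T_efun:
  assumes k: "k \<le> n div 2" and t: "t \<ge> 0"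
  shows "AE x in \<mu>. T t (efun n k j) x =
     (\<Sum>i\<le>2 * n + 1. exp (- (real n * c * t)) * ((- t) ^ i / fact i) * efun n k (j + i) x)"
proof (rule smooth_eq_imp_AE_eq)
  have L: "(\<lambda>x. exp (- (real n * c * t)) * ((- t) ^ i / fact i) * efun n k (j + i) x) \<in> L2 \<mu>" for i
    by (intro L2_scale efun_L2 k)
  show "T t (efun n k j) \<in> L2 \<mu>" by (intro T_L2 t efun_L2 k)
  show "(\<lambda>x. \<Sum>i\<le>2 * n + 1. exp (- (real n * c * t)) * ((- t) ^ i / fact i) * efun n k (j + i) x) \<in> L2 \<mu>"
    by (intro L2_sum L)
  fix \<zeta>
  show "smooth (T t (efun n k j)) \<zeta> =
     smooth (\<lambda>x. \<Sum>i\<le>2 * n + 1. exp (- (real n * c * t)) * ((- t) ^ i / fact i) * efun n k (j + i) x) \<zeta>"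
    by (simp only: smooth_T[OF t efun_L2[OF k]] smooth_efun[OF k] schain_flow[OF k] smooth_sum[OF L] smooth_scale)
qed

lemma gen_rel_efun:
  assumes k: "k \<le> n div 2"
  shows "gen_rel (efun n k j) (\<lambda>x. - (real n * c) * efun n k j x - efun n k (j + 1) x)"
  unfolding gen_rel_iff
proof (intro conjI)
  let ?b = "real n * c" and ?f = "efun n k j" and ?g = "\<lambda>x. - (real n * c) * efun n k j x - efun n k (j + 1) x"
  show "?f \<in> L2 \<mu>" "?g \<in> L2 \<mu>" by (intro L2_diff L2_scale efun_L2 k)+
  \<comment> \<open>The coefficient of \<open>efun n k (j + i)\<close> in the difference quotient
    minus its supposed limit. The limit contributes to the indices 0 and 1 only; from index 2 on,
    the factor t^i beats the division by t.\<close>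
  define a where "a i t = (if i = 0 then (exp (- (?b * t)) - 1) / t + ?b
     else if i = 1 then 1 - exp (- (?b * t)) else exp (- (?b * t)) * ((- t) ^ i / fact i) / t)" for i :: nat and t
  have lim: "(a i \<longlongrightarrow> 0) (at_right 0)" for i
  proof -
    consider "i = 0" | "i = 1" | l where "i = Suc (Suc l)" by (metis One_nat_def not0_implies_Suc)
    then show ?thesis
    proof cases
      case 1
      have "((\<lambda>t. (exp (- (b * t)) - 1) / t + b) \<longlongrightarrow> 0) (at_right 0)" for b :: real
        by real_asymp
      then show ?thesis unfolding 1 a_def by simp
    next
      case 2
      have "((\<lambda>t. 1 - exp (- (b * t))) \<longlongrightarrow> 0) (at_right 0)" for b :: real
        by real_asymp
      then show ?thesis unfolding 2 a_def by simp
    next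
      case 3
      have "((\<lambda>t. exp (- (?b * t)) * (- ((- t) ^ Suc l) / fact i)) \<longlongrightarrow> exp (- (?b * 0)) * (- ((- 0) ^ Suc l) / fact i)) (at_right 0)"
        by (intro tendsto_intros) auto
      then have "((\<lambda>t. exp (- (?b * t)) * (- ((- t) ^ Suc l) / fact i)) \<longlongrightarrow> 0) (at_right 0)" by simp
      moreover have "eventually (\<lambda>t. exp (- (?b * t)) * (- ((- t) ^ Suc l) / fact i) = a i t) (at_right 0)"
        by (rule eventually_at_right_less[THEN eventually_mono]) (simp add: a_def 3)
      ultimately show ?thesis by (rule Lim_transform_eventually)
    qed
  qed
  have "((\<lambda>t. L2_norm_sq \<mu> (\<lambda>x. \<Sum>i\<le>2 * n + 1. a i t * efun n k (j + i) x)) \<longlongrightarrow> 0) (at_right 0)"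
    by (intro L2_norm_sq_sum_tendsto efun_L2 k lim) simp
  moreover have "eventually (\<lambda>t. L2_norm_sq \<mu> (\<lambda>x. \<Sum>i\<le>2 * n + 1. a i t * efun n k (j + i) x) =
      L2_norm_sq \<mu> (\<lambda>x. (T t ?f x - ?f x) / t - ?g x)) (at_right 0)"
  proof (rule eventually_at_right_less[THEN eventually_mono])
    fix t :: real assume t: "0 < t"
    have "AE x in \<mu>. (\<Sum>i\<le>2 * n + 1. a i t * efun n k (j + i) x) = (T t ?f x - ?f x) / t - ?g x"
      using T_efun[OF k less_imp_le[OF t], of j]
    proof eventually_elim
      case (elim x)
      define e where "e = exp (- (?b * t))"
      have sp: "(\<Sum>i\<le>2 * n + 1. h i) = h 0 + h 1 + (\<Sum>i\<in>{2..2 * n + 1}. h i)" for h :: "nat \<Rightarrow> real"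
      proof -
        have "{..2 * n + 1} = insert 0 (insert 1 {2..2 * n + 1})" by auto
        then show ?thesis by (simp add: add.assoc)
      qed
      define S where "S = (\<Sum>i\<in>{2..2 * n + 1}. e * ((- t) ^ i / fact i) * efun n k (j + i) x)"
      have 1: "(\<Sum>i\<in>{2..2 * n + 1}. a i t * efun n k (j + i) x) = S / t"
        unfolding sum_divide_distrib S_def by (rule sum.cong) (auto simp: a_def e_def)
      have 2: "T t ?f x = e * efun n k j x - e * t * efun n k (j + 1) x + S"
        using elim unfolding e_def[symmetric] sp S_def by simp
      have 3: "a 0 t = (e - 1) / t + ?b" "a 1 t = 1 - e"
        by (simp_all add: a_def e_def)
      show ?case
        unfolding sp 1 2 3 using t by (simp add: field_simps)
    qed
    then show "L2_norm_sq \<mu> (\<lambda>x. \<Sum>i\<le>2 * n + 1. a i t * efun n k (j + i) x) =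
      L2_norm_sq \<mu> (\<lambda>x. (T t ?f x - ?f x) / t - ?g x)"
      by (rule L2_norm_sq_cong_AE)
  qed
  ultimately show "((\<lambda>t. L2_norm_sq \<mu> (\<lambda>x. (T t ?f x - ?f x) / t - ?g x)) \<longlongrightarrow> 0) (at_right 0)"
    by (rule Lim_transform_eventually)
qed

text \<open>The generator returns an unspecified representative, so iterated shifts are known only
  almost everywhere. Membership in the domain and in \<open>L2\<close> is carried along so that
  \<open>gen_rel_cong\<close> can replace the iterate by the polynomial.\<close>

lemma shift_efun:
  assumes k: "k \<le> n div 2"
  shows "(OU_shift c \<sigma> \<mu> (- (real n * c)) ^^ j) (efun n k 0) \<in> OU_dom c \<sigma> \<mu> \<and>
     (OU_shift c \<sigma> \<mu> (- (real n * c)) ^^ j) (efun n k 0) \<in> L2 \<mu> \<and>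
     (AE x in \<mu>. (OU_shift c \<sigma> \<mu> (- (real n * c)) ^^ j) (efun n k 0) x = efun n k j x)"
proof (induction j)
  case 0
  then show ?case using gen_rel_efun[OF k, of 0] efun_L2[OF k, of 0] by (auto simp: OU_dom_def)
next
  case (Suc j)
  define f where "f = (OU_shift c \<sigma> \<mu> (- (real n * c)) ^^ j) (efun n k 0)"
  have f: "f \<in> OU_dom c \<sigma> \<mu>" "f \<in> L2 \<mu>" "AE x in \<mu>. f x = efun n k j x"
    using Suc by (auto simp: f_def)
  define h where "h = OU_shift c \<sigma> \<mu> (- (real n * c)) f"
  have gL: "OU_gen c \<sigma> \<mu> f \<in> L2 \<mu>" by (rule gen_rel_L2[OF OU_dom_gen[OF f(1)]])
  then have hL: "h \<in> L2 \<mu>" unfolding h_def OU_shift_def by (intro L2_diff L2_scale f)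
  have "gen_rel (efun n k j) (OU_gen c \<sigma> \<mu> f)"
    using f by (intro gen_rel_cong[OF OU_dom_gen[OF f(1)] _ gL] efun_L2 k) auto
  from gen_rel_unique[OF this gen_rel_efun[OF k]] f(3)
  have h: "AE x in \<mu>. h x = efun n k (j + 1) x"
    by eventually_elim (simp add: h_def OU_shift_def)
  have "gen_rel h (\<lambda>x. - (real n * c) * efun n k (j + 1) x - efun n k (j + 1 + 1) x)"
    by (rule gen_rel_cong[OF gen_rel_efun[OF k, of "j + 1"] hL]) (use h gen_rel_L2(2)[OF gen_rel_efun[OF k, of "j + 1"]] in auto)
  then have "h \<in> OU_dom c \<sigma> \<mu>" by (auto simp: OU_dom_def)
  then show ?case using h hL by (simp add: h_def f_def)
qed

end

section \<open>Generalised eigenfunctions are polynomials\<close>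

lemma pderiv_surj: "\<exists>q. pderiv q = (p :: real poly)"
proof -
  define q where "q = (\<Sum>i\<le>degree p. monom (coeff p i / real (Suc i)) (Suc i))"
  have "pderiv q = (\<Sum>i\<le>degree p. monom (coeff p i) i)"
  proof -
    have "pderiv (\<Sum>i\<in>I. f i) = (\<Sum>i\<in>I. pderiv (f i))" for f :: "nat \<Rightarrow> real poly" and I
      by (induction I rule: infinite_finite_induct) (simp_all add: pderiv_add)
    then show ?thesis unfolding q_def by (simp add: pderiv_monom del: of_nat_Suc)
  qed
  then show ?thesis by (auto simp: poly_as_sum_of_monoms)
qed

text \<open>Backwards from the zero function: after multiplication by exp (- \<gamma> s), the
  derivative of \<open>u j\<close> is minus the polynomial found for \<open>u (Suc j)\<close>, and
  integration keeps it polynomial.\<close>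

lemma exp_poly_ode:
  fixes u :: "nat \<Rightarrow> real \<Rightarrow> real"
  assumes deriv: "\<And>j s. j < m \<Longrightarrow> (u j has_real_derivative \<gamma> * u j s - u (Suc j) s) (at s)"
    and zero: "\<And>s. u m s = 0"
    and "j \<le> m"
  shows "\<exists>p. \<forall>s. u j s = exp (\<gamma> * s) * poly p s"
  using \<open>j \<le> m\<close>
proof (induction j rule: inc_induct)
  case base
  then show ?case by (intro exI[of _ 0]) (simp add: zero)
next
  case (step j)
  then obtain p where p: "\<And>s. u (Suc j) s = exp (\<gamma> * s) * poly p s" by blast
  obtain q where q: "pderiv q = - p" using pderiv_surj by blast
  define w where "w s = exp (- (\<gamma> * s)) * u j s - poly q s" for s
  have "(w has_real_derivative 0) (at s)" for s
  proof -
    have "(w has_real_derivative - \<gamma> * exp (- (\<gamma> * s)) * u j s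
        + exp (- (\<gamma> * s)) * (\<gamma> * u j s - u (Suc j) s) - poly (- p) s) (at s)"
      unfolding w_def using deriv[OF step.hyps(2), of s]
      by (auto intro!: derivative_eq_intros simp: q)
    moreover have "exp (- (\<gamma> * s)) * u (Suc j) s = poly p s"
      unfolding p by (simp flip: mult.assoc exp_add)
    ultimately show ?thesis by (simp add: algebra_simps)
  qed
  then have w: "w s = w 0" for s
    using DERIV_isconst_all by blast
  have "u j s = exp (\<gamma> * s) * poly (q + [:w 0:]) s" for s
  proof -
    have e: "exp (\<gamma> * s) * exp (- (\<gamma> * s)) = 1" by (simp flip: exp_add)
    have "u j s = exp (\<gamma> * s) * (exp (- (\<gamma> * s)) * u j s)"
      by (simp only: mult.assoc[symmetric] e mult_1)
    also have "exp (- (\<gamma> * s)) * u j s = poly (q + [:w 0:]) s"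
      using w[of s] by (simp add: w_def)
    finally show ?thesis .
  qed
  then show ?case by blast
qed

lemma poly_mult_exp_tendsto_0:
  fixes p :: "real poly"
  assumes "b > 0"
  shows "((\<lambda>s. poly p s * exp (- (b * s))) \<longlongrightarrow> 0) at_top"
proof -
  have k: "((\<lambda>s. s ^ k * exp (- (b * s))) \<longlongrightarrow> 0) at_top" for k
  proof -
    have "((\<lambda>s. (b * s) ^ k / exp (b * s)) \<longlongrightarrow> 0) at_top"
      using assms by (intro filterlim_compose[OF tendsto_power_div_exp_0]
          filterlim_tendsto_pos_mult_at_top[OF tendsto_const _ filterlim_ident])
    from tendsto_mult_left[OF this, of "1 / b ^ k"]
    have "((\<lambda>s. 1 / b ^ k * ((b * s) ^ k / exp (b * s))) \<longlongrightarrow> 0) at_top" by simp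
    moreover have "1 / b ^ k * ((b * s) ^ k / exp (b * s)) = s ^ k * exp (- (b * s))" for s
      using assms by (simp add: power_mult_distrib exp_minus field_simps)
    ultimately show ?thesis by (simp only:)
  qed
  have "((\<lambda>s. \<Sum>i\<le>degree p. coeff p i * (s ^ i * exp (- (b * s)))) \<longlongrightarrow> (\<Sum>i\<le>degree p. coeff p i * 0)) at_top"
    by (intro tendsto_sum tendsto_mult tendsto_const k)
  then show ?thesis by (simp add: poly_altdef sum_distrib_right mult.assoc)
qed

lemma poly_tendsto_0_imp_eq_0:
  fixes p :: "real poly"
  assumes "(poly p \<longlongrightarrow> 0) at_top"
  shows "p = 0"
proof (rule ccontr)
  assume "p \<noteq> 0"
  have *: False if "lead_coeff q > 0" "(poly q \<longlongrightarrow> 0) at_top" for q :: "real poly"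
  proof -
    from poly_pinfty_gt_lc[OF that(1)] obtain n where n: "\<And>x. x \<ge> n \<Longrightarrow> lead_coeff q \<le> poly q x" by blast
    have "lead_coeff q \<le> 0"
    proof (rule tendsto_lowerbound[OF that(2)])
      show "eventually (\<lambda>x. lead_coeff q \<le> poly q x) at_top"
        by (rule eventually_mono[OF eventually_ge_at_top[of n]]) (rule n)
    qed simp
    then show False using that(1) by simp
  qed
  show False
  proof (cases "lead_coeff p > 0")
    case True
    then show False using * assms by blast
  next
    case False
    then have "lead_coeff (- p) > 0" using \<open>p \<noteq> 0\<close>
      by (simp add: less_le lead_coeff_minus)
    moreover have "(poly (- p) \<longlongrightarrow> 0) at_top"
    proof -
      have "poly (- p) = (\<lambda>x. - poly p x)" by (rule ext) simp
      then show ?thesis using tendsto_minus[OF assms] by (simp only: minus_zero)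
    qed
    ultimately show False using * by blast
  qed
qed

text \<open>Once the coefficients below \<open>m\<close> are known to vanish, multiplication by exp
  (m c s) leaves the polynomial \<open>\<pi> m\<close> plus decaying terms. The whole still tends to
  0 because m \<le> n, and a polynomial that tends to 0 is zero.\<close>

lemma exp_poly_sum_eq_0:
  fixes \<pi> :: "nat \<Rightarrow> real poly"
  assumes c: "c > 0" and "n < N"
    and lim: "((\<lambda>s. exp (real n * c * s) * (\<Sum>m<N. exp (- (real m * c * s)) * poly (\<pi> m) s)) \<longlongrightarrow> 0) at_top"
    and "m \<le> n"
  shows "\<pi> m = 0"
  using \<open>m \<le> n\<close>
proof (induction m rule: less_induct)
  case (less m)
  let ?S = "\<lambda>s. \<Sum>l<N. exp (- (real l * c * s)) * poly (\<pi> l) s"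
  have "((\<lambda>s. exp (real m * c * s) * ?S s) \<longlongrightarrow> 0) at_top"
  proof (rule Lim_null_comparison)
    show "((\<lambda>s. norm (exp (real n * c * s) * ?S s)) \<longlongrightarrow> 0) at_top"
      using tendsto_norm[OF lim] by simp
    show "eventually (\<lambda>s. norm (exp (real m * c * s) * ?S s) \<le> norm (exp (real n * c * s) * ?S s)) at_top"
    proof (rule eventually_mono[OF eventually_ge_at_top[of 0]])
      fix s :: real assume "0 \<le> s"
      then have "real m * c * s \<le> real n * c * s"
        using less.prems c by (intro mult_right_mono) auto
      then show "norm (exp (real m * c * s) * ?S s) \<le> norm (exp (real n * c * s) * ?S s)"
        unfolding norm_mult by (intro mult_right_mono) auto
    qed
  qed
  moreover have "exp (real m * c * s) * ?S s =
      poly (\<pi> m) s + (\<Sum>l\<in>{m<..<N}. poly (\<pi> l) s * exp (- (real (l - m) * c * s)))" for s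
  proof -
    have "exp (real m * c * s) * ?S s = (\<Sum>l<N. exp (real m * c * s) * (exp (- (real l * c * s)) * poly (\<pi> l) s))"
      by (simp add: sum_distrib_left)
    also have "\<dots> = (\<Sum>l\<in>insert m {m<..<N}. exp (real m * c * s) * (exp (- (real l * c * s)) * poly (\<pi> l) s))"
    proof (rule sum.mono_neutral_right)
      show "\<forall>l\<in>{..<N} - insert m {m<..<N}. exp (real m * c * s) * (exp (- (real l * c * s)) * poly (\<pi> l) s) = 0"
      proof
        fix l assume "l \<in> {..<N} - insert m {m<..<N}"
        then have "l < m" by auto
        then show "exp (real m * c * s) * (exp (- (real l * c * s)) * poly (\<pi> l) s) = 0"
          using less.IH[of l] less.prems by simp
      qed
    qed (use less.prems \<open>n < N\<close> in auto)
    also have "\<dots> = poly (\<pi> m) s + (\<Sum>l\<in>{m<..<N}. exp (real m * c * s) * (exp (- (real l * c * s)) * poly (\<pi> l) s))"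
      by (simp add: exp_minus)
    also have "(\<Sum>l\<in>{m<..<N}. exp (real m * c * s) * (exp (- (real l * c * s)) * poly (\<pi> l) s)) =
        (\<Sum>l\<in>{m<..<N}. poly (\<pi> l) s * exp (- (real (l - m) * c * s)))"
    proof (rule sum.cong)
      fix l assume "l \<in> {m<..<N}"
      then have "real m * c * s + - (real l * c * s) = - (real (l - m) * c * s)"
        by (simp add: of_nat_diff algebra_simps)
      then have "exp (real m * c * s) * exp (- (real l * c * s)) = exp (- (real (l - m) * c * s))"
        by (simp only: exp_add[symmetric])
      then show "exp (real m * c * s) * (exp (- (real l * c * s)) * poly (\<pi> l) s) = poly (\<pi> l) s * exp (- (real (l - m) * c * s))"
        by (simp only: mult.assoc[symmetric]) (simp only: mult.commute)
    qed simp
    finally show ?thesis .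
  qed
  ultimately have 1: "((\<lambda>s. poly (\<pi> m) s + (\<Sum>l\<in>{m<..<N}. poly (\<pi> l) s * exp (- (real (l - m) * c * s)))) \<longlongrightarrow> 0) at_top"
    by (simp only:)
  have "((\<lambda>s. \<Sum>l\<in>{m<..<N}. poly (\<pi> l) s * exp (- (real (l - m) * c * s))) \<longlongrightarrow> (\<Sum>l\<in>{m<..<N}. 0)) at_top"
    by (intro tendsto_sum poly_mult_exp_tendsto_0) (use c in auto)
  from tendsto_diff[OF 1 this] have "(poly (\<pi> m) \<longlongrightarrow> 0) at_top" by simp
  then show ?case by (rule poly_tendsto_0_imp_eq_0)
qed

lemma lpoly_decomp:
  assumes "p \<in> lpoly N"
  obtains P where "\<And>m. P m \<in> hpoly m" "p = (\<lambda>v. \<Sum>m<N. P m v)"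
proof -
  from assms have "\<exists>P. (\<forall>m. P m \<in> hpoly m) \<and> p = (\<lambda>v. \<Sum>m<N. P m v)"
    unfolding lpoly_def
  proof induction
    case zero
    show ?case by (intro exI[of _ "\<lambda>_ _. 0"]) (auto intro: hpoly_zero)
  next
    case (add_base f g a)
    then obtain P where P: "\<And>m. P m \<in> hpoly m" "f = (\<lambda>v. \<Sum>m<N. P m v)" by blast
    from add_base.hyps obtain i j k where g: "g = monom3 i j k" and N: "i + j + k < N" by blast
    define P' where "P' m v = P m v + (if m = i + j + k then a else 0) * g v" for m v
    have "P' m \<in> hpoly m" for m
      unfolding P'_def by (cases "m = i + j + k") (auto simp: g intro!: hpoly_add hpoly_scale P monom3_hpoly hpoly_zero)
    moreover have "(\<lambda>v. f v + a * g v) = (\<lambda>v. \<Sum>m<N. P' m v)"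
      using N by (auto simp: P(2) P'_def sum.distrib if_distrib[of "\<lambda>x. x * _"] cong: if_cong)
    ultimately show ?case by blast
  qed
  then show thesis using that by blast
qed

lemma shear_poly:
  assumes "P \<in> hpoly m"
  shows "\<exists>p. \<forall>s. P (shear s v) = poly p s"
  using assms unfolding hpoly_def
proof induction
  case zero
  then show ?case by (intro exI[of _ 0]) simp
next
  case (add_base f g a)
  then obtain p where p: "\<And>s. f (shear s v) = poly p s" by blast
  from add_base.hyps obtain i j k where g: "g = monom3 i j k" by blast
  have "g (shear s v) = poly ([:v $ 1, v $ 2, v $ 3 / 2:] ^ i * [:v $ 2, v $ 3:] ^ j * [:v $ 3:] ^ k) s" for s
    by (simp add: g monom3_def power2_eq_square algebra_simps)
  then have "f (shear s v) + a * g (shear s v) =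
      poly (p + smult a ([:v $ 1, v $ 2, v $ 3 / 2:] ^ i * [:v $ 2, v $ 3:] ^ j * [:v $ 3:] ^ k)) s" for s
    by (simp add: p)
  then show ?case by blast
qed

lemma norm_shear_le:
  assumes "s \<ge> 0"
  shows "norm (shear s v) \<le> poly [:norm v, norm (vector [v $ 2, v $ 3, 0] :: real ^ 3), norm (vector [v $ 3, 0, 0] :: real ^ 3) / 2:] s"
proof -
  have "shear s v = v + s *\<^sub>R vector [v $ 2, v $ 3, 0] + (s\<^sup>2 / 2) *\<^sub>R vector [v $ 3, 0, 0]"
    by (simp add: vec_eq_iff forall_3)
  then have "norm (shear s v) \<le> norm v + norm (s *\<^sub>R (vector [v $ 2, v $ 3, 0] :: real ^ 3)) + norm ((s\<^sup>2 / 2) *\<^sub>R (vector [v $ 3, 0, 0] :: real ^ 3))"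
    by (simp only:) (meson norm_triangle_ineq norm_triangle_le add_right_mono order_trans)
  also have "\<dots> = poly [:norm v, norm (vector [v $ 2, v $ 3, 0] :: real ^ 3), norm (vector [v $ 3, 0, 0] :: real ^ 3) / 2:] s"
    using assms by (simp add: power2_eq_square algebra_simps)
  finally show ?thesis .
qed

lemma exp_taylor_le:
  fixes w :: real
  shows "\<bar>exp w - (\<Sum>m<n. w ^ m / fact m)\<bar> \<le> \<bar>w\<bar> ^ n * exp \<bar>w\<bar>"
proof -
  obtain t where t: "\<bar>t\<bar> \<le> \<bar>w\<bar>" "exp w = (\<Sum>m<n. w ^ m / fact m) + exp t / fact n * w ^ n"
    using Maclaurin_exp_le by blast
  have "\<bar>exp t / fact n * w ^ n\<bar> \<le> exp \<bar>w\<bar> * \<bar>w\<bar> ^ n"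
    unfolding abs_mult power_abs
  proof (rule mult_right_mono)
    have "exp t / fact n \<le> exp t / 1"
      by (intro divide_left_mono) (auto simp: fact_ge_1)
    also have "\<dots> \<le> exp \<bar>w\<bar>" using t(1) by simp
    finally show "\<bar>exp t / fact n\<bar> \<le> exp \<bar>w\<bar>" by simp
  qed simp
  then show ?thesis using t(2) by (simp add: mult.commute)
qed

lemma exp_bounded_exp_affine: "(\<lambda>x. exp (a * norm x + b)) \<in> exp_bounded"
  by (rule exp_boundedI[of _ "exp b" a]) (auto simp: exp_add mult.commute)

lemma linear_nth_hpoly:
  assumes "linear L"
  shows "(\<lambda>v. (L v :: real ^ 3) $ i) \<in> hpoly 1"
proof -
  have "L v $ i = (\<Sum>j\<in>UNIV. (L (axis j 1) $ i) * v $ j)" for v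
  proof -
    have "v = (\<Sum>j\<in>UNIV. v $ j *\<^sub>R axis j 1)"
      using basis_expansion[of v] by (simp add: scalar_mult_eq_scaleR)
    then have "L v = (\<Sum>j\<in>UNIV. v $ j *\<^sub>R L (axis j 1))"
      using linear_sum[OF assms, of "\<lambda>j. v $ j *\<^sub>R axis j 1" UNIV] linear_cmul[OF assms] by simp
    then show ?thesis by (simp add: mult.commute)
  qed
  then have "(\<lambda>v. L v $ i) = (\<lambda>v. \<Sum>j\<in>UNIV. (L (axis j 1) $ i) * v $ j)" by (rule ext)
  then show ?thesis by (rule ssubst) (intro hpoly_sum hpoly_scale hpoly_nth)
qed

section \<open>Smoothed functions near the fixed point and along the flow\<close>

context OU_process
begin

text \<open>The exponent is a polynomial of degree two in \<open>\<zeta>\<close>, so its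
  \<open>m\<close>-th power has degree at most \<open>2 * m\<close>, whence the strict bound. The
  weight \<open>e\<close> takes up the coordinates of x that accompany the linear part.\<close>

lemma wick_exponent_moment_lpoly:
  assumes f: "f \<in> L2 \<mu>" and "e \<in> exp_bounded"
  shows "(\<lambda>\<zeta>. \<integral>x. f x * (e x * (eta \<zeta> \<bullet> x - (cov *v eta \<zeta>) \<bullet> eta \<zeta>) ^ m) \<partial>\<mu>) \<in> lpoly (2 * m + 1)"
  using assms(2)
proof (induction m arbitrary: e)
  case 0
  then show ?case by (simp add: hpoly_lpoly[OF hpoly_const])
next
  case (Suc m)
  define w where "w \<zeta> x = eta \<zeta> \<bullet> x - (cov *v eta \<zeta>) \<bullet> eta \<zeta>" for \<zeta> x
  define I where "I e \<zeta> = (\<integral>x. f x * (e x * w \<zeta> x ^ m) \<partial>\<mu>)" for e \<zeta>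
  have IH: "I e \<in> lpoly (Suc (2 * m))" if "e \<in> exp_bounded" for e
    using Suc.IH[OF that] unfolding I_def w_def by simp
  have wb: "w \<zeta> \<in> exp_bounded" for \<zeta>
    unfolding w_def[abs_def] by (rule exp_bounded_affine)
  have int: "integrable \<mu> (\<lambda>x. f x * (e x * w \<zeta> x ^ m))" if "e \<in> exp_bounded" for e \<zeta>
    using that by (intro L2_mult_integrable f exp_bounded_L2 exp_bounded_mult exp_bounded_power wb)
  have xe: "(\<lambda>x. x $ i * e x) \<in> exp_bounded" for i
    by (intro exp_bounded_mult exp_bounded_nth Suc.prems)
  have "(\<integral>x. f x * (e x * w \<zeta> x ^ Suc m) \<partial>\<mu>) =
     eta \<zeta> $ 1 * I (\<lambda>x. x $ 1 * e x) \<zeta> + eta \<zeta> $ 2 * I (\<lambda>x. x $ 2 * e x) \<zeta> + eta \<zeta> $ 3 * I (\<lambda>x. x $ 3 * e x) \<zeta>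
       - ((cov *v eta \<zeta>) \<bullet> eta \<zeta>) * I e \<zeta>" for \<zeta>
  proof -
    have "(\<integral>x. f x * (e x * w \<zeta> x ^ Suc m) \<partial>\<mu>) =
      (\<integral>x. eta \<zeta> $ 1 * (f x * ((x $ 1 * e x) * w \<zeta> x ^ m)) + eta \<zeta> $ 2 * (f x * ((x $ 2 * e x) * w \<zeta> x ^ m))
        + eta \<zeta> $ 3 * (f x * ((x $ 3 * e x) * w \<zeta> x ^ m)) - ((cov *v eta \<zeta>) \<bullet> eta \<zeta>) * (f x * (e x * w \<zeta> x ^ m)) \<partial>\<mu>)"
    proof (rule Bochner_Integration.integral_cong)
      fix x
      have "w \<zeta> x = eta \<zeta> $ 1 * x $ 1 + eta \<zeta> $ 2 * x $ 2 + eta \<zeta> $ 3 * x $ 3 - (cov *v eta \<zeta>) \<bullet> eta \<zeta>"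
        by (simp add: w_def inner_vec_def[of "eta \<zeta>"] sum_3)
      then have "w \<zeta> x ^ Suc m = (eta \<zeta> $ 1 * x $ 1 + eta \<zeta> $ 2 * x $ 2 + eta \<zeta> $ 3 * x $ 3 - (cov *v eta \<zeta>) \<bullet> eta \<zeta>) * w \<zeta> x ^ m"
        by simp
      then show "f x * (e x * w \<zeta> x ^ Suc m) =
        eta \<zeta> $ 1 * (f x * ((x $ 1 * e x) * w \<zeta> x ^ m)) + eta \<zeta> $ 2 * (f x * ((x $ 2 * e x) * w \<zeta> x ^ m))
        + eta \<zeta> $ 3 * (f x * ((x $ 3 * e x) * w \<zeta> x ^ m)) - ((cov *v eta \<zeta>) \<bullet> eta \<zeta>) * (f x * (e x * w \<zeta> x ^ m))"
        by (simp only:) (simp only: left_diff_distrib distrib_right right_diff_distrib distrib_left mult_ac)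
    qed simp
    also have "\<dots> = eta \<zeta> $ 1 * I (\<lambda>x. x $ 1 * e x) \<zeta> + eta \<zeta> $ 2 * I (\<lambda>x. x $ 2 * e x) \<zeta> + eta \<zeta> $ 3 * I (\<lambda>x. x $ 3 * e x) \<zeta>
       - ((cov *v eta \<zeta>) \<bullet> eta \<zeta>) * I e \<zeta>"
      unfolding I_def using int[OF xe] int[OF Suc.prems] by simp
    finally show ?thesis .
  qed
  moreover have "(\<lambda>\<zeta>. eta \<zeta> $ 1 * I (\<lambda>x. x $ 1 * e x) \<zeta> + eta \<zeta> $ 2 * I (\<lambda>x. x $ 2 * e x) \<zeta> + eta \<zeta> $ 3 * I (\<lambda>x. x $ 3 * e x) \<zeta>
       - ((cov *v eta \<zeta>) \<bullet> eta \<zeta>) * I e \<zeta>) \<in> lpoly (3 + 2 * m)"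
  proof (intro lpoly_diff lpoly_add)
    have e1: "(\<lambda>\<zeta>. eta \<zeta> $ i) \<in> hpoly 1" for i by (rule linear_nth_hpoly[OF linear_eta])
    have "(\<lambda>\<zeta>. eta \<zeta> $ i * I (\<lambda>x. x $ i * e x) \<zeta>) \<in> lpoly (3 + 2 * m)" for i
      by (intro lpoly_mult IH xe hpoly_lpoly[OF e1]) simp
    then show "(\<lambda>\<zeta>. eta \<zeta> $ 1 * I (\<lambda>x. x $ 1 * e x) \<zeta>) \<in> lpoly (3 + 2 * m)"
      "(\<lambda>\<zeta>. eta \<zeta> $ 2 * I (\<lambda>x. x $ 2 * e x) \<zeta>) \<in> lpoly (3 + 2 * m)"
      "(\<lambda>\<zeta>. eta \<zeta> $ 3 * I (\<lambda>x. x $ 3 * e x) \<zeta>) \<in> lpoly (3 + 2 * m)" by blast+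
    have "(\<lambda>\<zeta>. (cov *v eta \<zeta>) $ i) \<in> hpoly 1" for i
      using linear_compose[OF linear_eta matrix_vector_mul_linear[of cov]]
      by (intro linear_nth_hpoly) (simp add: o_def)
    then have "(\<lambda>\<zeta>. (cov *v eta \<zeta>) $ 1 * eta \<zeta> $ 1 + (cov *v eta \<zeta>) $ 2 * eta \<zeta> $ 2 + (cov *v eta \<zeta>) $ 3 * eta \<zeta> $ 3) \<in> hpoly (1 + 1)"
      by (intro hpoly_add hpoly_mult e1)
    then have "(\<lambda>\<zeta>. (cov *v eta \<zeta>) \<bullet> eta \<zeta>) \<in> hpoly 2"
      by (simp add: inner_vec_def[of _ "eta _"] sum_3 numeral_2_eq_2)
    then show "(\<lambda>\<zeta>. ((cov *v eta \<zeta>) \<bullet> eta \<zeta>) * I e \<zeta>) \<in> lpoly (3 + 2 * m)"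
      by (intro lpoly_mult IH Suc.prems hpoly_lpoly[of _ 2]) simp_all
  qed
  ultimately show ?case by (simp add: w_def numeral_3_eq_3)
qed

text \<open>The exponential in the density of the translate is expanded up to its
  \<open>n\<close>-th power under the integral. Since the exponent is quadratic in
  \<open>\<zeta>\<close>, the polynomial \<open>P\<close> may reach degree \<open>2 * n\<close>; its
  parts of degree above \<open>n\<close> are small enough near 0 to be harmless later.\<close>

lemma smooth_taylor:
  assumes f: "f \<in> L2 \<mu>"
  obtains P C where "P \<in> lpoly (2 * n + 1)" "C \<ge> 0"
    "\<And>\<zeta>. norm \<zeta> \<le> 1 \<Longrightarrow> \<bar>smooth f \<zeta> - P \<zeta>\<bar> \<le> C * norm \<zeta> ^ (n + 1)"
proof -
  define w where "w \<zeta> x = eta \<zeta> \<bullet> x - (cov *v eta \<zeta>) \<bullet> eta \<zeta>" for \<zeta> x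
  define P where "P \<zeta> = (\<Sum>m<n + 1. (1 / fact m) * (\<integral>x. f x * (1 * w \<zeta> x ^ m) \<partial>\<mu>))" for \<zeta>
  have [measurable]: "f \<in> borel_measurable borel" by (rule L2_measurable[OF f])
  obtain K1 where K1: "K1 > 0" "\<And>\<zeta>. norm (eta \<zeta>) \<le> norm \<zeta> * K1"
    using bounded_linear.pos_bounded[OF linear_conv_bounded_linear[THEN iffD1, OF linear_eta]] by blast
  obtain K2 where K2: "K2 > 0" "\<And>x. norm (cov *v x) \<le> norm x * K2"
    using bounded_linear.pos_bounded[OF linear_conv_bounded_linear[THEN iffD1, OF matrix_vector_mul_linear[of cov]]] by blast
  \<comment> \<open>Bounds the quadratic part of the exponent; one of its two factors
    \<open>norm \<zeta>\<close> is estimated by 1, so that the whole exponent is at most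
    \<open>norm \<zeta>\<close> times a function of x alone.\<close>
  define b where "b = K1 * K1 * K2"
  have "b \<ge> 0" using K1 K2 by (simp add: b_def)
  define h where "h x = K1 * norm x + b" for x :: "real ^ 3"
  have h0: "h x \<ge> 0" for x using K1 \<open>b \<ge> 0\<close> by (simp add: h_def)
  have wh: "\<bar>w \<zeta> x\<bar> \<le> norm \<zeta> * h x" if "norm \<zeta> \<le> 1" for \<zeta> x
  proof -
    have 1: "\<bar>eta \<zeta> \<bullet> x\<bar> \<le> norm \<zeta> * (K1 * norm x)"
      using Cauchy_Schwarz_ineq2[of "eta \<zeta>" x] mult_right_mono[OF K1(2)[of \<zeta>], of "norm x"] by (simp add: mult.assoc)
    have "\<bar>(cov *v eta \<zeta>) \<bullet> eta \<zeta>\<bar> \<le> norm (cov *v eta \<zeta>) * norm (eta \<zeta>)" by (rule Cauchy_Schwarz_ineq2)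
    also have "\<dots> \<le> (norm (eta \<zeta>) * K2) * norm (eta \<zeta>)" by (intro mult_right_mono K2) simp
    also have "\<dots> \<le> ((norm \<zeta> * K1) * K2) * (norm \<zeta> * K1)"
      using K1 K2 by (intro mult_mono mult_nonneg_nonneg) auto
    also have "\<dots> = norm \<zeta> * (norm \<zeta> * b)" by (simp add: b_def mult_ac)
    also have "\<dots> \<le> norm \<zeta> * (1 * b)" using that \<open>b \<ge> 0\<close> by (intro mult_left_mono mult_right_mono) auto
    finally have 2: "\<bar>(cov *v eta \<zeta>) \<bullet> eta \<zeta>\<bar> \<le> norm \<zeta> * b" by simp
    show ?thesis using 1 2 unfolding w_def h_def distrib_left by linarith
  qed
  define H where "H x = h x ^ (n + 1) * exp (h x)" for x
  have Hb: "H \<in> exp_bounded"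
    unfolding H_def h_def
    by (intro exp_bounded_mult exp_bounded_power exp_bounded_add exp_bounded_const exp_bounded_norm exp_bounded_exp_affine)
  have fabs: "(\<lambda>x. \<bar>f x\<bar>) \<in> L2 \<mu>" using f by (auto simp: L2_def)
  have HI: "integrable \<mu> (\<lambda>x. \<bar>f x\<bar> * H x)" by (intro L2_mult_integrable fabs exp_bounded_L2 Hb)
  define C where "C = (\<integral>x. \<bar>f x\<bar> * H x \<partial>\<mu>)"
  have H0: "H x \<ge> 0" for x using h0[of x] by (simp add: H_def)
  have C0: "C \<ge> 0" unfolding C_def by (rule Bochner_Integration.integral_nonneg) (simp add: H0)
  have wb: "w \<zeta> \<in> exp_bounded" for \<zeta>
    unfolding w_def[abs_def] by (rule exp_bounded_affine)
  have est: "\<bar>smooth f \<zeta> - P \<zeta>\<bar> \<le> C * norm \<zeta> ^ (n + 1)" if z: "norm \<zeta> \<le> 1" for \<zeta>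
  proof -
    define S where "S x = (\<Sum>m<n + 1. w \<zeta> x ^ m / fact m)" for x
    have int: "integrable \<mu> (\<lambda>x. f x * (1 * w \<zeta> x ^ m))" for m
      by (intro L2_mult_integrable f exp_bounded_L2 exp_bounded_mult exp_bounded_const exp_bounded_power wb)
    have PS: "P \<zeta> = (\<integral>x. f x * S x \<partial>\<mu>)" and SI: "integrable \<mu> (\<lambda>x. f x * S x)"
    proof -
      have S: "f x * S x = (\<Sum>m<n + 1. (1 / fact m) * (f x * (1 * w \<zeta> x ^ m)))" for x
        unfolding S_def sum_distrib_left by (rule sum.cong) simp_all
      show "integrable \<mu> (\<lambda>x. f x * S x)"
        unfolding S by (intro Bochner_Integration.integrable_sum integrable_mult_right int)
      show "P \<zeta> = (\<integral>x. f x * S x \<partial>\<mu>)"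
        unfolding S P_def by (subst Bochner_Integration.integral_sum) (use int in auto)
    qed
    have wexp: "wick_exp (eta \<zeta>) x = exp (w \<zeta> x)" for x by (simp add: wick_exp_def w_def)
    have EI: "integrable \<mu> (\<lambda>x. f x * exp (w \<zeta> x))"
      unfolding wexp[symmetric] by (intro L2_mult_integrable f exp_bounded_L2 wick_exp_bounded)
    have "smooth f \<zeta> - P \<zeta> = (\<integral>x. f x * exp (w \<zeta> x) - f x * S x \<partial>\<mu>)"
      unfolding translate_integrable(2)[OF f] wexp PS
      by (rule Bochner_Integration.integral_diff[symmetric, OF EI SI])
    also have "\<bar>\<dots>\<bar> \<le> (\<integral>x. norm \<zeta> ^ (n + 1) * (\<bar>f x\<bar> * H x) \<partial>\<mu>)"
    proof (rule integral_abs_bound[THEN order_trans], rule integral_mono)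
      show "integrable \<mu> (\<lambda>x. \<bar>f x * exp (w \<zeta> x) - f x * S x\<bar>)" using EI SI by auto
      show "integrable \<mu> (\<lambda>x. norm \<zeta> ^ (n + 1) * (\<bar>f x\<bar> * H x))" using HI by simp
      fix x
      have "\<bar>f x * exp (w \<zeta> x) - f x * S x\<bar> = \<bar>f x\<bar> * \<bar>exp (w \<zeta> x) - S x\<bar>"
        by (simp add: right_diff_distrib[symmetric] abs_mult)
      also have "\<dots> \<le> \<bar>f x\<bar> * (\<bar>w \<zeta> x\<bar> ^ (n + 1) * exp \<bar>w \<zeta> x\<bar>)"
        unfolding S_def by (intro mult_left_mono exp_taylor_le) simp
      also have "\<dots> \<le> \<bar>f x\<bar> * ((norm \<zeta> * h x) ^ (n + 1) * exp (h x))"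
      proof (intro mult_left_mono mult_mono power_mono)
        have "norm \<zeta> * h x \<le> 1 * h x" using z h0[of x] by (intro mult_right_mono) auto
        then show "exp \<bar>w \<zeta> x\<bar> \<le> exp (h x)" using wh[OF z, of x] by simp
      qed (use wh[OF z, of x] h0[of x] in auto)
      also have "\<dots> = norm \<zeta> ^ (n + 1) * (\<bar>f x\<bar> * H x)"
        by (simp only: H_def power_mult_distrib mult_ac)
      finally show "\<bar>f x * exp (w \<zeta> x) - f x * S x\<bar> \<le> norm \<zeta> ^ (n + 1) * (\<bar>f x\<bar> * H x)" .
    qed
    also have "\<dots> = C * norm \<zeta> ^ (n + 1)" by (simp add: C_def mult.commute)
    finally show ?thesis .
  qed
  have "P \<in> lpoly (2 * n + 1)"
    unfolding P_def
  proof (intro lpoly_sum lpoly_scale)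
    fix m assume "m \<in> {..<n + 1}"
    then show "(\<lambda>\<zeta>. \<integral>x. f x * (1 * w \<zeta> x ^ m) \<partial>\<mu>) \<in> lpoly (2 * n + 1)"
      unfolding w_def by (intro lpoly_le[OF wick_exponent_moment_lpoly[OF f exp_bounded_const]]) auto
  qed
  then show thesis using C0 est by (intro that[of P C])
qed

text \<open>Along the flow the norm is at most a polynomial times exp (- c s), so the Taylor
  remainder of order n + 1 is negligible against exp (- n c s). All terms of order up to n must then
  cancel.\<close>

lemma smooth_hpoly_of_decay:
  assumes f: "f \<in> L2 \<mu>"
    and decay: "\<And>\<zeta>. \<exists>p. \<forall>s. smooth f (flow c s \<zeta>) = exp (- (real n * c * s)) * poly p s"
  shows "smooth f \<in> hpoly n"
proof -
  obtain P C where P: "P \<in> lpoly (2 * n + 1)" and C: "C \<ge> 0"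
    "\<And>\<zeta>. norm \<zeta> \<le> 1 \<Longrightarrow> \<bar>smooth f \<zeta> - P \<zeta>\<bar> \<le> C * norm \<zeta> ^ (n + 1)"
    using smooth_taylor[OF f, where n = n] by metis
  define N where "N = 2 * n + 1"
  obtain Q where Q: "\<And>m. Q m \<in> hpoly m" "P = (\<lambda>v. \<Sum>m<N. Q m v)"
    using lpoly_decomp[OF P] unfolding N_def by blast
  have "smooth f \<zeta> = Q n \<zeta>" for \<zeta>
  proof -
    obtain p where p: "\<And>s. smooth f (flow c s \<zeta>) = exp (- (real n * c * s)) * poly p s"
      using decay by blast
    have "\<forall>m. \<exists>\<pi>. \<forall>s. Q m (shear s \<zeta>) = poly \<pi> s" using shear_poly Q(1) by blast
    then obtain \<pi> where \<pi>: "\<And>m s. Q m (shear s \<zeta>) = poly (\<pi> m) s" by metis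
    \<comment> \<open>The assumed expansion of \<open>smooth f\<close> is merged into the
      coefficient of order \<open>n\<close>; its vanishing says that \<open>p\<close> equals
      \<open>\<pi> n\<close>, and s = 0 gives the value at \<open>\<zeta>\<close> itself.\<close>
    define \<pi>' where "\<pi>' m = (if m = n then \<pi> n - p else \<pi> m)" for m
    have Qf: "Q m (flow c s \<zeta>) = exp (- (real m * c * s)) * poly (\<pi> m) s" for m s
    proof -
      have "Q m (flow c s \<zeta>) = exp (- (c * s)) ^ m * Q m (shear s \<zeta>)"
        unfolding flow_def by (rule hpoly_homogeneous[OF Q(1)])
      then show ?thesis by (simp add: \<pi> flip: exp_of_nat_mult)
    qed
    have diff: "(\<Sum>m<N. exp (- (real m * c * s)) * poly (\<pi>' m) s) = P (flow c s \<zeta>) - smooth f (flow c s \<zeta>)" for s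
    proof -
      have "(\<Sum>m<N. exp (- (real m * c * s)) * poly (\<pi>' m) s) =
          (\<Sum>m<N. exp (- (real m * c * s)) * poly (\<pi> m) s - (if m = n then exp (- (real n * c * s)) * poly p s else 0))"
        by (rule sum.cong) (auto simp: \<pi>'_def algebra_simps)
      also have "\<dots> = P (flow c s \<zeta>) - smooth f (flow c s \<zeta>)"
        unfolding Q(2) p Qf by (simp add: sum_subtractf N_def)
      finally show ?thesis .
    qed
    define q where "q = [:norm \<zeta>, norm (vector [\<zeta> $ 2, \<zeta> $ 3, 0] :: real ^ 3), norm (vector [\<zeta> $ 3, 0, 0] :: real ^ 3) / 2:]"
    have nf: "norm (flow c s \<zeta>) \<le> poly q s * exp (- (c * s))" if "s \<ge> 0" for s
      using norm_shear_le[OF that, of \<zeta>] unfolding flow_def q_def by (simp add: mult.commute)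
    have ev1: "eventually (\<lambda>s. poly q s * exp (- (c * s)) < 1) at_top"
      using order_tendstoD(2)[OF poly_mult_exp_tendsto_0[OF c_pos, of q]] by simp
    have "((\<lambda>s. exp (real n * c * s) * (\<Sum>m<N. exp (- (real m * c * s)) * poly (\<pi>' m) s)) \<longlongrightarrow> 0) at_top"
    proof (rule Lim_null_comparison)
      show "eventually (\<lambda>s. norm (exp (real n * c * s) * (\<Sum>m<N. exp (- (real m * c * s)) * poly (\<pi>' m) s))
          \<le> C * (poly (q ^ (n + 1)) s * exp (- (c * s)))) at_top"
        using ev1 eventually_ge_at_top[of 0]
      proof eventually_elim
        case (elim s)
        have "\<bar>P (flow c s \<zeta>) - smooth f (flow c s \<zeta>)\<bar> \<le> C * norm (flow c s \<zeta>) ^ (n + 1)"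
          using C(2)[of "flow c s \<zeta>"] nf[OF elim(2)] elim(1) by (simp add: abs_minus_commute)
        also have "\<dots> \<le> C * (poly q s * exp (- (c * s))) ^ (n + 1)"
          using nf[OF elim(2)] C(1) by (intro mult_left_mono power_mono) auto
        finally have "exp (real n * c * s) * \<bar>P (flow c s \<zeta>) - smooth f (flow c s \<zeta>)\<bar>
            \<le> exp (real n * c * s) * (C * (poly q s * exp (- (c * s))) ^ (n + 1))"
          by (rule mult_left_mono) simp
        also have "\<dots> = C * (poly (q ^ (n + 1)) s * (exp (real n * c * s) * exp (- (c * s)) ^ (n + 1)))"
          by (simp only: power_mult_distrib poly_power mult_ac)
        also have "exp (real n * c * s) * exp (- (c * s)) ^ (n + 1) = exp (- (c * s))"
          by (simp add: algebra_simps flip: exp_of_nat_mult exp_add)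
        finally show ?case unfolding diff by (simp add: abs_mult)
      qed
      from tendsto_mult_left[OF poly_mult_exp_tendsto_0[OF c_pos, of "q ^ (n + 1)"], of C]
      show "((\<lambda>s. C * (poly (q ^ (n + 1)) s * exp (- (c * s)))) \<longlongrightarrow> 0) at_top" by simp
    qed
    from exp_poly_sum_eq_0[OF c_pos _ this, of n] have "\<pi>' n = 0" by (simp add: N_def)
    then have "p = \<pi> n" by (simp add: \<pi>'_def)
    then show ?thesis using p[of 0] Qf[of n 0] by simp
  qed
  then have "smooth f = Q n" by (rule ext)
  then show ?thesis using Q(1) by simp
qed

text \<open>Along a flow line, the smoothed iterates of the shift satisfy a triangular linear system
  with last function 0, for any exponent \<open>\<nu>\<close>.\<close>

lemma OU_ker_smooth:
  assumes f: "f \<in> OU_ker c \<sigma> \<mu> (- (real n * c)) \<nu>"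
  shows "smooth f \<in> hpoly n"
proof -
  define F where "F j = (OU_shift c \<sigma> \<mu> (- (real n * c)) ^^ j) f" for j
  have dom: "F j \<in> OU_dom c \<sigma> \<mu>" if "j < \<nu>" for j using f that by (simp add: OU_ker_def F_def)
  have fL: "f \<in> L2 \<mu>" using f by (simp add: OU_ker_def)
  have F_Suc: "F (Suc j) = (\<lambda>x. - (real n * c) * F j x - OU_gen c \<sigma> \<mu> (F j) x)" for j
    by (simp add: F_def OU_shift_def)
  have gen: "gen_rel (F j) (OU_gen c \<sigma> \<mu> (F j))" if "j < \<nu>" for j by (rule OU_dom_gen[OF dom[OF that]])
  have FL: "F j \<in> L2 \<mu>" if "j \<le> \<nu>" for j
    using that
  proof (induction j)
    case 0
    then show ?case using fL by (simp add: F_def)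
  next
    case (Suc j)
    then show ?case unfolding F_Suc by (intro L2_diff L2_scale gen_rel_L2(2)[OF gen]) auto
  qed
  have "AE x in \<mu>. F \<nu> x = 0" using f by (simp add: OU_ker_def F_def)
  then have F0: "smooth (F \<nu>) = smooth (\<lambda>x. 0)"
    by (intro smooth_cong_AE FL L2_zero) auto
  have "\<exists>p. \<forall>s. smooth f (flow c s \<zeta>) = exp (- (real n * c * s)) * poly p s" for \<zeta>
  proof -
    define u where "u j s = smooth (F j) (flow c s \<zeta>)" for j s
    have "(u j has_real_derivative - (real n * c) * u j s - u (Suc j) s) (at s)" if j: "j < \<nu>" for j s
    proof -
      have "smooth (F (Suc j)) \<zeta>' = - (real n * c) * smooth (F j) \<zeta>' - smooth (OU_gen c \<sigma> \<mu> (F j)) \<zeta>'" for \<zeta>'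
        unfolding F_Suc using smooth_diff[OF L2_scale[OF FL[OF less_imp_le[OF j]], of "- (real n * c)"] gen_rel_L2(2)[OF gen[OF j]]]
        by (simp only: smooth_scale)
      then show ?thesis
        using gen_flow_deriv[OF gen[OF j], of \<zeta> s] unfolding u_def by simp
    qed
    moreover have "u \<nu> s = 0" for s unfolding u_def F0 by simp
    ultimately obtain p where "\<And>s. u 0 s = exp (- (real n * c) * s) * poly p s"
      using exp_poly_ode[of \<nu> u "- (real n * c)" 0] by blast
    then show ?thesis unfolding u_def F_def by (intro exI[of _ p]) (simp add: mult.assoc)
  qed
  then show ?thesis by (rule smooth_hpoly_of_decay[OF fL])
qed

end

section \<open>Bases of the spectral subspace and of the eigenspace\<close>

lemma sum_chain_idx:
  "(\<Sum>(k, j)\<in>chain_idx n. F k j) = (\<Sum>k\<in>{0..n div 2}. \<Sum>j\<le>2 * (n - 2 * k). F k j)"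
proof -
  have "(\<Sum>(k, j)\<in>chain_idx n. F k j) = (\<Sum>k\<in>{0..n div 2}. \<Sum>j\<in>{0..<2 * n + 1 - 4 * k}. F k j)"
    unfolding chain_idx_def by (rule sum.Sigma[symmetric]) auto
  also have "\<dots> = (\<Sum>k\<in>{0..n div 2}. \<Sum>j\<le>2 * (n - 2 * k). F k j)"
    by (intro sum.cong) auto
  finally show ?thesis .
qed

context OU_process
begin

lemma schain_indep:
  assumes zero: "\<And>\<zeta>. (\<Sum>(k, j)\<in>chain_idx n. a k j * schain n k j \<zeta>) = 0"
    and kj: "(k, j) \<in> chain_idx n"
  shows "a k j = 0"
proof -
  have "(\<Sum>(k, j)\<in>chain_idx n. (a k j * ((- 1) ^ j / chain_const n k)) * chain n k j \<zeta>) = 0" for \<zeta>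
    using zero[of \<zeta>] by (simp only: schain_def mult.assoc)
  from chain_indep[OF this kj] show ?thesis using chain_const_pos[of n k] by simp
qed

lemma hpoly_schain_coeffs:
  assumes "p \<in> hpoly n"
  obtains a where "\<And>\<zeta>. p \<zeta> = (\<Sum>(k, j)\<in>chain_idx n. a k j * schain n k j \<zeta>)"
proof -
  obtain a where a: "p = (\<lambda>x. \<Sum>i\<in>chain_idx n. a i * (\<lambda>(k, j). chain n k j) i x)"
    by (rule lspan_image_coeffs[OF hpoly_chain_span[OF assms] finite_chain_idx])
  show thesis
  proof (rule that[of "\<lambda>k j. a (k, j) * (chain_const n k * (- 1) ^ j)"])
    fix \<zeta>
    have e: "a (k, j) * chain n k j \<zeta> = a (k, j) * (chain_const n k * (- 1) ^ j) * schain n k j \<zeta>" for k j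
      using chain_const_pos[of n k] by (simp add: schain_def flip: power_mult_distrib)
    show "p \<zeta> = (\<Sum>(k, j)\<in>chain_idx n. a (k, j) * (chain_const n k * (- 1) ^ j) * schain n k j \<zeta>)"
      unfolding a
    proof (rule sum.cong)
      fix i show "a i * (\<lambda>(k, j). chain n k j) i \<zeta> =
          (\<lambda>(k, j). a (k, j) * (chain_const n k * (- 1) ^ j) * schain n k j \<zeta>) i"
        by (cases i) (simp only: prod.case e)
    qed simp
  qed
qed

lemma smooth_efun_sum:
  assumes "\<And>k j. (k, j) \<in> I \<Longrightarrow> k \<le> n div 2"
  shows "(\<lambda>x. \<Sum>(k, j)\<in>I. a k j * efun n k j x) \<in> L2 \<mu>"
    and "smooth (\<lambda>x. \<Sum>(k, j)\<in>I. a k j * efun n k j x) \<zeta> = (\<Sum>(k, j)\<in>I. a k j * schain n k j \<zeta>)"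
proof -
  have L: "(\<lambda>x. (\<lambda>(k, j). a k j * efun n k j x) i) \<in> L2 \<mu>" if "i \<in> I" for i
    using that assms by (cases i) (auto intro!: L2_scale efun_L2)
  show "(\<lambda>x. \<Sum>(k, j)\<in>I. a k j * efun n k j x) \<in> L2 \<mu>" by (rule L2_sum[OF L])
  have "smooth (\<lambda>x. \<Sum>(k, j)\<in>I. a k j * efun n k j x) \<zeta> = (\<Sum>i\<in>I. smooth (\<lambda>x. (\<lambda>(k, j). a k j * efun n k j x) i) \<zeta>)"
    by (rule smooth_sum[OF L])
  also have "\<dots> = (\<Sum>(k, j)\<in>I. a k j * schain n k j \<zeta>)"
    using assms by (intro sum.cong) (auto simp: smooth_scale smooth_efun)
  finally show "smooth (\<lambda>x. \<Sum>(k, j)\<in>I. a k j * efun n k j x) \<zeta> = (\<Sum>(k, j)\<in>I. a k j * schain n k j \<zeta>)" .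
qed

lemma chain_idx_le: "(k, j) \<in> chain_idx n \<Longrightarrow> k \<le> n div 2"
  by (simp add: chain_idx_iff)

abbreviation "ou_shift n \<equiv> OU_shift c \<sigma> \<mu> (- (real n * c))"

lemma shift_efun_zero:
  assumes k: "k \<le> n div 2" and "j > 2 * (n - 2 * k)"
  shows "AE x in \<mu>. (ou_shift n ^^ j) (efun n k 0) x = 0"
proof -
  have "AE x in \<mu>. efun n k j x = 0"
    by (rule smooth_inj[OF efun_L2[OF k]]) (simp add: smooth_efun[OF k] schain_eq_0 assms)
  with shift_efun[OF k, of j] show ?thesis by auto
qed

text \<open>Serves both bases: \<nu> = 2 n + 1 admits every member of a chain, \<nu> = 1 the last
  one.\<close>

lemma shift_efun_ker:
  assumes k: "k \<le> n div 2" and "j + \<nu> > 2 * (n - 2 * k)"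
  shows "(ou_shift n ^^ j) (efun n k 0) \<in> OU_ker c \<sigma> \<mu> (- (real n * c)) \<nu>"
proof -
  have "(ou_shift n ^^ i) ((ou_shift n ^^ j) (efun n k 0)) = (ou_shift n ^^ (i + j)) (efun n k 0)" for i
    by (simp add: funpow_add)
  then show ?thesis
    using shift_efun[OF k] shift_efun_zero[OF k, of "\<nu> + j"] assms(2)
    by (simp add: OU_ker_def add.commute)
qed

text \<open>Whatever the exponent \<open>\<nu>\<close>, the smoothed function is a form of degree
  \<open>n\<close>. Its expansion in the chains carries over to \<open>g\<close> by injectivity of
  \<open>smooth\<close>.\<close>

lemma OU_ker_coeffs:
  assumes g: "g \<in> OU_ker c \<sigma> \<mu> (- (real n * c)) \<nu>"
  obtains a where "AE x in \<mu>. g x = (\<Sum>(k, j)\<in>chain_idx n. a k j * efun n k j x)"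
    "\<And>\<zeta>. smooth g \<zeta> = (\<Sum>(k, j)\<in>chain_idx n. a k j * schain n k j \<zeta>)"
proof -
  have gL: "g \<in> L2 \<mu>" using g by (simp add: OU_ker_def)
  obtain a where a: "\<And>\<zeta>. smooth g \<zeta> = (\<Sum>(k, j)\<in>chain_idx n. a k j * schain n k j \<zeta>)"
    by (rule hpoly_schain_coeffs[OF OU_ker_smooth[OF g]]) blast
  have "AE x in \<mu>. g x = (\<Sum>(k, j)\<in>chain_idx n. a k j * efun n k j x)"
    by (rule smooth_eq_imp_AE_eq[OF gL smooth_efun_sum(1)[OF chain_idx_le]])
       (simp_all add: smooth_efun_sum(2)[OF chain_idx_le] a)
  then show thesis using a by (rule that)
qed

lemma AE_shift_efun: "AE x in \<mu>. \<forall>(k, j)\<in>chain_idx n. (ou_shift n ^^ j) (efun n k 0) x = efun n k j x"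
proof -
  have "AE x in \<mu>. \<forall>i\<in>chain_idx n. (\<lambda>(k, j). (ou_shift n ^^ j) (efun n k 0) x = efun n k j x) i"
    by (rule AE_finite_allI[OF finite_chain_idx]) (use shift_efun chain_idx_le in \<open>auto split: prod.splits\<close>)
  then show ?thesis by simp
qed

lemma efun_sum_zero:
  assumes "AE x in \<mu>. (\<Sum>(k, j)\<in>chain_idx n. a k j * efun n k j x) = 0" and "(k, j) \<in> chain_idx n"
  shows "a k j = 0"
proof (rule schain_indep[OF _ assms(2)])
  fix \<zeta>
  have "smooth (\<lambda>x. \<Sum>(k, j)\<in>chain_idx n. a k j * efun n k j x) = smooth (\<lambda>x. 0)"
    by (rule smooth_cong_AE[OF smooth_efun_sum(1)[OF chain_idx_le] L2_zero assms(1)])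
  moreover have "smooth (\<lambda>x. \<Sum>(k, j)\<in>chain_idx n. a k j * efun n k j x) \<zeta> =
      (\<Sum>(k, j)\<in>chain_idx n. a k j * schain n k j \<zeta>)"
    by (rule smooth_efun_sum(2)[OF chain_idx_le])
  ultimately show "(\<Sum>(k, j)\<in>chain_idx n. a k j * schain n k j \<zeta>) = 0" by simp
qed

lemma spectral_basis:
  "L2_basis \<mu> (chain_idx n) (\<lambda>(k, j). (ou_shift n ^^ j) (efun n k 0)) (OU_spectral_subspace c \<sigma> \<mu> n)"
  unfolding L2_basis_def
proof (intro conjI ballI allI impI)
  show "finite (chain_idx n)" by simp
next
  fix i assume "i \<in> chain_idx n"
  then show "(\<lambda>(k, j). (ou_shift n ^^ j) (efun n k 0)) i \<in> OU_spectral_subspace c \<sigma> \<mu> n"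
    unfolding OU_spectral_subspace_def
    by (cases i) (auto simp: chain_idx_iff intro!: shift_efun_ker)
next
  fix a :: "nat \<times> nat \<Rightarrow> real" and i
  assume A: "AE x in \<mu>. (\<Sum>i\<in>chain_idx n. a i * (\<lambda>(k, j). (ou_shift n ^^ j) (efun n k 0)) i x) = 0"
    and i: "i \<in> chain_idx n"
  have "AE x in \<mu>. (\<Sum>(k, j)\<in>chain_idx n. a (k, j) * efun n k j x) = 0"
    using A AE_shift_efun[of n]
  proof eventually_elim
    case (elim x)
    have "(\<Sum>(k, j)\<in>chain_idx n. a (k, j) * efun n k j x) =
        (\<Sum>i\<in>chain_idx n. a i * (\<lambda>(k, j). (ou_shift n ^^ j) (efun n k 0)) i x)"
      using elim(2) by (intro sum.cong) auto
    then show ?case using elim(1) by simp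
  qed
  from efun_sum_zero[OF this, of "fst i" "snd i"] i show "a i = 0" by simp
next
  fix g assume "g \<in> OU_spectral_subspace c \<sigma> \<mu> n"
  then obtain a where "AE x in \<mu>. g x = (\<Sum>(k, j)\<in>chain_idx n. a k j * efun n k j x)"
    unfolding OU_spectral_subspace_def by (rule OU_ker_coeffs)
  then have "AE x in \<mu>. g x = (\<Sum>i\<in>chain_idx n. a (fst i) (snd i) * (\<lambda>(k, j). (ou_shift n ^^ j) (efun n k 0)) i x)"
    using AE_shift_efun[of n]
  proof eventually_elim
    case (elim x)
    have "(\<Sum>(k, j)\<in>chain_idx n. a k j * efun n k j x) =
        (\<Sum>i\<in>chain_idx n. a (fst i) (snd i) * (\<lambda>(k, j). (ou_shift n ^^ j) (efun n k 0)) i x)"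
      using elim(2) by (intro sum.cong) auto
    then show ?case using elim(1) by simp
  qed
  then show "\<exists>a. AE x in \<mu>. g x = (\<Sum>i\<in>chain_idx n. a i * (\<lambda>(k, j). (ou_shift n ^^ j) (efun n k 0)) i x)"
    by (rule exI[of _ "\<lambda>i. a (fst i) (snd i)"])
qed

text \<open>The derivative along the flow at s = 0 is computed twice, from the eigenvalue equation
  and term by term in the expansion. The difference is a linear relation between the chains shifted
  by one place.\<close>

lemma eigenfunction_coeffs:
  assumes g: "g \<in> OU_ker c \<sigma> \<mu> (- (real n * c)) 1"
    and a: "\<And>\<zeta>. smooth g \<zeta> = (\<Sum>(k, j)\<in>chain_idx n. a k j * schain n k j \<zeta>)"
    and kj: "k \<le> n div 2" "j < 2 * (n - 2 * k)"
  shows "a k j = 0"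
proof -
  have gL: "g \<in> L2 \<mu>" and dom: "g \<in> OU_dom c \<sigma> \<mu>" and z: "AE x in \<mu>. ou_shift n g x = 0"
    using g by (simp_all add: OU_ker_def)
  note gen = OU_dom_gen[OF dom]
  have "AE x in \<mu>. OU_gen c \<sigma> \<mu> g x = - (real n * c) * g x"
    using z by eventually_elim (simp add: OU_shift_def)
  then have sg: "smooth (OU_gen c \<sigma> \<mu> g) = smooth (\<lambda>x. - (real n * c) * g x)"
    by (intro smooth_cong_AE gen_rel_L2(2)[OF gen] L2_scale gL)
  have shifted: "(\<Sum>(k, j)\<in>chain_idx n. a k j * schain n k (j + 1) \<zeta>) = 0" for \<zeta>
  proof -
    have 1: "((\<lambda>s. smooth g (flow c s \<zeta>)) has_real_derivative - (real n * c) * smooth g \<zeta>) (at 0)"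
      using gen_flow_deriv[OF gen, of \<zeta> 0] by (simp only: sg smooth_scale flow_0)
    have e: "((\<lambda>s. schain n k j (flow c s \<zeta>)) has_real_derivative
        - (real n * c) * schain n k j \<zeta> - schain n k (j + 1) \<zeta>) (at 0)" if k: "k \<le> n div 2" for k j
    proof -
      have "smooth (\<lambda>x. - (real n * c) * efun n k j x - efun n k (j + 1) x) \<zeta> =
          - (real n * c) * schain n k j \<zeta> - schain n k (j + 1) \<zeta>"
        by (simp only: smooth_diff[OF L2_scale[OF efun_L2[OF k]] efun_L2[OF k]] smooth_scale smooth_efun[OF k])
      then show ?thesis
        using gen_flow_deriv[OF gen_rel_efun[OF k, of j], of \<zeta> 0] by (simp only: smooth_efun[OF k] flow_0)
    qed
    have "((\<lambda>s. \<Sum>i\<in>chain_idx n. a (fst i) (snd i) * schain n (fst i) (snd i) (flow c s \<zeta>)) has_real_derivative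
       (\<Sum>i\<in>chain_idx n. a (fst i) (snd i) * (- (real n * c) * schain n (fst i) (snd i) \<zeta> - schain n (fst i) (snd i + 1) \<zeta>))) (at 0)"
      by (intro DERIV_sum DERIV_cmult e) (auto simp: chain_idx_iff)
    then have 2: "((\<lambda>s. smooth g (flow c s \<zeta>)) has_real_derivative
       (\<Sum>i\<in>chain_idx n. a (fst i) (snd i) * (- (real n * c) * schain n (fst i) (snd i) \<zeta> - schain n (fst i) (snd i + 1) \<zeta>))) (at 0)"
      by (simp only: a split_def)
    have "(\<Sum>i\<in>chain_idx n. a (fst i) (snd i) * (- (real n * c) * schain n (fst i) (snd i) \<zeta> - schain n (fst i) (snd i + 1) \<zeta>)) =
       - (real n * c) * smooth g \<zeta> - (\<Sum>i\<in>chain_idx n. a (fst i) (snd i) * schain n (fst i) (snd i + 1) \<zeta>)"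
      unfolding a split_def sum_distrib_left sum_subtractf[symmetric]
      by (rule sum.cong) (simp_all add: algebra_simps)
    with DERIV_unique[OF 1 2] show ?thesis by (simp add: split_def)
  qed
  \<comment> \<open>The relation rewritten in the unshifted chain members. The last member of each
    chain is shifted to zero, so its coefficient is the only one that escapes.\<close>
  define a' where "a' k j = (if j = 0 then 0 else a k (j - 1))" for k j
  have "(\<Sum>(k, j)\<in>chain_idx n. a' k j * schain n k j \<zeta>) = 0" for \<zeta>
  proof -
    have "(\<Sum>j\<le>2 * (n - 2 * k). a' k j * schain n k j \<zeta>) = (\<Sum>j\<le>2 * (n - 2 * k). a k j * schain n k (j + 1) \<zeta>)" for k
    proof -
      let ?m = "2 * (n - 2 * k)"
      have "(\<Sum>j\<le>?m. a' k j * schain n k j \<zeta>) = (\<Sum>j\<le>Suc ?m. a' k j * schain n k j \<zeta>)"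
        by (simp add: schain_eq_0)
      also have "\<dots> = (\<Sum>j\<le>?m. a k j * schain n k (j + 1) \<zeta>)"
        unfolding sum.atMost_Suc_shift by (simp add: a'_def)
      finally show ?thesis .
    qed
    then show ?thesis using shifted[of \<zeta>] by (simp only: sum_chain_idx)
  qed
  from schain_indep[OF this, of k "j + 1"] kj show ?thesis by (simp add: chain_idx_iff a'_def)
qed

lemma top_sum:
  "(\<Sum>(k, j)\<in>chain_idx n. (if j = 2 * (n - 2 * k) then b k else 0) * F k j) =
     (\<Sum>k\<in>{0..n div 2}. b k * F k (2 * (n - 2 * k)))" for b :: "nat \<Rightarrow> real"
  unfolding sum_chain_idx by (intro sum.cong refl) (simp add: if_distrib[of "\<lambda>x. x * _"] cong: if_cong)

lemma eigenspace_basis: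
  "L2_basis \<mu> {0..n div 2} (\<lambda>k. (ou_shift n ^^ (2 * (n - 2 * k))) (efun n k 0)) (OU_eigenspace c \<sigma> \<mu> (- (real n * c)))"
  unfolding L2_basis_def OU_eigenspace_def
proof (intro conjI ballI allI impI)
  let ?h = "\<lambda>k. (ou_shift n ^^ (2 * (n - 2 * k))) (efun n k 0)"
  have AEh: "AE x in \<mu>. \<forall>k\<in>{0..n div 2}. ?h k x = efun n k (2 * (n - 2 * k)) x"
    by (rule AE_finite_allI) (use shift_efun in auto)
  show "finite {0..n div 2}" by simp
  show "?h k \<in> OU_ker c \<sigma> \<mu> (- (real n * c)) 1" if "k \<in> {0..n div 2}" for k
    using that by (intro shift_efun_ker) auto
  show "b k = 0" if "AE x in \<mu>. (\<Sum>k\<in>{0..n div 2}. b k * ?h k x) = 0" and k: "k \<in> {0..n div 2}" for b k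
  proof -
    have "AE x in \<mu>. (\<Sum>(k, j)\<in>chain_idx n. (if j = 2 * (n - 2 * k) then b k else 0) * efun n k j x) = 0"
      using that(1) AEh
    proof eventually_elim
      case (elim x)
      have "(\<Sum>k\<in>{0..n div 2}. b k * efun n k (2 * (n - 2 * k)) x) = (\<Sum>k\<in>{0..n div 2}. b k * ?h k x)"
        using elim(2) by (intro sum.cong) auto
      then show ?case unfolding top_sum using elim(1) by simp
    qed
    from efun_sum_zero[OF this, of k "2 * (n - 2 * k)"] k show ?thesis by (simp add: chain_idx_iff)
  qed
  fix g assume g: "g \<in> OU_ker c \<sigma> \<mu> (- (real n * c)) 1"
  obtain a where a: "AE x in \<mu>. g x = (\<Sum>(k, j)\<in>chain_idx n. a k j * efun n k j x)"
    "\<And>\<zeta>. smooth g \<zeta> = (\<Sum>(k, j)\<in>chain_idx n. a k j * schain n k j \<zeta>)"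
    by (rule OU_ker_coeffs[OF g]) blast
  define b where "b k = a k (2 * (n - 2 * k))" for k
  have eq: "a k j = (if j = 2 * (n - 2 * k) then b k else 0)" if "(k, j) \<in> chain_idx n" for k j
    using that eigenfunction_coeffs[OF g a(2), of k j] by (auto simp: chain_idx_iff b_def)
  have "AE x in \<mu>. g x = (\<Sum>k\<in>{0..n div 2}. b k * ?h k x)"
    using a(1) AEh
  proof eventually_elim
    case (elim x)
    have "g x = (\<Sum>(k, j)\<in>chain_idx n. (if j = 2 * (n - 2 * k) then b k else 0) * efun n k j x)"
      unfolding elim(1) by (intro sum.cong) (auto simp: eq)
    also have "\<dots> = (\<Sum>k\<in>{0..n div 2}. b k * efun n k (2 * (n - 2 * k)) x)" by (rule top_sum)
    also have "\<dots> = (\<Sum>k\<in>{0..n div 2}. b k * ?h k x)"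
      using elim(2) by (intro sum.cong) auto
    finally show ?case .
  qed
  then show "\<exists>a. AE x in \<mu>. g x = (\<Sum>k\<in>{0..n div 2}. a k * ?h k x)" by (rule exI[of _ b])
qed

text \<open>The projection is meaningful for genuine polynomials only, whereas an iterated shift is
  known up to null sets. It is therefore applied to the polynomial \<open>efun\<close> that
  represents the same element of L2.\<close>

lemma eigenfunction_proj:
  assumes "\<rho> > 0" and k: "k \<le> n div 2"
  shows "\<exists>p. real_polynomial_function p \<and>
     (AE v in \<mu>. (ou_shift n ^^ (2 * (n - 2 * k))) (efun n k 0) v = p v) \<and>
     Hermite_proj \<rho> n p = (\<lambda>v. \<Sum>i=0..k. (- 2) ^ (k - i) * real (k choose i) *
       (Hermite \<rho> (k - i) (v $ 1) * Hermite \<rho> (2 * i) (v $ 2) * Hermite \<rho> (n - k - i) (v $ 3)))"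
proof (intro exI conjI)
  let ?p = "efun n k (2 * (n - 2 * k))"
  show "real_polynomial_function ?p" by (rule lpoly_real_polynomial_function[OF efun_lpoly[OF k]])
  show "AE v in \<mu>. (ou_shift n ^^ (2 * (n - 2 * k))) (efun n k 0) v = ?p v" using shift_efun[OF k] by blast
  show "Hermite_proj \<rho> n ?p = (\<lambda>v. \<Sum>i=0..k. (- 2) ^ (k - i) * real (k choose i) *
       (Hermite \<rho> (k - i) (v $ 1) * Hermite \<rho> (2 * i) (v $ 2) * Hermite \<rho> (n - k - i) (v $ 3)))"
    by (rule Hermite_proj_kernel[OF assms]) (use efun_lead[OF k, of "2 * (n - 2 * k)"] in \<open>simp only: schain_top\<close>)
qed

end

theorem theorem3p1:
  fixes c \<sigma> \<rho> \<gamma> :: real and n r :: nat and q :: "nat \<Rightarrow> nat" and \<mu> :: "(real ^ 3) measure"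
  assumes "c > 0" and "\<sigma> > 0" and "\<rho> = \<sigma>\<^sup>2 / c"
    and "\<gamma> = - (real n * c)" and "r = n div 2"
    and "\<And>k. k \<le> r \<Longrightarrow> q k = 2 * n + 1 - 4 * k"
    and "OU_invariant c \<sigma> \<mu>"
  shows "\<exists>(f :: nat \<Rightarrow> real ^ 3 \<Rightarrow> real) (h :: nat \<Rightarrow> real ^ 3 \<Rightarrow> real).
           L2_basis \<mu> (SIGMA k:{0..r}. {0..<q k})
             (\<lambda>(k, j). (OU_shift c \<sigma> \<mu> \<gamma> ^^ j) (f k)) (OU_spectral_subspace c \<sigma> \<mu> n) \<and>
           (\<forall>k\<le>r. h k = (OU_shift c \<sigma> \<mu> \<gamma> ^^ (q k - 1)) (f k)) \<and>
           L2_basis \<mu> {0..r} h (OU_eigenspace c \<sigma> \<mu> \<gamma>) \<and>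
           (\<forall>k\<le>r. \<exists>p. real_polynomial_function p \<and> (AE v in \<mu>. h k v = p v) \<and>
              Hermite_proj \<rho> n p =
                (\<lambda>v. \<Sum>i=0..k. (- 2) ^ (k - i) * real (k choose i) *
                   (Hermite \<rho> (k - i) (v $ 1) * Hermite \<rho> (2 * i) (v $ 2) *
                    Hermite \<rho> (n - k - i) (v $ 3))))"
proof -
  interpret OU_process c \<sigma> \<mu> by unfold_locales (use assms in auto)
  have "\<rho> > 0" using assms by simp
  have idx: "(SIGMA k:{0..r}. {0..<q k}) = chain_idx n"
    unfolding chain_idx_def using assms(5,6) by (intro Sigma_cong) auto
  \<comment> \<open>No subtraction is cut off here: k \<le> r gives 4 k \<le> 2 n, hence q k \<ge>
    1.\<close>
  have top: "q k - 1 = 2 * (n - 2 * k)" if "k \<le> r" for k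
    using assms(5,6) that by simp
  let ?f = "\<lambda>k. efun n k 0" and ?h = "\<lambda>k. (ou_shift n ^^ (2 * (n - 2 * k))) (efun n k 0)"
  show ?thesis
  proof (rule exI[of _ ?f], rule exI[of _ ?h], intro conjI allI impI)
    show "L2_basis \<mu> (SIGMA k:{0..r}. {0..<q k})
        (\<lambda>(k, j). (OU_shift c \<sigma> \<mu> \<gamma> ^^ j) (?f k)) (OU_spectral_subspace c \<sigma> \<mu> n)"
      unfolding idx assms(4) by (rule spectral_basis)
    show "?h k = (OU_shift c \<sigma> \<mu> \<gamma> ^^ (q k - 1)) (?f k)" if "k \<le> r" for k
      unfolding top[OF that] assms(4) ..
    show "L2_basis \<mu> {0..r} ?h (OU_eigenspace c \<sigma> \<mu> \<gamma>)"
      unfolding assms(4,5) by (rule eigenspace_basis)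
    show "\<exists>p. real_polynomial_function p \<and> (AE v in \<mu>. ?h k v = p v) \<and>
              Hermite_proj \<rho> n p =
                (\<lambda>v. \<Sum>i=0..k. (- 2) ^ (k - i) * real (k choose i) *
                   (Hermite \<rho> (k - i) (v $ 1) * Hermite \<rho> (2 * i) (v $ 2) *
                    Hermite \<rho> (n - k - i) (v $ 3)))" if "k \<le> r" for k
      using eigenfunction_proj[OF \<open>\<rho> > 0\<close>, of k n] that assms(5) by simp
  qed
qed

end
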